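(* Let $\mu$ be a Borel probability measure on $\mathbb{C}$ with compact, infinite support, and let $D=(d_{i,j})_{i,j=1}^{\infty}$ be the Hessenberg matrix associated with $\mu$. Assume that: (1) $\mu$ is regular, and its support $\Gamma=\operatorname{supp}(\mu)$ is a Jordan arc or a finite union of Jordan arcs such that $\mathbb{C}_\infty\setminus\Gamma$ is a simply connected subset of the Riemann sphere $\mathbb{C}_\infty$; (2) the operator $D$ on $\ell^2$ is uniformly asymptotically Toeplitz, and the corresponding limit matrix $T$ has a continuous symbol. Let $\phi:\mathbb{C}_\infty\setminus\overline{\mathbb{D}}\to\mathbb{C}_\infty\setminus\Gamma$ be the Riemann mapping function, extended continuously to the unit circle, and for $n\ge1$ let $$h_n(z)=d_{n+1,n}z+d_{n,n}+\frac{d_{n-1,n}}{z}+\frac{d_{n-2,n}}{z^2}+\cdots+\frac{d_{1,n}}{z^{n-1}}.$$ Then for every $\varepsilon>0$ there is a $\delta>0$ such that for every $r\in(1,1+\delta)$ there is a natural number $N$ such that for all $n\ge N$ $$|h_n(re^{i\theta})-\phi(e^{i\theta})|\le\varepsilon\quad\text{for every }\theta\in[0,2\pi].$$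
   Context: $\mathbb{D}$ is the open unit disk, $\mathbb{T}$ the unit circle, $\mathbb{C}_\infty$ the Riemann sphere. A Jordan arc is a subset of $\mathbb{C}$ homeomorphic to $[0,1]$. Simply connected open sets are understood to be connected. Orthonormal polynomials and Hessenberg matrix: $\{P_n\}_{n\ge 0}$ is the sequence of orthonormal polynomials for $\langle Q,R\rangle_\mu=\int Q\overline{R}\,d\mu$, with $\deg P_n=n$, positive leading coefficient $\gamma_n$, and $P_0=1$. The Hessenberg matrix $D=(d_{i,j})_{i,j\ge1}$ associated with $\mu$ is the infinite upper Hessenberg matrix defined by $zP_n(z)=\sum_{k=0}^{n+1}d_{k+1,n+1}P_k(z)$, $n\ge 0$ (with $d_{i,j}=0$ for $i>j+1$). It is the matrix, in the basis $\{P_n\}$, of multiplication by $z$ on the closure of the polynomials in $L^2(\mu)$, and it is regarded as an operator on $\ell^2$. Regular measure: $\mu$ is regular if $\lim_{n\to\infty}\gamma_n^{-1/n}=\operatorname{cap}(\operatorname{supp}(\mu))$, the logarithmic capacity. Uniformly asymptotically Toeplitz: a bounded operator $A$ on $\ell^2$ is uniformly asymptotically Toeplitz if there is a bounded operator $T$ on $\ell^2$ with $\lim_{n\to\infty}\|S^{*n}AS^n-T\|=0$, where $S$ is the forward (unilateral) shift on $\ell^2$. The limit $T$ is called the limit matrix; it is a Toeplitz matrix, $T=(a_{i-j})_{i,j\ge1}$. Symbol: the symbol of a Toeplitz matrix $T=(a_{i-j})_{i,j\ge1}$ is the function on $\mathbb{T}$ given by the Laurent (Fourier) series $\sum_{k\in\mathbb{Z}}a_kz^k$.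 For $T$ the limit of a Hessenberg matrix, $a_k=0$ for $k\ge 2$, so, writing $d_k=a_k$, the symbol is $f_T(z)=\sum_{k=-1}^\infty d_{-k}z^{-k}$, where $d_k=\lim_{n\to\infty}d_{n+k,n}$. For a bounded $T$ the symbol is the element of $L^\infty(\mathbb{T})$ with these Fourier coefficients; "continuous symbol" means that it has a continuous representative, which is then called the symbol. Riemann mapping function: for a compact $\Gamma\subset\mathbb{C}$, not a point, with $\mathbb{C}_\infty\setminus\Gamma$ simply connected, $\phi$ is the unique conformal (bijective) map $\mathbb{C}_\infty\setminus\overline{\mathbb{D}}\to\mathbb{C}_\infty\setminus\Gamma$ with $\phi(\infty)=\infty$ and $\phi'(\infty)>0$, i.e. with expansion $\phi(z)=c_1z+c_0+c_{-1}z^{-1}+\cdots$ for $|z|>1$ and $c_1>0$ (then $c_1=\operatorname{cap}(\Gamma)$). For $|z|=1$, $\phi(z)$ denotes the value of the continuous extension of $\phi$ to $\{1\le|z|<\infty\}$. *)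

theory Defs
  imports
    "HOL-Complex_Analysis.Complex_Analysis"
    "HOL-Probability.Probability_Measure"
begin

section \<open>The Hilbert space of square-summable complex sequences\<close>

typedef ell2 = "{x :: nat \<Rightarrow> complex. summable (\<lambda>n. (cmod (x n))\<^sup>2)}"
  morphisms ell2_nth Abs_ell2
  by (rule exI[of _ "\<lambda>_. 0"]) simp

setup_lifting type_definition_ell2

lemma square_summable_add:
  fixes x y :: "nat \<Rightarrow> complex"
  assumes "summable (\<lambda>n. (cmod (x n))\<^sup>2)" "summable (\<lambda>n. (cmod (y n))\<^sup>2)"
  shows "summable (\<lambda>n. (cmod (x n + y n))\<^sup>2)"
proof (rule summable_comparison_test')
  show "summable (\<lambda>n. 2 * (cmod (x n))\<^sup>2 + 2 * (cmod (y n))\<^sup>2)"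
    using assms by (intro summable_add summable_mult)
  fix n
  have "(cmod (x n + y n))\<^sup>2 \<le> (cmod (x n) + cmod (y n))\<^sup>2"
    by (intro power_mono norm_triangle_ineq norm_ge_zero)
  also have "\<dots> \<le> 2 * (cmod (x n))\<^sup>2 + 2 * (cmod (y n))\<^sup>2"
    using sum_squares_bound[of "cmod (x n)" "cmod (y n)"] by (simp add: power2_sum)
  finally show "norm ((cmod (x n + y n))\<^sup>2) \<le> 2 * (cmod (x n))\<^sup>2 + 2 * (cmod (y n))\<^sup>2"
    by simp
qed

lemma square_summable_scale:
  fixes x :: "nat \<Rightarrow> complex"
  assumes "summable (\<lambda>n. (cmod (x n))\<^sup>2)"
  shows "summable (\<lambda>n. (cmod (c * x n))\<^sup>2)"
  using summable_mult[OF assms, of "(cmod c)\<^sup>2"] by (simp add: norm_mult power_mult_distrib)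

lemma square_summable_inner:
  fixes x y :: "nat \<Rightarrow> complex"
  assumes "summable (\<lambda>n. (cmod (x n))\<^sup>2)" "summable (\<lambda>n. (cmod (y n))\<^sup>2)"
  shows "summable (\<lambda>n. x n \<bullet> y n)"
proof (rule summable_comparison_test')
  show "summable (\<lambda>n. (cmod (x n))\<^sup>2 + (cmod (y n))\<^sup>2)"
    using assms by (intro summable_add)
  fix n
  have "norm (x n \<bullet> y n) \<le> cmod (x n) * cmod (y n)"
    using Cauchy_Schwarz_ineq2 by simp
  also have "\<dots> \<le> 2 * cmod (x n) * cmod (y n)"
    by simp
  also have "\<dots> \<le> (cmod (x n))\<^sup>2 + (cmod (y n))\<^sup>2"
    by (rule sum_squares_bound)
  finally show "norm (x n \<bullet> y n) \<le> (cmod (x n))\<^sup>2 + (cmod (y n))\<^sup>2" .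
qed

instantiation ell2 :: real_vector
begin

lift_definition zero_ell2 :: ell2 is "\<lambda>_. 0" by simp
lift_definition plus_ell2 :: "ell2 \<Rightarrow> ell2 \<Rightarrow> ell2" is "\<lambda>x y n. x n + y n"
  by (rule square_summable_add)
lift_definition uminus_ell2 :: "ell2 \<Rightarrow> ell2" is "\<lambda>x n. - x n" by simp
lift_definition minus_ell2 :: "ell2 \<Rightarrow> ell2 \<Rightarrow> ell2" is "\<lambda>x y n. x n - y n"
  using square_summable_add[of _ "\<lambda>n. - _ n"] by simp
lift_definition scaleR_ell2 :: "real \<Rightarrow> ell2 \<Rightarrow> ell2" is "\<lambda>c x n. c *\<^sub>R x n"
  unfolding scaleR_conv_of_real by (rule square_summable_scale)

instance
  by standard (transfer; simp add: algebra_simps scaleR_conv_of_real)+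

end

lift_definition ell2_scaleC :: "complex \<Rightarrow> ell2 \<Rightarrow> ell2" is "\<lambda>c x n. c * x n"
  by (rule square_summable_scale)

text \<open>The inner product of the class is the real part of the complex inner product; it induces
  the usual norm, and for complex-linear operators it yields the usual adjoint.\<close>

instantiation ell2 :: real_inner
begin

lift_definition inner_ell2 :: "ell2 \<Rightarrow> ell2 \<Rightarrow> real" is "\<lambda>x y. \<Sum>n. x n \<bullet> y n" .
definition norm_ell2 :: "ell2 \<Rightarrow> real" where "norm_ell2 x = sqrt (x \<bullet> x)"
definition sgn_ell2 :: "ell2 \<Rightarrow> ell2" where "sgn_ell2 x = inverse (norm x) *\<^sub>R x"
definition dist_ell2 :: "ell2 \<Rightarrow> ell2 \<Rightarrow> real" where "dist_ell2 x y = norm (x - y)"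
definition uniformity_ell2 :: "(ell2 \<times> ell2) filter" where
  "uniformity_ell2 = (INF e\<in>{0<..}. principal {(x, y). dist x y < e})"
definition open_ell2 :: "ell2 set \<Rightarrow> bool" where
  "open_ell2 U \<longleftrightarrow> (\<forall>x\<in>U. \<forall>\<^sub>F (x', y) in uniformity. x' = x \<longrightarrow> y \<in> U)"

instance
proof
  fix x y z :: ell2 and r :: real
  show "x \<bullet> y = y \<bullet> x"
    by transfer (simp add: inner_commute)
  show "(x + y) \<bullet> z = x \<bullet> z + y \<bullet> z"
    by transfer (simp add: inner_add_left suminf_add[symmetric] square_summable_inner)
  show "(r *\<^sub>R x) \<bullet> y = r * (x \<bullet> y)"
    by transfer (simp add: suminf_mult square_summable_inner)
  show "0 \<le> x \<bullet> x"
    by transfer (auto intro!: suminf_nonneg square_summable_inner)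
  show "(x \<bullet> x = 0) = (x = 0)"
  proof (transfer, goal_cases)
    case (1 x)
    then have "summable (\<lambda>n. x n \<bullet> x n)"
      by (intro square_summable_inner)
    then have "(\<Sum>n. x n \<bullet> x n) = 0 \<longleftrightarrow> (\<forall>n. x n \<bullet> x n = 0)"
      by (intro suminf_eq_zero_iff) auto
    then show ?case by (auto simp: fun_eq_iff)
  qed
qed (fact norm_ell2_def sgn_ell2_def dist_ell2_def uniformity_ell2_def open_ell2_def)+

end

lift_definition ell2_unit :: "nat \<Rightarrow> ell2" is "\<lambda>j n. if n = j then 1 else 0"
proof -
  fix j :: nat
  show "summable (\<lambda>n. (cmod (if n = j then 1 else 0))\<^sup>2)"
    by (rule summable_finite[of "{j}"]) auto
qed

lift_definition ell2_shift :: "ell2 \<Rightarrow> ell2" is "\<lambda>x n. case n of 0 \<Rightarrow> 0 | Suc m \<Rightarrow> x m"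
proof -
  fix x :: "nat \<Rightarrow> complex"
  assume "summable (\<lambda>n. (cmod (x n))\<^sup>2)"
  then show "summable (\<lambda>n. (cmod (case n of 0 \<Rightarrow> 0 | Suc m \<Rightarrow> x m))\<^sup>2)"
    by (subst summable_Suc_iff[symmetric]) simp
qed

lift_definition ell2_backward_shift :: "ell2 \<Rightarrow> ell2" is "\<lambda>x n. x (Suc n)"
  by (subst summable_Suc_iff)

lemma adjoint_ell2_shift: "adjoint ell2_shift = ell2_backward_shift"
proof (rule adjoint_unique, intro allI)
  fix x y
  show "ell2_shift x \<bullet> y = x \<bullet> ell2_backward_shift y"
  proof (transfer, goal_cases)
    case (1 x y)
    let ?x = "\<lambda>n. case n of 0 \<Rightarrow> 0 | Suc m \<Rightarrow> x m"
    have "summable (\<lambda>n. (cmod (?x n))\<^sup>2)"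
      using 1(1) by (subst summable_Suc_iff[symmetric]) simp
    then have "summable (\<lambda>n. ?x n \<bullet> y n)"
      using 1(2) by (rule square_summable_inner)
    then show ?case
      using suminf_split_head[of "\<lambda>n. ?x n \<bullet> y n"] by simp
  qed
qed

definition bounded_clinear :: "(ell2 \<Rightarrow> ell2) \<Rightarrow> bool" where
  "bounded_clinear A \<longleftrightarrow>
     bounded_linear A \<and> (\<forall>c x. A (ell2_scaleC c x) = ell2_scaleC c (A x))"

text \<open>Entries are indexed from 0 here.\<close>

definition ell2_entry :: "(ell2 \<Rightarrow> ell2) \<Rightarrow> nat \<Rightarrow> nat \<Rightarrow> complex" where
  "ell2_entry A i j = ell2_nth (A (ell2_unit j)) i"

section \<open>Uniformly asymptotically Toeplitz operators and symbols\<close>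

definition unif_asymp_Toeplitz_limit :: "(ell2 \<Rightarrow> ell2) \<Rightarrow> (ell2 \<Rightarrow> ell2) \<Rightarrow> bool" where
  "unif_asymp_Toeplitz_limit A T \<longleftrightarrow>
     bounded_clinear A \<and> bounded_clinear T \<and>
     (\<lambda>n. onorm (\<lambda>x. (adjoint ell2_shift ^^ n) (A ((ell2_shift ^^ n) x)) - T x)) \<longlonglongrightarrow> 0"

definition fourier_coeff :: "(complex \<Rightarrow> complex) \<Rightarrow> int \<Rightarrow> complex" where
  "fourier_coeff f k =
     (LINT \<theta>|lebesgue_on {0..2 * pi}. f (cis \<theta>) * cis (- (of_int k * \<theta>))) / of_real (2 * pi)"

text \<open>A function on the unit circle, given as a function on the plane whose values off the circle
  are irrelevant.\<close>

definition Linfty_circle :: "(complex \<Rightarrow> complex) \<Rightarrow> bool" where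
  "Linfty_circle f \<longleftrightarrow>
     (\<lambda>\<theta>. f (cis \<theta>)) \<in> borel_measurable (lebesgue_on {0..2 * pi}) \<and>
     (\<exists>C. AE \<theta> in lebesgue_on {0..2 * pi}. cmod (f (cis \<theta>)) \<le> C)"

definition Toeplitz_symbol :: "(ell2 \<Rightarrow> ell2) \<Rightarrow> (complex \<Rightarrow> complex) \<Rightarrow> bool" where
  "Toeplitz_symbol T f \<longleftrightarrow>
     Linfty_circle f \<and> (\<forall>i j. ell2_entry T i j = fourier_coeff f (int i - int j))"

definition has_continuous_symbol :: "(ell2 \<Rightarrow> ell2) \<Rightarrow> bool" where
  "has_continuous_symbol T \<longleftrightarrow> (\<exists>f. Toeplitz_symbol T f \<and> continuous_on (sphere 0 1) f)"

section \<open>Orthonormal polynomials and the Hessenberg matrix\<close>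

definition measure_support :: "complex measure \<Rightarrow> complex set" where
  "measure_support \<mu> = {z. \<forall>U. open U \<and> z \<in> U \<longrightarrow> emeasure \<mu> U > 0}"

definition poly_inner :: "complex measure \<Rightarrow> complex poly \<Rightarrow> complex poly \<Rightarrow> complex" where
  "poly_inner \<mu> Q R = (LINT z|\<mu>. poly Q z * cnj (poly R z))"

text \<open>For a probability measure with infinite compact support there is exactly one such
  sequence, and its first term is the constant polynomial 1.\<close>

definition orthonormal_polys :: "complex measure \<Rightarrow> (nat \<Rightarrow> complex poly) \<Rightarrow> bool" where
  "orthonormal_polys \<mu> P \<longleftrightarrow>
     (\<forall>n. degree (P n) = n \<and> lead_coeff (P n) \<in> \<real> \<and> Re (lead_coeff (P n)) > 0) \<and>
     (\<forall>m n. poly_inner \<mu> (P m) (P n) = (if m = n then 1 else 0))"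

text \<open>Rows and columns are numbered from 1; values of \<open>d\<close> with an index 0 play no role.\<close>

definition Hessenberg_matrix :: "(nat \<Rightarrow> complex poly) \<Rightarrow> (nat \<Rightarrow> nat \<Rightarrow> complex) \<Rightarrow> bool" where
  "Hessenberg_matrix P d \<longleftrightarrow>
     (\<forall>n z. z * poly (P n) z = (\<Sum>k=0..n + 1. d (k + 1) (n + 1) * poly (P k) z)) \<and>
     (\<forall>i\<ge>1. \<forall>j\<ge>1. i > j + 1 \<longrightarrow> d i j = 0)"

definition Hessenberg_operator :: "(nat \<Rightarrow> nat \<Rightarrow> complex) \<Rightarrow> (ell2 \<Rightarrow> ell2) \<Rightarrow> bool" where
  "Hessenberg_operator d D \<longleftrightarrow>
     bounded_clinear D \<and> (\<forall>i j. ell2_entry D i j = d (i + 1) (j + 1))"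

definition hess_laurent :: "(nat \<Rightarrow> nat \<Rightarrow> complex) \<Rightarrow> nat \<Rightarrow> complex \<Rightarrow> complex" where
  "hess_laurent d n z = d (n + 1) n * z + (\<Sum>k<n. d (n - k) n / z ^ k)"

section \<open>Logarithmic capacity and regular measures\<close>

text \<open>The logarithmic energy is the double integral of \<open>-ln (dist z w)\<close>, computed as the integral
  of the positive part minus the integral of the negative part. Since \<open>ln 0 = 0\<close> in the library,
  the value \<open>\<infinity>\<close> on the diagonal has to be given explicitly. For measures on a compact set the
  subtracted term is finite.\<close>

definition log_energy :: "complex measure \<Rightarrow> ereal" where
  "log_energy \<nu> =
     enn2ereal (\<integral>\<^sup>+ z. \<integral>\<^sup>+ w. (if z = w then \<infinity> else ennreal (- ln (dist z w))) \<partial>\<nu> \<partial>\<nu>)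
     - enn2ereal (\<integral>\<^sup>+ z. \<integral>\<^sup>+ w. ennreal (ln (dist z w)) \<partial>\<nu> \<partial>\<nu>)"

definition Robin_const :: "complex set \<Rightarrow> ereal" where
  "Robin_const K =
     (INF \<nu>\<in>{\<nu>. prob_space \<nu> \<and> sets \<nu> = sets borel \<and> emeasure \<nu> K = 1}. log_energy \<nu>)"

definition log_capacity :: "complex set \<Rightarrow> real" where
  "log_capacity K = (if Robin_const K = \<infinity> then 0 else exp (- real_of_ereal (Robin_const K)))"

definition regular_measure :: "complex measure \<Rightarrow> (nat \<Rightarrow> complex poly) \<Rightarrow> bool" where
  "regular_measure \<mu> P \<longleftrightarrow>
     (\<lambda>n. Re (lead_coeff (P n)) powr (- 1 / real n)) \<longlonglongrightarrow> log_capacity (measure_support \<mu>)"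

section \<open>Jordan arcs, the Riemann sphere and the Riemann mapping function\<close>

definition Jordan_arc :: "complex set \<Rightarrow> bool" where
  "Jordan_arc A \<longleftrightarrow> A homeomorphic {0..1::real}"

abbreviation Riemann_sphere :: "complex option topology" where
  "Riemann_sphere \<equiv> Alexandroff_compactification euclidean"

text \<open>The counterpart of \<^const>\<open>simply_connected\<close> for abstract topologies; as there, it entails
  path-connectedness, because constant loops have to be homotopic.\<close>

definition simply_connected_space :: "'a topology \<Rightarrow> bool" where
  "simply_connected_space X \<longleftrightarrow>
     (\<forall>p q. pathin X p \<and> p 1 = p 0 \<and> pathin X q \<and> q 1 = q 0 \<longrightarrow>
        homotopic_with (\<lambda>r. r 1 = r 0) (top_of_set {0..1::real}) X p q)"

abbreviation sphere_complement :: "complex set \<Rightarrow> complex option topology" where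
  "sphere_complement \<Gamma> \<equiv> subtopology Riemann_sphere (topspace Riemann_sphere - Some ` \<Gamma>)"

text \<open>The finite part of the conformal map between the complements in the sphere. The expansion
  encodes that \<open>\<infinity>\<close> is fixed with positive derivative.\<close>

definition Riemann_mapping :: "complex set \<Rightarrow> (complex \<Rightarrow> complex) \<Rightarrow> bool" where
  "Riemann_mapping \<Gamma> \<phi> \<longleftrightarrow>
     \<phi> holomorphic_on {z. 1 < cmod z} \<and>
     bij_betw \<phi> {z. 1 < cmod z} (- \<Gamma>) \<and>
     (\<exists>c1 :: real. \<exists>c :: nat \<Rightarrow> complex. c1 > 0 \<and>
        (\<forall>z. 1 < cmod z \<longrightarrow> (\<lambda>k. c k / z ^ k) sums (\<phi> z - of_real c1 * z)))"

text \<open>Values on the unit circle are boundary limits from outside; whenever a continuous extension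
  to the closed exterior exists, it is this function.\<close>

definition boundary_extension :: "(complex \<Rightarrow> complex) \<Rightarrow> complex \<Rightarrow> complex" where
  "boundary_extension \<phi> z = (if 1 < cmod z then \<phi> z else Lim (at z within {w. 1 < cmod w}) \<phi>)"

lemma boundary_extension_eq:
  assumes cont: "continuous_on {z. 1 \<le> cmod z} g"
    and eq: "\<And>z. 1 < cmod z \<Longrightarrow> g z = \<phi> z"
    and z: "1 \<le> cmod z"
  shows "boundary_extension \<phi> z = g z"
proof (cases "1 < cmod z")
  case True
  then show ?thesis by (simp add: boundary_extension_def eq)
next
  case False
  have ext: "{w. 1 < cmod w} = - cball (0::complex) 1"
    by auto
  have frontier: "z \<in> closure (- cball (0::complex) 1)"
    using z by (simp add: closure_complement)
  have "z islimpt {w. 1 < cmod w}"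
    using frontier False unfolding ext closure_def by auto
  then have nontriv: "at z within {w. 1 < cmod w} \<noteq> bot"
    by (simp add: trivial_limit_within)
  have "(g \<longlongrightarrow> g z) (at z within {w. 1 \<le> cmod w})"
    using cont z by (simp add: continuous_on_def)
  then have "(g \<longlongrightarrow> g z) (at z within {w. 1 < cmod w})"
    by (rule tendsto_within_subset) auto
  then have "(\<phi> \<longlongrightarrow> g z) (at z within {w. 1 < cmod w})"
    by (rule Lim_transform_within[OF _ zero_less_one]) (simp add: eq)
  then show ?thesis
    using False nontriv by (simp add: boundary_extension_def tendsto_Lim)
qed

end

theory Submission
  imports Defs
begin

text \<open>Multiplication by \<open>z\<close> and the limit matrix differ
    by a compact operator \<open>D - T\<close>. Write the symbol as
  \<open>E s = (c 0 + c 1 * s + c 2 * s^2 + \<dots>) / s\<close> for \<open>0 < cmod s < 1\<close>, with \<open>s = 1 / z\<close>. The vectors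
  \<open>(s ^ j)\<close> are eigenvectors of \<open>T\<close> for \<open>E s\<close> up to a bounded error, and \<open>D - w\<close> is bounded below by the
  distance of \<open>w\<close> to the support \<open>\<Gamma>\<close>; hence all limits of \<open>E\<close> at the unit circle lie in \<open>\<Gamma>\<close>.
  Conversely, Runge approximation yields polynomials peaking at any non-atom \<open>l\<close> of \<open>\<Gamma>\<close>, that is,
  weakly null approximate eigenvectors of the adjoint of \<open>D\<close> and so of \<open>T\<close>; they exist only if \<open>E\<close> comes
  arbitrarily close to \<open>l\<close> near the circle. Non-atoms are dense in \<open>\<Gamma>\<close> because arcs are locally
  uncountable. So the cluster set of \<open>E\<close> is exactly \<open>\<Gamma>\<close>. As the complement of \<open>\<Gamma>\<close> is connected, Rouche's
  theorem shows that \<open>E\<close> takes every value off \<open>\<Gamma>\<close> once, the open mapping theorem that it takes no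
  value in \<open>\<Gamma>\<close>, and the Schwarz lemma that \<open>z \<mapsto> E (1 / z)\<close> is the Riemann mapping function. Finally,
  the Poisson integral gives the uniform convergence of \<open>E\<close> to the continuous symbol on the circle, and
  \<open>h\<^sub>n\<close> converges uniformly to \<open>z \<mapsto> E (1 / z)\<close> on each circle of radius larger than 1.\<close>

section \<open>Operators on the sequence space\<close>

lemma ell2_summable: "summable (\<lambda>n. (cmod (ell2_nth x n))\<^sup>2)"
  using ell2_nth[of x] by simp

lemma ell2_norm_sq_sums: "(\<lambda>n. (cmod (ell2_nth x n))\<^sup>2) sums (norm x)\<^sup>2"
proof -
  have "(norm x)\<^sup>2 = (\<Sum>n. (cmod (ell2_nth x n))\<^sup>2)"
    unfolding power2_norm_eq_inner inner_ell2.rep_eq ..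
  then show ?thesis
    using ell2_summable[of x] by (simp add: sums_iff)
qed

lemma ell2_sum_le_norm_sq:
  assumes "finite I"
  shows "(\<Sum>n\<in>I. (cmod (ell2_nth x n))\<^sup>2) \<le> (norm x)\<^sup>2"
  using sum_le_suminf[OF ell2_summable assms, of x] ell2_norm_sq_sums[of x]
  by (simp add: sums_iff)

lemma ell2_nth_le_norm: "cmod (ell2_nth x n) \<le> norm x"
  using ell2_sum_le_norm_sq[of "{n}" x] by (simp add: power2_le_iff_abs_le)

lemma ell2_nth_minus: "ell2_nth (x - y) n = ell2_nth x n - ell2_nth y n"
  by (simp add: minus_ell2.rep_eq)

lemma ell2_nth_uminus: "ell2_nth (- x) n = - ell2_nth x n"
  by (simp add: uminus_ell2.rep_eq)

lemma ell2_nth_scaleC: "ell2_nth (ell2_scaleC c x) n = c * ell2_nth x n"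
  by (simp add: ell2_scaleC.rep_eq)

lemma ell2_nth_add: "ell2_nth (x + y) n = ell2_nth x n + ell2_nth y n"
  by (simp add: plus_ell2.rep_eq)

lemma ell2_nth_zero: "ell2_nth 0 n = 0"
  by (simp add: zero_ell2.rep_eq)

lemma ell2_nth_sum: "ell2_nth (\<Sum>j\<in>I. x j) n = (\<Sum>j\<in>I. ell2_nth (x j) n)"
  by (induction I rule: infinite_finite_induct) (auto simp: ell2_nth_add ell2_nth_zero)

lemma ell2_eqI: "(\<And>n. ell2_nth x n = ell2_nth y n) \<Longrightarrow> x = y"
  by (metis ell2_nth_inject ext)

lemma ell2_nth_unit: "ell2_nth (ell2_unit j) n = (if n = j then 1 else 0)"
  by (simp add: ell2_unit.rep_eq)

lemma ell2_norm_scaleC: "norm (ell2_scaleC c x) = cmod c * norm x"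
proof -
  have "(norm (ell2_scaleC c x))\<^sup>2 = (cmod c * norm x)\<^sup>2"
    using ell2_norm_sq_sums[of "ell2_scaleC c x"]
      sums_mult[OF ell2_norm_sq_sums[of x], of "(cmod c)\<^sup>2"]
    by (simp add: ell2_nth_scaleC norm_mult power_mult_distrib sums_iff)
  then show ?thesis by (simp add: power2_eq_iff_nonneg)
qed

lift_definition ell2_fin :: "nat \<Rightarrow> (nat \<Rightarrow> complex) \<Rightarrow> ell2" is "\<lambda>N x n. if n < N then x n else 0"
  subgoal for N x by (rule summable_finite[of "{..<N}"]) auto
  done

lemma ell2_nth_fin: "ell2_nth (ell2_fin N x) n = (if n < N then x n else 0)"
  by (simp add: ell2_fin.rep_eq)

lemma ell2_norm_fin: "(norm (ell2_fin N x))\<^sup>2 = (\<Sum>n<N. (cmod (x n))\<^sup>2)"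
proof -
  have "(\<lambda>n. (cmod (ell2_nth (ell2_fin N x) n))\<^sup>2) sums (\<Sum>n<N. (cmod (ell2_nth (ell2_fin N x) n))\<^sup>2)"
    by (rule sums_finite) (auto simp: ell2_nth_fin)
  with ell2_norm_sq_sums[of "ell2_fin N x"] show ?thesis
    by (simp add: ell2_nth_fin sums_iff)
qed

lemma ell2_fin_eq_sum: "ell2_fin N x = (\<Sum>j<N. ell2_scaleC (x j) (ell2_unit j))"
  by (rule ell2_eqI) (simp add: ell2_nth_fin ell2_nth_sum ell2_nth_scaleC ell2_nth_unit
      if_distrib[of "\<lambda>u. _ * u"] sum.delta cong: if_cong)

abbreviation ell2_proj :: "nat \<Rightarrow> ell2 \<Rightarrow> ell2" where
  "ell2_proj N x \<equiv> ell2_fin N (ell2_nth x)"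

lemma ell2_norm_proj_split: "(norm x)\<^sup>2 = (norm (ell2_proj N x))\<^sup>2 + (norm (x - ell2_proj N x))\<^sup>2"
proof -
  have "(\<lambda>n. (cmod (ell2_nth x n))\<^sup>2) sums ((norm (ell2_proj N x))\<^sup>2 + (norm (x - ell2_proj N x))\<^sup>2)"
    using sums_add[OF ell2_norm_sq_sums[of "ell2_proj N x"] ell2_norm_sq_sums[of "x - ell2_proj N x"]]
    by (rule sums_cong[THEN iffD1, rotated]) (simp add: ell2_nth_fin ell2_nth_minus)
  with ell2_norm_sq_sums[of x] show ?thesis by (simp add: sums_iff)
qed

lemma ell2_norm_coproj_le: "norm (x - ell2_proj N x) \<le> norm x"
  using ell2_norm_proj_split[of x N] by (simp add: power2_le_imp_le)

lemma ell2_proj_tendsto: "(\<lambda>N. ell2_proj N x) \<longlonglongrightarrow> x"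
proof -
  have "(\<lambda>N. (norm (ell2_proj N x))\<^sup>2) \<longlonglongrightarrow> (norm x)\<^sup>2"
    using ell2_norm_sq_sums[of x] by (simp add: ell2_norm_fin sums_def)
  then have "(\<lambda>N. (norm x)\<^sup>2 - (norm (ell2_proj N x))\<^sup>2) \<longlonglongrightarrow> (norm x)\<^sup>2 - (norm x)\<^sup>2"
    by (rule tendsto_diff[OF tendsto_const])
  moreover have "(norm (x - ell2_proj N x))\<^sup>2 = (norm x)\<^sup>2 - (norm (ell2_proj N x))\<^sup>2" for N
    using ell2_norm_proj_split[of x N] by simp
  ultimately have "(\<lambda>N. (norm (x - ell2_proj N x))\<^sup>2) \<longlonglongrightarrow> 0" by simp
  then have "(\<lambda>N. sqrt ((norm (x - ell2_proj N x))\<^sup>2)) \<longlonglongrightarrow> sqrt 0"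
    by (intro tendsto_intros)
  then have "(\<lambda>N. norm (ell2_proj N x - x)) \<longlonglongrightarrow> 0"
    by (simp add: norm_minus_commute)
  then show ?thesis
    by (rule LIM_zero_cancel[OF tendsto_norm_zero_cancel])
qed

lemma ell2_Cauchy_Schwarz_sum:
  assumes "finite I"
  shows "(\<Sum>n\<in>I. cmod (ell2_nth x n) * cmod (ell2_nth y n)) \<le> norm x * norm y"
proof -
  have "(\<Sum>n\<in>I. cmod (ell2_nth x n) * cmod (ell2_nth y n))\<^sup>2
      \<le> (\<Sum>n\<in>I. (cmod (ell2_nth x n))\<^sup>2) * (\<Sum>n\<in>I. (cmod (ell2_nth y n))\<^sup>2)"
    by (rule Cauchy_Schwarz_ineq_sum)
  also have "\<dots> \<le> (norm x)\<^sup>2 * (norm y)\<^sup>2"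
    by (intro mult_mono ell2_sum_le_norm_sq assms) (auto intro: sum_nonneg)
  finally show ?thesis
    by (metis power_mult_distrib power2_le_imp_le mult_nonneg_nonneg norm_ge_zero)
qed

lemma bounded_clinear_linear:
  assumes "bounded_clinear A"
  shows "bounded_linear A" "A (x + y) = A x + A y" "A (x - y) = A x - A y"
    "A (ell2_scaleC c x) = ell2_scaleC c (A x)" "A (\<Sum>j\<in>I. f j) = (\<Sum>j\<in>I. A (f j))"
  using assms unfolding bounded_clinear_def
  by (auto dest: bounded_linear.linear simp: linear_add linear_diff linear_sum)

lemma bounded_clinear_norm_le:
  assumes "bounded_clinear A"
  shows "norm (A x) \<le> onorm A * norm x"
  using assms onorm unfolding bounded_clinear_def by blast

lemma bounded_clinear_nth_fin:
  assumes "bounded_clinear A"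
  shows "ell2_nth (A (ell2_fin N x)) i = (\<Sum>j<N. ell2_entry A i j * x j)"
  by (simp add: ell2_fin_eq_sum bounded_clinear_linear[OF assms] ell2_nth_sum ell2_nth_scaleC
      ell2_entry_def mult.commute)

lemma ell2_nth_tendsto:
  assumes "X \<longlonglongrightarrow> (x :: ell2)"
  shows "(\<lambda>N. ell2_nth (X N) i) \<longlonglongrightarrow> ell2_nth x i"
proof -
  have "(\<lambda>N. norm (X N - x)) \<longlonglongrightarrow> 0"
    using assms by (simp add: LIM_zero_iff tendsto_norm_zero_iff)
  then have "(\<lambda>N. ell2_nth (X N) i - ell2_nth x i) \<longlonglongrightarrow> 0"
    by (rule Lim_null_comparison[rotated])
      (use ell2_nth_le_norm[of "_ - x" i] in \<open>auto simp: ell2_nth_minus\<close>)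
  then show ?thesis by (simp add: LIM_zero_iff)
qed

lemma bounded_clinear_nth_sums:
  assumes "bounded_clinear A"
  shows "(\<lambda>j. ell2_entry A i j * ell2_nth x j) sums ell2_nth (A x) i"
proof -
  have "(\<lambda>N. A (ell2_proj N x)) \<longlonglongrightarrow> A x"
    by (intro bounded_linear.tendsto[OF bounded_clinear_linear(1)[OF assms]] ell2_proj_tendsto)
  from ell2_nth_tendsto[OF this, of i] show ?thesis
    by (simp add: sums_def bounded_clinear_nth_fin[OF assms])
qed

lemma bounded_clinear_minus:
  assumes "bounded_clinear A" "bounded_clinear B"
  shows "bounded_clinear (\<lambda>x. A x - B x)"
  using assms unfolding bounded_clinear_def
  by (auto intro!: bounded_linear_sub ell2_eqI simp: ell2_nth_minus ell2_nth_scaleC right_diff_distrib)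

lemma ell2_entry_minus: "ell2_entry (\<lambda>x. A x - B x) i j = ell2_entry A i j - ell2_entry B i j"
  by (simp add: ell2_entry_def ell2_nth_minus)

lemma bounded_clinear_entry_le: 
  assumes "bounded_clinear A"
  shows "cmod (ell2_entry A i j) \<le> onorm A"
proof -
  have "ell2_unit j = ell2_fin (Suc j) (\<lambda>i. if i = j then 1 else 0)"
    by (rule ell2_eqI) (simp add: ell2_nth_unit ell2_nth_fin)
  then have "(norm (ell2_unit j))\<^sup>2 = 1"
    by (simp only: ell2_norm_fin) simp
  then have "norm (ell2_unit j) = 1"
    using norm_ge_zero[of "ell2_unit j"] by (simp add: power2_eq_1_iff)
  then show ?thesis
    using ell2_nth_le_norm[of "A (ell2_unit j)" i] bounded_clinear_norm_le[OF assms, of "ell2_unit j"]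
    by (simp add: ell2_entry_def)
qed

lemma bounded_clinear_row_summable:
  assumes "bounded_clinear A"
  shows "summable (\<lambda>j. (cmod (ell2_entry A i j))\<^sup>2)"
proof (rule summableI_nonneg_bounded[where x = "(onorm A)\<^sup>2"])
  fix N
  let ?S = "\<Sum>j<N. (cmod (ell2_entry A i j))\<^sup>2"
  define v where "v = ell2_fin N (\<lambda>j. cnj (ell2_entry A i j))"
  have S0: "?S \<ge> 0" by (intro sum_nonneg) auto
  have nv: "(norm v)\<^sup>2 = ?S" by (simp add: v_def ell2_norm_fin)
  have "ell2_nth (A v) i = of_real ?S"
    by (simp add: v_def bounded_clinear_nth_fin[OF assms] complex_norm_square[symmetric])
  then have "?S = cmod (ell2_nth (A v) i)" using S0 by (simp only: norm_of_real abs_of_nonneg)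
  also have "\<dots> \<le> onorm A * norm v"
    using ell2_nth_le_norm bounded_clinear_norm_le[OF assms] order_trans by blast
  finally have "norm v * norm v \<le> onorm A * norm v" using nv by (simp add: power2_eq_square)
  then have "norm v \<le> onorm A \<or> norm v = 0" by (auto simp: mult_le_cancel_right)
  then have "norm v \<le> onorm A"
    using bounded_clinear_linear(1)[OF assms] onorm_pos_le by auto
  then show "?S \<le> (onorm A)\<^sup>2" unfolding nv[symmetric] by (intro power_mono) auto
qed auto

lemma ell2_shift_nth: "ell2_nth ((ell2_shift ^^ n) x) i = (if i < n then 0 else ell2_nth x (i - n))"
proof (induction n arbitrary: i)
  case (Suc n)
  then show ?case by (cases i) (auto simp: ell2_shift.rep_eq)
qed simp

lemma ell2_backward_shift_nth: "ell2_nth ((ell2_backward_shift ^^ n) x) i = ell2_nth x (i + n)"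
  by (induction n arbitrary: i) (auto simp: ell2_backward_shift.rep_eq)

lemma ell2_norm_shift: "norm ((ell2_shift ^^ n) x) = norm x"
proof -
  have "(\<lambda>i. (cmod (ell2_nth ((ell2_shift ^^ n) x) (i + n)))\<^sup>2) sums (norm x)\<^sup>2"
    using ell2_norm_sq_sums[of x] by (simp add: ell2_shift_nth)
  then have "(\<lambda>i. (cmod (ell2_nth ((ell2_shift ^^ n) x) i))\<^sup>2) sums (norm x)\<^sup>2"
    by (subst (asm) sums_iff_shift) (simp add: ell2_shift_nth)
  then have "(norm ((ell2_shift ^^ n) x))\<^sup>2 = (norm x)\<^sup>2"
    using ell2_norm_sq_sums[of "(ell2_shift ^^ n) x"] by (simp add: sums_iff)
  then show ?thesis by simp
qed

lemma ell2_norm_backward_shift: "norm ((ell2_backward_shift ^^ n) x) = norm (x - ell2_proj n x)"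
proof -
  have "(ell2_shift ^^ n) ((ell2_backward_shift ^^ n) x) = x - ell2_proj n x"
    by (rule ell2_eqI) (simp add: ell2_shift_nth ell2_backward_shift_nth ell2_nth_minus ell2_nth_fin)
  then show ?thesis by (metis ell2_norm_shift)
qed

lemma bounded_clinear_shift_pow: "bounded_clinear (ell2_shift ^^ n)"
proof -
  have "bounded_linear (ell2_shift ^^ n)"
  proof (rule bounded_linear_intro[where K = 1])
    show "norm ((ell2_shift ^^ n) x) \<le> norm x * 1" for x by (simp add: ell2_norm_shift)
  qed (auto intro!: ell2_eqI simp: ell2_shift_nth ell2_nth_add scaleR_ell2.rep_eq)
  then show ?thesis
    by (auto simp: bounded_clinear_def ell2_shift_nth ell2_nth_scaleC intro!: ell2_eqI)
qed

lemma bounded_clinear_backward_shift_pow: "bounded_clinear (ell2_backward_shift ^^ n)"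
proof -
  have "bounded_linear (ell2_backward_shift ^^ n)"
  proof (rule bounded_linear_intro[where K = 1])
    show "norm ((ell2_backward_shift ^^ n) x) \<le> norm x * 1" for x
      by (simp add: ell2_norm_backward_shift ell2_norm_coproj_le)
  qed (auto intro!: ell2_eqI simp: ell2_backward_shift_nth ell2_nth_add scaleR_ell2.rep_eq)
  then show ?thesis
    by (auto simp: bounded_clinear_def ell2_backward_shift_nth ell2_nth_scaleC intro!: ell2_eqI)
qed

lemma bounded_clinear_compose:
  assumes "bounded_clinear A" "bounded_clinear B"
  shows "bounded_clinear (\<lambda>x. A (B x))"
  using assms bounded_linear_compose[of A B] unfolding bounded_clinear_def by auto

definition ell2_compression :: "nat \<Rightarrow> (ell2 \<Rightarrow> ell2) \<Rightarrow> ell2 \<Rightarrow> ell2" where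
  "ell2_compression n A x = (ell2_backward_shift ^^ n) (A ((ell2_shift ^^ n) x))"

lemma bounded_clinear_compression:
  "bounded_clinear A \<Longrightarrow> bounded_clinear (ell2_compression n A)"
  using bounded_clinear_compose[OF bounded_clinear_backward_shift_pow
      bounded_clinear_compose[OF _ bounded_clinear_shift_pow], of A n n]
  by (simp add: ell2_compression_def[abs_def])

lemma ell2_entry_compression: "ell2_entry (ell2_compression n A) i j = ell2_entry A (i + n) (j + n)"
proof -
  have "(ell2_shift ^^ n) (ell2_unit j) = ell2_unit (j + n)"
    by (rule ell2_eqI) (auto simp: ell2_shift_nth ell2_nth_unit)
  then show ?thesis
    by (simp add: ell2_entry_def ell2_compression_def ell2_backward_shift_nth)
qed

lemma bounded_clinear_eqI:
  assumes "bounded_clinear A" "bounded_clinear B" "\<And>i j. ell2_entry A i j = ell2_entry B i j"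
  shows "A = B"
proof
  fix x
  show "A x = B x"
  proof (rule ell2_eqI)
    fix i
    show "ell2_nth (A x) i = ell2_nth (B x) i"
      using bounded_clinear_nth_sums[OF assms(1), of i x]
        bounded_clinear_nth_sums[OF assms(2), of i x] sums_unique2
      unfolding assms(3) by blast
  qed
qed

lemma ell2_norm_proj_le_sum: "norm (ell2_proj m x) \<le> (\<Sum>i<m. cmod (ell2_nth x i))"
proof -
  have "(norm (ell2_proj m x))\<^sup>2 \<le> (\<Sum>i<m. cmod (ell2_nth x i))\<^sup>2"
    unfolding ell2_norm_fin
  proof (induction m)
    case (Suc m)
    have "0 \<le> (\<Sum>i<m. cmod (ell2_nth x i)) * cmod (ell2_nth x m)"
      by (intro mult_nonneg_nonneg sum_nonneg) auto
    with Suc show ?case by (simp add: power2_sum)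
  qed simp
  then show ?thesis by (rule power2_le_imp_le) (auto intro: sum_nonneg)
qed

text \<open>The second assumption makes \<open>K\<close> compact; the lemmas \<open>apply_le_proj\<close> and \<open>pairing_le_proj\<close> quantify this for
  the operator and for its transpose.\<close>

locale tail_null_operator =
  fixes K :: "ell2 \<Rightarrow> ell2"
  assumes clinear: "bounded_clinear K"
    and compression_tendsto: "(\<lambda>n. onorm (ell2_compression n K)) \<longlonglongrightarrow> 0"
begin

lemma onorm_nonneg: "0 \<le> onorm K"
  using clinear bounded_clinear_def onorm_pos_le by blast

lemma tail_bound:
  assumes "e > 0"
  obtains m where "\<And>x. norm (K (x - ell2_proj m x) - ell2_proj m (K (x - ell2_proj m x))) \<le> e * norm x"
proof -
  obtain m where m: "onorm (ell2_compression m K) < e"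
    using order_tendstoD(2)[OF compression_tendsto assms] by (auto simp: eventually_sequentially)
  show ?thesis
  proof (rule that[of m])
    fix x
    let ?y = "(ell2_backward_shift ^^ m) x"
    have "(ell2_shift ^^ m) ?y = x - ell2_proj m x"
      by (rule ell2_eqI) (simp add: ell2_shift_nth ell2_backward_shift_nth ell2_nth_minus ell2_nth_fin)
    then have "norm (K (x - ell2_proj m x) - ell2_proj m (K (x - ell2_proj m x)))
        = norm (ell2_compression m K ?y)"
      by (simp add: ell2_compression_def ell2_norm_backward_shift)
    also have "\<dots> \<le> onorm (ell2_compression m K) * norm ?y"
      by (intro bounded_clinear_norm_le bounded_clinear_compression clinear)
    also have "\<dots> \<le> e * norm x"
      using m assms by (intro mult_mono) (auto simp: ell2_norm_backward_shift ell2_norm_coproj_le)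
    finally show "norm (K (x - ell2_proj m x) - ell2_proj m (K (x - ell2_proj m x))) \<le> e * norm x" .
  qed
qed

lemma apply_le_proj:
  assumes "e > 0"
  obtains M C where "C \<ge> 0" "\<And>x. norm (K x) \<le> e * norm x + C * norm (ell2_proj M x)"
proof -
  obtain m where m: "norm (K (x - ell2_proj m x) - ell2_proj m (K (x - ell2_proj m x)))
      \<le> e / 2 * norm x"
    for x using tail_bound[of "e / 2"] assms by auto
  define R where "R i = Abs_ell2 (\<lambda>j. cnj (ell2_entry K i j))" for i
  have R: "ell2_nth (R i) j = cnj (ell2_entry K i j)" for i j
    using bounded_clinear_row_summable[OF clinear, of i]
    by (simp add: R_def Abs_ell2_inverse)
  have "(\<lambda>N. \<Sum>i<m. norm (R i - ell2_proj N (R i))) \<longlonglongrightarrow> (\<Sum>i<m. norm (R i - R i))"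
    by (intro tendsto_intros ell2_proj_tendsto)
  then have "\<forall>\<^sub>F N in sequentially. (\<Sum>i<m. norm (R i - ell2_proj N (R i))) < e / 2"
    by (rule order_tendstoD) (use assms in auto)
  then have "\<forall>\<^sub>F N in sequentially. (\<Sum>i<m. norm (R i - ell2_proj N (R i))) < e / 2 \<and> m \<le> N"
    using eventually_ge_at_top by (rule eventually_conj)
  then obtain N where N: "(\<Sum>i<m. norm (R i - ell2_proj N (R i))) < e / 2" "m \<le> N"
    using eventually_happens' sequentially_bot by blast
  show ?thesis
  proof (rule that[of "onorm K" N])
    fix x
    define y where "y = x - ell2_proj N x"
    have y_tail: "y - ell2_proj m y = y"
      using N(2) by (auto intro!: ell2_eqI simp: y_def ell2_nth_minus ell2_nth_fin ell2_nth_zero)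
    have ny: "norm y \<le> norm x" by (simp add: y_def ell2_norm_coproj_le)
    have coord: "cmod (ell2_nth (K y) i) \<le> norm (R i - ell2_proj N (R i)) * norm y" for i
    proof -
      let ?r = "R i - ell2_proj N (R i)"
      have "(\<lambda>j. ell2_entry K i j * ell2_nth y j) sums ell2_nth (K y) i"
        by (rule bounded_clinear_nth_sums[OF clinear])
      then have "(\<lambda>n. cmod (\<Sum>j<n. ell2_entry K i j * ell2_nth y j)) \<longlonglongrightarrow> cmod (ell2_nth (K y) i)"
        unfolding sums_def by (rule tendsto_norm)
      moreover have "cmod (\<Sum>j<n. ell2_entry K i j * ell2_nth y j) \<le> norm ?r * norm y" for n
      proof -
        have "cmod (\<Sum>j<n. ell2_entry K i j * ell2_nth y j)
            \<le> (\<Sum>j<n. cmod (ell2_entry K i j * ell2_nth y j))"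
          by (rule norm_sum)
        also have "\<dots> = (\<Sum>j<n. cmod (ell2_nth ?r j) * cmod (ell2_nth y j))"
          by (intro sum.cong) (auto simp: ell2_nth_minus ell2_nth_fin R y_def norm_mult)
        also have "\<dots> \<le> norm ?r * norm y"
          by (rule ell2_Cauchy_Schwarz_sum) simp
        finally show ?thesis .
      qed
      ultimately show ?thesis
        by (intro LIMSEQ_le_const2[of "\<lambda>n. cmod (\<Sum>j<n. ell2_entry K i j * ell2_nth y j)"]) auto
    qed
    have "norm (ell2_proj m (K y)) \<le> (\<Sum>i<m. cmod (ell2_nth (K y) i))"
      by (rule ell2_norm_proj_le_sum)
    also have "\<dots> \<le> (\<Sum>i<m. norm (R i - ell2_proj N (R i)) * norm y)"
      by (intro sum_mono coord)
    also have "\<dots> = (\<Sum>i<m. norm (R i - ell2_proj N (R i))) * norm y"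
      by (simp add: sum_distrib_right)
    also have "\<dots> \<le> e / 2 * norm x"
      using N ny assms by (intro mult_mono) auto
    finally have 1: "norm (ell2_proj m (K y)) \<le> e / 2 * norm x" .
    have "norm (K y - ell2_proj m (K y)) \<le> e / 2 * norm y"
      using m[of y] unfolding y_tail .
    also have "\<dots> \<le> e / 2 * norm x" using ny assms by (intro mult_left_mono) auto
    finally have 2: "norm (K y - ell2_proj m (K y)) \<le> e / 2 * norm x" .
    have "K x = K y + K (ell2_proj N x)"
      unfolding y_def by (simp add: bounded_clinear_linear(3)[OF clinear])
    then have "norm (K x) \<le> norm (K y) + norm (K (ell2_proj N x))"
      by (simp add: norm_triangle_ineq)
    also have "norm (K y) \<le> norm (K y - ell2_proj m (K y)) + norm (ell2_proj m (K y))"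
      using norm_triangle_ineq[of "K y - ell2_proj m (K y)" "ell2_proj m (K y)"] by simp
    also have "norm (K (ell2_proj N x)) \<le> onorm K * norm (ell2_proj N x)"
      by (rule bounded_clinear_norm_le[OF clinear])
    finally show "norm (K x) \<le> e * norm x + onorm K * norm (ell2_proj N x)"
      using 1 2 by linarith
  qed (rule onorm_nonneg)
qed

lemma pairing_le_proj:
  assumes "e > 0"
  obtains M C where "C \<ge> 0" "\<And>u v n. (\<Sum>i<n. cmod (ell2_nth u i * ell2_nth (K v) i))
     \<le> (e * norm u + C * norm (ell2_proj M u)) * norm v"
proof -
  obtain m where m: "norm (K (x - ell2_proj m x) - ell2_proj m (K (x - ell2_proj m x)))
      \<le> e / 2 * norm x"
    for x using tail_bound[of "e / 2"] assms by auto
  have "(\<lambda>N. \<Sum>j<m. norm (K (ell2_unit j) - ell2_proj N (K (ell2_unit j)))) \<longlonglongrightarrow>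
      (\<Sum>j<m. norm (K (ell2_unit j) - K (ell2_unit j)))"
    by (intro tendsto_intros ell2_proj_tendsto)
  then have "\<forall>\<^sub>F N in sequentially. (\<Sum>j<m. norm (K (ell2_unit j) - ell2_proj N (K (ell2_unit j)))) < e / 2"
    by (rule order_tendstoD) (use assms in auto)
  then have "\<forall>\<^sub>F N in sequentially. (\<Sum>j<m. norm (K (ell2_unit j) - ell2_proj N (K (ell2_unit j)))) < e / 2 \<and> m \<le> N"
    using eventually_ge_at_top by (rule eventually_conj)
  then obtain N where N: "(\<Sum>j<m. norm (K (ell2_unit j) - ell2_proj N (K (ell2_unit j)))) < e / 2" "m
      \<le> N"
    using eventually_happens' sequentially_bot by blast
  show ?thesis
  proof (rule that[of "onorm K" N])
    fix u v n
    define w where "w = K v - ell2_proj N (K v)"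
    have w: "norm w \<le> e * norm v"
    proof -
      let ?y = "v - ell2_proj m v"
      let ?q = "\<lambda>x. x - ell2_proj N x"
      have split: "w = ?q (K ?y) + ?q (K (ell2_proj m v))"
        by (rule ell2_eqI) (auto simp: w_def ell2_nth_minus ell2_nth_add ell2_nth_fin
            bounded_clinear_linear(3)[OF clinear])
      have "?q (K ?y) = ?q (K ?y - ell2_proj m (K ?y))"
        using N(2) by (auto intro!: ell2_eqI simp: ell2_nth_minus ell2_nth_fin ell2_nth_uminus)
      then have "norm (?q (K ?y)) \<le> norm (K ?y - ell2_proj m (K ?y))"
        by (metis ell2_norm_coproj_le)
      then have 1: "norm (?q (K ?y)) \<le> e / 2 * norm v" using m[of v] by linarith
      have "K (ell2_proj m v) = (\<Sum>j<m. ell2_scaleC (ell2_nth v j) (K (ell2_unit j)))"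
        by (simp add: ell2_fin_eq_sum bounded_clinear_linear[OF clinear])
      then have "?q (K (ell2_proj m v)) = (\<Sum>j<m. ell2_scaleC (ell2_nth v j) (?q (K (ell2_unit j))))"
        by (intro ell2_eqI) (auto simp: ell2_nth_minus ell2_nth_fin ell2_nth_sum ell2_nth_scaleC)
      then have "norm (?q (K (ell2_proj m v)))
          \<le> (\<Sum>j<m. norm (ell2_scaleC (ell2_nth v j) (?q (K (ell2_unit j)))))"
        by (simp add: norm_sum)
      also have "\<dots> \<le> (\<Sum>j<m. norm v * norm (?q (K (ell2_unit j))))"
        by (intro sum_mono) (simp add: ell2_norm_scaleC ell2_nth_le_norm mult_right_mono)
      also have "\<dots> = norm v * (\<Sum>j<m. norm (?q (K (ell2_unit j))))"
        by (simp add: sum_distrib_left)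
      also have "\<dots> \<le> norm v * (e / 2)" using N(1) by (intro mult_left_mono) auto
      finally have "norm (?q (K (ell2_proj m v))) \<le> e / 2 * norm v" by (simp add: mult.commute)
      with 1 show ?thesis unfolding split
        using norm_triangle_ineq[of "?q (K ?y)" "?q (K (ell2_proj m v))"] by linarith
    qed
    have "(\<Sum>i<n. cmod (ell2_nth u i * ell2_nth (K v) i))
        = (\<Sum>i<n. cmod (ell2_nth (ell2_proj N u) i) * cmod (ell2_nth (K v) i))
          + (\<Sum>i<n. cmod (ell2_nth u i) * cmod (ell2_nth w i))"
      unfolding sum.distrib[symmetric]
      by (intro sum.cong) (auto simp: w_def ell2_nth_minus ell2_nth_fin norm_mult)
    also have "\<dots> \<le> norm (ell2_proj N u) * norm (K v) + norm u * norm w"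
      by (intro add_mono ell2_Cauchy_Schwarz_sum) auto
    also have "\<dots> \<le> norm (ell2_proj N u) * (onorm K * norm v) + norm u * (e * norm v)"
      by (intro add_mono mult_left_mono w bounded_clinear_norm_le[OF clinear]) auto
    finally show "(\<Sum>i<n. cmod (ell2_nth u i * ell2_nth (K v) i))
     \<le> (e * norm u + onorm K * norm (ell2_proj N u)) * norm v"
      by (simp add: algebra_simps)
  qed (rule onorm_nonneg)
qed

end

section \<open>Orthonormal polynomials and the Hessenberg operator\<close>

lemma AE_measure_support:
  assumes "sets \<mu> = sets borel"
  shows "AE z in \<mu>. z \<in> measure_support \<mu>"
proof -
  let ?F = "{U. open U \<and> emeasure \<mu> U = 0}"
  have eq: "- measure_support \<mu> = \<Union>?F"
    by (auto simp: measure_support_def zero_less_iff_neq_zero)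
  obtain F' where F': "F' \<subseteq> ?F" "countable F'" "\<Union>F' = \<Union>?F"
    using Lindelof[of ?F] by auto
  have "(\<Union>U\<in>F'. U) \<in> null_sets \<mu>"
    by (rule null_sets_UN') (use F' assms in \<open>auto intro!: null_setsI\<close>)
  then have "- measure_support \<mu> \<in> null_sets \<mu>"
    using F'(3) eq by simp
  then show ?thesis by (rule AE_I') auto
qed

lemma integral_Cauchy_Schwarz:
  fixes f g :: "'a \<Rightarrow> real"
  assumes "integrable M (\<lambda>x. (f x)\<^sup>2)" "integrable M (\<lambda>x. (g x)\<^sup>2)" "integrable M (\<lambda>x. f x * g x)"
  shows "(LINT x|M. f x * g x)\<^sup>2 \<le> (LINT x|M. (f x)\<^sup>2) * (LINT x|M. (g x)\<^sup>2)"
proof -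
  define A B I where "A = (LINT x|M. (f x)\<^sup>2)" and "B = (LINT x|M. (g x)\<^sup>2)"
    and "I = (LINT x|M. f x * g x)"
  have quad: "0 \<le> s\<^sup>2 * A - 2 * s * t * I + t\<^sup>2 * B" for s t
  proof -
    have "0 \<le> (LINT x|M. (s * f x - t * g x)\<^sup>2)" by simp
    also have "(\<lambda>x. (s * f x - t * g x)\<^sup>2)
        = (\<lambda>x. s\<^sup>2 * (f x)\<^sup>2 - 2 * s * t * (f x * g x) + t\<^sup>2 * (g x)\<^sup>2)"
      by (auto simp: power2_eq_square algebra_simps)
    also have "(LINT x|M. \<dots> x) = s\<^sup>2 * A - 2 * s * t * I + t\<^sup>2 * B"
      using assms by (simp add: A_def B_def I_def)
    finally show ?thesis .
  qed
  have "B \<ge> 0" "A \<ge> 0" by (simp_all add: A_def B_def)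
  show ?thesis
  proof (cases "B = 0")
    case True
    have "0 \<le> I\<^sup>2 * A - 2 * I * (A + 1) * I" using quad[of I "A + 1"] True by simp
    then have "0 \<le> - (I\<^sup>2 * (A + 2))" by (simp add: power2_eq_square algebra_simps)
    then have "I\<^sup>2 * (A + 2) \<le> 0" by simp
    then have "I = 0" using \<open>A \<ge> 0\<close> by (auto simp: mult_le_0_iff)
    then show ?thesis using \<open>A \<ge> 0\<close> \<open>B \<ge> 0\<close> by (simp add: A_def B_def I_def)
  next
    case False
    have "0 \<le> B * (A * B - I\<^sup>2)" using quad[of B I] by (simp add: power2_eq_square algebra_simps)
    then have "I\<^sup>2 \<le> A * B" using False \<open>B \<ge> 0\<close> by (simp add: zero_le_mult_iff)
    then show ?thesis by (simp add: A_def B_def I_def)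
  qed
qed

locale orthonormal_poly_measure = prob_space \<mu> for \<mu> :: "complex measure" +
  fixes P :: "nat \<Rightarrow> complex poly"
  assumes sets_eq: "sets \<mu> = sets borel"
    and compact_support: "compact (measure_support \<mu>)"
    and orthonormal: "orthonormal_polys \<mu> P"
begin

abbreviation "\<Gamma> \<equiv> measure_support \<mu>"

lemma measurable_continuous:
  fixes f :: "complex \<Rightarrow> 'b :: {banach, second_countable_topology}"
  assumes "continuous_on UNIV f"
  shows "f \<in> borel_measurable \<mu>"
  using borel_measurable_continuous_onI[OF assms] measurable_cong_sets[OF sets_eq refl] by auto

lemma integrable_bounded_on_support:
  fixes f :: "complex \<Rightarrow> 'b :: {banach, second_countable_topology}"
  assumes "f \<in> borel_measurable \<mu>" "\<And>z. z \<in> \<Gamma> \<Longrightarrow> norm (f z) \<le> B"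
  shows "integrable \<mu> f"
  using AE_measure_support[OF sets_eq]
  by (intro integrable_const_bound[where B = B] assms(1)) (auto elim!: eventually_mono intro: assms(2))

lemma integrable_continuous:
  fixes f :: "complex \<Rightarrow> 'b :: {banach, second_countable_topology}"
  assumes "continuous_on UNIV f"
  shows "integrable \<mu> f"
proof -
  have "compact (f ` \<Gamma>)"
    using assms compact_support by (intro compact_continuous_image) (auto intro: continuous_on_subset)
  then obtain B where "\<And>z. z \<in> \<Gamma> \<Longrightarrow> norm (f z) \<le> B"
    using compact_imp_bounded bounded_iff by (metis imageI)
  then show ?thesis by (intro integrable_bounded_on_support measurable_continuous assms)
qed

lemma integral_mono_on_support:
  fixes f g :: "complex \<Rightarrow> real"
  assumes "integrable \<mu> f" "integrable \<mu> g" "\<And>z. z \<in> \<Gamma> \<Longrightarrow> f z \<le> g z"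
  shows "(LINT z|\<mu>. f z) \<le> (LINT z|\<mu>. g z)"
  using AE_measure_support[OF sets_eq]
  by (intro integral_mono_AE assms(1,2)) (auto elim!: eventually_mono intro: assms(3))

definition poly_norm :: "complex poly \<Rightarrow> real" where
  "poly_norm q = sqrt (LINT z|\<mu>. (cmod (poly q z))\<^sup>2)"

lemma poly_norm_sq: "(poly_norm q)\<^sup>2 = (LINT z|\<mu>. (cmod (poly q z))\<^sup>2)"
  by (simp add: poly_norm_def)

lemma poly_norm_nonneg: "0 \<le> poly_norm q"
  by (simp add: poly_norm_def)

definition comb :: "nat \<Rightarrow> (nat \<Rightarrow> complex) \<Rightarrow> complex poly" where
  "comb N x = (\<Sum>j<N. smult (x j) (P j))"

lemma poly_comb: "poly (comb N x) z = (\<Sum>j<N. x j * poly (P j) z)"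
  by (simp add: comb_def poly_sum)

lemma degree_P: "degree (P n) = n" and lead_coeff_P_pos: "Re (lead_coeff (P n)) > 0"
  and lead_coeff_P_real: "lead_coeff (P n) \<in> \<real>"
  and inner_P: "poly_inner \<mu> (P m) (P n) = (if m = n then 1 else 0)"
  using orthonormal unfolding orthonormal_polys_def by blast+

lemma ex_comb:
  assumes "degree q < N"
  shows "\<exists>x. q = comb N x"
  using assms
proof (induction N arbitrary: q)
  case (Suc N)
  have lead: "coeff (P N) N \<noteq> 0"
    using lead_coeff_P_pos[of N] degree_P[of N] by auto
  define c where "c = coeff q N / coeff (P N) N"
  define r where "r = q - smult c (P N)"
  have "coeff r k = 0" if "k \<ge> N" for k
  proof (cases "k = N")
    case True
    then show ?thesis using lead by (simp add: r_def c_def)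
  next
    case False
    then have "k > N" using that by simp
    then have "coeff q k = 0" "coeff (P N) k = 0"
      using Suc.prems degree_P[of N] by (auto intro!: coeff_eq_0)
    then show ?thesis by (simp add: r_def)
  qed
  then have r: "degree r < N \<or> r = 0"
    by (metis leading_coeff_0_iff not_less)
  have "\<exists>x. r = comb N x"
  proof (cases "r = 0")
    case True
    then show ?thesis by (intro exI[of _ "\<lambda>_. 0"]) (simp add: comb_def)
  qed (use r Suc.IH in auto)
  then obtain x where x: "r = comb N x" by blast
  have "q = comb (Suc N) (x(N := c))"
    using x by (simp add: comb_def r_def algebra_simps)
  then show ?case by blast
qed simp

lemma inner_comb: "poly_inner \<mu> (comb N x) (comb N y) = (\<Sum>j<N. x j * cnj (y j))"
proof -
  have int: "integrable \<mu> (\<lambda>z. x i * cnj (y j) * (poly (P i) z * cnj (poly (P j) z)))" for i j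
    by (intro integrable_continuous continuous_intros)
  have "poly_inner \<mu> (comb N x) (comb N y)
      = (LINT z|\<mu>. (\<Sum>i<N. \<Sum>j<N. x i * cnj (y j) * (poly (P i) z * cnj (poly (P j) z))))"
    unfolding poly_inner_def poly_comb by (simp add: sum_product mult_ac)
  also have "\<dots> = (\<Sum>i<N. \<Sum>j<N. (LINT z|\<mu>. x i * cnj (y j) * (poly (P i) z * cnj (poly (P j) z))))"
    using int by (subst Bochner_Integration.integral_sum)
      (auto intro!: sum.cong Bochner_Integration.integral_sum)
  also have "\<dots> = (\<Sum>i<N. \<Sum>j<N. x i * cnj (y j) * poly_inner \<mu> (P i) (P j))"
    by (simp add: poly_inner_def)
  also have "\<dots> = (\<Sum>j<N. x j * cnj (y j))"
    by (simp add: inner_P if_distrib[of "\<lambda>u. _ * u"] cong: if_cong)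
  finally show ?thesis .
qed

lemma poly_norm_comb: "(poly_norm (comb N x))\<^sup>2 = (\<Sum>j<N. (cmod (x j))\<^sup>2)"
proof -
  have "poly_inner \<mu> (comb N x) (comb N x) = of_real ((poly_norm (comb N x))\<^sup>2)"
    unfolding poly_norm_sq poly_inner_def complex_norm_square[symmetric]
    by (subst integral_complex_of_real[symmetric]) simp
  moreover have "poly_inner \<mu> (comb N x) (comb N x) = of_real (\<Sum>j<N. (cmod (x j))\<^sup>2)"
    unfolding inner_comb by (simp add: complex_norm_square[symmetric])
  ultimately show ?thesis by (simp only: of_real_eq_iff)
qed

lemma comb_extend: "N \<le> M \<Longrightarrow> comb N x = comb M (\<lambda>j. if j < N then x j else 0)"
  unfolding comb_def by (intro sum.mono_neutral_cong_left) auto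

lemma inner_comb_P:
  assumes "j < N"
  shows "poly_inner \<mu> (comb N x) (P j) = x j"
proof -
  have "P j = comb N (\<lambda>i. if i = j then 1 else 0)"
    using assms by (simp add: comb_def if_distrib[of "\<lambda>u. smult u _"] cong: if_cong)
  then show ?thesis
    using assms by (simp add: inner_comb if_distrib[of "\<lambda>u. _ * u"] if_distrib[of cnj] cong: if_cong)
qed

end

locale Hessenberg_setting = orthonormal_poly_measure +
  fixes d :: "nat \<Rightarrow> nat \<Rightarrow> complex" and D :: "ell2 \<Rightarrow> ell2"
  assumes Hess: "Hessenberg_matrix P d" and Hess_op: "Hessenberg_operator d D"
begin

lemma clinear_D: "bounded_clinear D" and entry_D: "ell2_entry D i j = d (i + 1) (j + 1)"
  using Hess_op by (auto simp: Hessenberg_operator_def)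

lemma entry_D_eq_0: "i > j + 1 \<Longrightarrow> ell2_entry D i j = 0"
  using Hess by (simp add: entry_D Hessenberg_matrix_def)

lemma z_times_P:
  assumes "n < N"
  shows "z * poly (P n) z = (\<Sum>k<Suc N. ell2_entry D k n * poly (P k) z)"
proof -
  have "z * poly (P n) z = (\<Sum>k=0..n + 1. d (k + 1) (n + 1) * poly (P k) z)"
    using Hess by (auto simp: Hessenberg_matrix_def)
  also have "\<dots> = (\<Sum>k<Suc N. ell2_entry D k n * poly (P k) z)"
    using assms entry_D_eq_0[of n] by (intro sum.mono_neutral_cong_left) (auto simp: entry_D)
  finally show ?thesis .
qed

lemma entry_D_subdiag: "\<exists>r>0. ell2_entry D (Suc n) n = of_real r"
proof -
  have pos: "\<exists>r>0. coeff (P m) m = of_real r" for m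
    using lead_coeff_P_pos[of m] lead_coeff_P_real[of m] degree_P[of m] by (auto elim!: Reals_cases)
  have "poly (pCons 0 (P n)) z = poly (\<Sum>k<Suc (Suc n). smult (ell2_entry D k n) (P k)) z" for z
    using z_times_P[of n "Suc n" z] by (simp add: poly_sum)
  then have "pCons 0 (P n) = (\<Sum>k<Suc (Suc n). smult (ell2_entry D k n) (P k))"
    by (auto simp: poly_eq_poly_eq_iff[symmetric])
  then have "coeff (pCons 0 (P n)) (Suc n) = (\<Sum>k<Suc (Suc n). ell2_entry D k n * coeff (P k) (Suc n))"
    by (simp add: coeff_sum)
  also have "\<dots> = ell2_entry D (Suc n) n * coeff (P (Suc n)) (Suc n)"
    using degree_P by (auto simp: coeff_eq_0)
  finally have eq: "coeff (P n) n = ell2_entry D (Suc n) n * coeff (P (Suc n)) (Suc n)" by simp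
  obtain r s where rs: "r > 0" "s > 0" "coeff (P n) n = of_real r" "coeff (P (Suc n)) (Suc n)
      = of_real s"
    using pos by meson
  then have "ell2_entry D (Suc n) n = of_real (r / s)" using eq by (simp add: field_simps)
  then show ?thesis using rs by (intro exI[of _ "r / s"]) auto
qed

lemma shifted_comb:
  assumes v: "v = ell2_fin N x"
  shows "comb (Suc N) (ell2_nth (D v - ell2_scaleC w v)) = [:- w, 1:] * comb N x"
    and "D v - ell2_scaleC w v = ell2_fin (Suc N) (ell2_nth (D v - ell2_scaleC w v))"
proof -
  have Dv: "ell2_nth (D v) i = (\<Sum>j<N. ell2_entry D i j * x j)" for i
    unfolding v by (rule bounded_clinear_nth_fin[OF clinear_D])
  show "D v - ell2_scaleC w v = ell2_fin (Suc N) (ell2_nth (D v - ell2_scaleC w v))"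
  proof (rule ell2_eqI)
    fix i
    have "ell2_nth (D v - ell2_scaleC w v) i = 0" if "\<not> i < Suc N"
      using that entry_D_eq_0[of _ i]
      by (auto simp: ell2_nth_minus Dv ell2_nth_scaleC v[THEN arg_cong, of "\<lambda>v. ell2_nth v i"] ell2_nth_fin
          intro!: sum.neutral)
    then show "ell2_nth (D v - ell2_scaleC w v) i
        = ell2_nth (ell2_fin (Suc N) (ell2_nth (D v - ell2_scaleC w v))) i"
      by (auto simp: ell2_nth_fin)
  qed
  have "poly (comb (Suc N) (ell2_nth (D v - ell2_scaleC w v))) z = (z - w) * poly (comb N x) z" for z
  proof -
    have "poly (comb (Suc N) (ell2_nth (D v - ell2_scaleC w v))) z
      = (\<Sum>i<Suc N. (\<Sum>j<N. ell2_entry D i j * x j) * poly (P i) z)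
        - (\<Sum>i<Suc N. (w * (if i < N then x i else 0)) * poly (P i) z)"
      unfolding poly_comb sum_subtractf[symmetric]
      by (intro sum.cong) (auto simp: ell2_nth_minus Dv[unfolded v] ell2_nth_scaleC v ell2_nth_fin algebra_simps)
    also have "(\<Sum>i<Suc N. (\<Sum>j<N. ell2_entry D i j * x j) * poly (P i) z)
      = (\<Sum>j<N. x j * (\<Sum>i<Suc N. ell2_entry D i j * poly (P i) z))"
      unfolding sum_distrib_left sum_distrib_right by (subst sum.swap) (simp add: mult_ac)
    also have "\<dots> = (\<Sum>j<N. x j * (z * poly (P j) z))"
      by (intro sum.cong) (auto simp: z_times_P[of _ N])
    also have "(\<Sum>i<Suc N. (w * (if i < N then x i else 0)) * poly (P i) z)
        = (\<Sum>i<N. w * x i * poly (P i) z)"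
      by simp
    finally show ?thesis by (simp add: poly_comb algebra_simps sum_distrib_left sum_subtractf)
  qed
  then show "comb (Suc N) (ell2_nth (D v - ell2_scaleC w v)) = [:- w, 1:] * comb N x"
    by (intro poly_eq_poly_eq_iff[THEN iffD1] ext) (simp add: algebra_simps)
qed

lemma norm_shifted_ge: "infdist w \<Gamma> * norm v \<le> norm (D v - ell2_scaleC w v)"
proof -
  have fin: "infdist w \<Gamma> * norm v \<le> norm (D v - ell2_scaleC w v)" if v: "v = ell2_fin N x" for v N x
  proof -
    have "(infdist w \<Gamma> * norm v)\<^sup>2 = (infdist w \<Gamma>)\<^sup>2 * (poly_norm (comb N x))\<^sup>2"
      by (simp add: v power_mult_distrib ell2_norm_fin poly_norm_comb)
    also have "\<dots> = (LINT z|\<mu>. (infdist w \<Gamma>)\<^sup>2 * (cmod (poly (comb N x) z))\<^sup>2)"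
      by (simp add: poly_norm_sq)
    also have "\<dots> \<le> (LINT z|\<mu>. (cmod (poly ([:- w, 1:] * comb N x) z))\<^sup>2)"
    proof (rule integral_mono_on_support)
      fix z assume "z \<in> \<Gamma>"
      then have "infdist w \<Gamma> \<le> dist w z" by (rule infdist_le)
      then have "infdist w \<Gamma> \<le> cmod (z - w)" by (simp add: dist_norm norm_minus_commute)
      then have "(infdist w \<Gamma>)\<^sup>2 \<le> (cmod (z - w))\<^sup>2" by (intro power_mono infdist_nonneg)
      then have "(infdist w \<Gamma>)\<^sup>2 * (cmod (poly (comb N x) z))\<^sup>2
          \<le> (cmod (z - w))\<^sup>2 * (cmod (poly (comb N x) z))\<^sup>2"
        by (rule mult_right_mono) simp
      also have "\<dots> = (cmod (poly ([:- w, 1:] * comb N x) z))\<^sup>2"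
        by (simp add: norm_mult power_mult_distrib[symmetric] del: power_mult_distrib)
           (simp flip: norm_mult add: algebra_simps)
      finally show "(infdist w \<Gamma>)\<^sup>2 * (cmod (poly (comb N x) z))\<^sup>2
          \<le> (cmod (poly ([:- w, 1:] * comb N x) z))\<^sup>2" .
    qed (intro integrable_continuous continuous_intros)+
    also have "\<dots> = (norm (D v - ell2_scaleC w v))\<^sup>2"
      by (subst shifted_comb(2)[OF v], subst shifted_comb(1)[OF v, symmetric])
        (simp only: poly_norm_sq[symmetric] poly_norm_comb ell2_norm_fin)
    finally show ?thesis by (rule power2_le_imp_le) simp
  qed
  have lim: "(\<lambda>N. ell2_proj N v) \<longlonglongrightarrow> v" by (rule ell2_proj_tendsto)
  have "bounded_linear (ell2_scaleC w)"
    by (rule bounded_linear_intro[where K = "cmod w"])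
      (auto intro!: ell2_eqI simp: ell2_nth_scaleC ell2_nth_add scaleR_ell2.rep_eq algebra_simps ell2_norm_scaleC)
  then have lim1: "(\<lambda>N. norm (D (ell2_proj N v) - ell2_scaleC w (ell2_proj N v)))
      \<longlonglongrightarrow> norm (D v - ell2_scaleC w v)"
    using lim
    by (intro tendsto_norm tendsto_diff bounded_linear.tendsto[of D]
        bounded_linear.tendsto[of "ell2_scaleC w"] bounded_clinear_linear(1)[OF clinear_D])
  have lim2: "(\<lambda>N. infdist w \<Gamma> * norm (ell2_proj N v)) \<longlonglongrightarrow> infdist w \<Gamma> * norm v"
    by (intro tendsto_mult tendsto_const tendsto_norm lim)
  show ?thesis
    by (rule LIMSEQ_le[OF lim2 lim1]) (use fin in blast)
qed

lemma pairing_eq_inner: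
  assumes v: "v = ell2_fin N y" and M: "Suc N \<le> M"
  shows "(\<Sum>i<M. ell2_nth (D v - ell2_scaleC w v) i * cnj (x i))
      = poly_inner \<mu> ([:- w, 1:] * comb N y) (comb M x)"
proof -
  have zero: "ell2_nth (D v - ell2_scaleC w v) i = 0" if "\<not> i < Suc N" for i
    using that shifted_comb(2)[OF v, of w] by (metis ell2_nth_fin)
  have "comb (Suc N) (ell2_nth (D v - ell2_scaleC w v)) = comb M (ell2_nth (D v - ell2_scaleC w v))"
    using zero by (subst comb_extend[OF M]) (auto intro!: arg_cong[where f = "comb M"])
  then show ?thesis
    unfolding shifted_comb(1)[OF v, of w, symmetric] by (simp only: inner_comb)
qed

end

section \<open>Polynomial approximation and Jordan arcs\<close>

definition poly_approx :: "complex set \<Rightarrow> (complex \<Rightarrow> complex) \<Rightarrow> bool" where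
  "poly_approx S f \<longleftrightarrow> (\<forall>e>0. \<exists>q. \<forall>z\<in>S. cmod (f z - poly q z) < e)"

lemma poly_approxD:
  assumes "poly_approx S f" "e > 0"
  obtains q where "\<And>z. z \<in> S \<Longrightarrow> cmod (f z - poly q z) < e"
  using assms unfolding poly_approx_def by blast

lemma poly_approx_poly: "poly_approx S (poly q)"
  unfolding poly_approx_def by (intro allI impI exI[of _ q]) simp

lemma poly_approx_const: "poly_approx S (\<lambda>z. c)"
  unfolding poly_approx_def by (intro allI impI exI[of _ "[:c:]"]) simp

lemma poly_approx_add:
  assumes "poly_approx S f" "poly_approx S g"
  shows "poly_approx S (\<lambda>z. f z + g z)"
  unfolding poly_approx_def
proof (intro allI impI)
  fix e :: real assume "e > 0"
  then obtain p q where p: "\<And>z. z \<in> S \<Longrightarrow> cmod (f z - poly p z) < e / 2"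
    and q: "\<And>z. z \<in> S \<Longrightarrow> cmod (g z - poly q z) < e / 2"
    using poly_approxD[OF assms(1), of "e / 2"] poly_approxD[OF assms(2), of "e / 2"]
        by (metis half_gt_zero)
  have "cmod (f z + g z - poly (p + q) z) < e" if "z \<in> S" for z
    using norm_triangle_ineq[of "f z - poly p z" "g z - poly q z"] p[OF that] q[OF that]
    by (simp add: algebra_simps)
  then show "\<exists>q. \<forall>z\<in>S. cmod (f z + g z - poly q z) < e" by blast
qed

lemma poly_approx_mult:
  assumes "poly_approx S f" "poly_approx S g" and "bounded (f ` S)" "bounded (g ` S)"
  shows "poly_approx S (\<lambda>z. f z * g z)"
  unfolding poly_approx_def
proof (intro allI impI)
  fix e :: real assume e: "e > 0"
  obtain B where B: "B > 0" "\<And>z. z \<in> S \<Longrightarrow> cmod (f z) \<le> B"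
    using assms(3) unfolding bounded_pos by auto
  obtain C where C: "C > 0" "\<And>z. z \<in> S \<Longrightarrow> cmod (g z) \<le> C"
    using assms(4) unfolding bounded_pos by auto
  define h where "h = min 1 (e / (B + C + 1))"
  have h: "h > 0" "h \<le> 1" "h * (B + C + 1) \<le> e"
    using e B(1) C(1) pos_le_divide_eq[of "B + C + 1" h e] by (auto simp: h_def)
  obtain p where p: "\<And>z. z \<in> S \<Longrightarrow> cmod (f z - poly p z) < h"
    using poly_approxD[OF assms(1) h(1)] by blast
  obtain q where q: "\<And>z. z \<in> S \<Longrightarrow> cmod (g z - poly q z) < h"
    using poly_approxD[OF assms(2) h(1)] by blast
  have "cmod (f z * g z - poly (p * q) z) < e" if z: "z \<in> S" for z
  proof -
    have "f z * g z - poly (p * q) z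
        = f z * (g z - poly q z) + (f z - poly p z) * g z - (f z - poly p z) * (g z - poly q z)"
      by (simp add: algebra_simps)
    then have "cmod (f z * g z - poly (p * q) z)
        \<le> cmod (f z) * cmod (g z - poly q z) + cmod (f z - poly p z) * cmod (g z)
          + cmod (f z - poly p z) * cmod (g z - poly q z)"
      using norm_triangle_ineq4[of "f z * (g z - poly q z) + (f z - poly p z) * g z"
          "(f z - poly p z) * (g z - poly q z)"]
        norm_triangle_ineq[of "f z * (g z - poly q z)" "(f z - poly p z) * g z"]
      unfolding norm_mult by simp
    also have "\<dots> \<le> B * cmod (g z - poly q z) + h * C + h * 1"
      using B C p[OF z] q[OF z] z h
      by (intro add_mono mult_mono) (auto intro: less_imp_le order_trans)
    also have "\<dots> < B * h + h * C + h * 1"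
      using B(1) q[OF z] by simp
    also have "\<dots> \<le> e" using h(3) by (simp add: algebra_simps)
    finally show ?thesis .
  qed
  then show "\<exists>q. \<forall>z\<in>S. cmod (f z * g z - poly q z) < e" by blast
qed

lemma poly_approx_limit:
  assumes "\<And>e. e > 0 \<Longrightarrow> \<exists>g. poly_approx S g \<and> (\<forall>z\<in>S. cmod (f z - g z) < e)"
  shows "poly_approx S f"
  unfolding poly_approx_def
proof (intro allI impI)
  fix e :: real assume e: "e > 0"
  obtain g where g: "poly_approx S g" "\<And>z. z \<in> S \<Longrightarrow> cmod (f z - g z) < e / 2"
    using assms[of "e / 2"] e by auto
  obtain q where q: "\<And>z. z \<in> S \<Longrightarrow> cmod (g z - poly q z) < e / 2"
    using poly_approxD[OF g(1), of "e / 2"] e by auto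
  have "cmod (f z - poly q z) < e" if "z \<in> S" for z
    using norm_triangle_ineq[of "f z - g z" "g z - poly q z"] g(2)[OF that] q[OF that] by simp
  then show "\<exists>q. \<forall>z\<in>S. cmod (f z - poly q z) < e" by blast
qed

lemma poly_approx_cong: "(\<And>z. z \<in> S \<Longrightarrow> f z = g z) \<Longrightarrow> poly_approx S f = poly_approx S g"
  unfolding poly_approx_def by (metis (no_types, lifting))

lemma poly_approx_power:
  assumes "poly_approx S f" "bounded (f ` S)"
  shows "poly_approx S (\<lambda>z. f z ^ n)" "bounded ((\<lambda>z. f z ^ n) ` S)"
proof -
  obtain B where B: "\<And>z. z \<in> S \<Longrightarrow> cmod (f z) \<le> B"
    using assms(2) unfolding bounded_iff by auto
  show bd: "bounded ((\<lambda>z. f z ^ n) ` S)" for n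
    unfolding bounded_iff by (intro exI[of _ "B ^ n"]) (auto simp: norm_power intro!: power_mono B)
  show "poly_approx S (\<lambda>z. f z ^ n)"
  proof (induction n)
    case 0
    show ?case by (simp add: poly_approx_const)
  next
    case (Suc n)
    then show ?case using poly_approx_mult[OF assms(1) Suc assms(2) bd] by simp
  qed
qed

lemma poly_approx_sum:
  assumes "\<And>i. i \<in> I \<Longrightarrow> poly_approx S (f i)"
  shows "poly_approx S (\<lambda>z. \<Sum>i\<in>I. f i z)"
  using assms
proof (induction I rule: infinite_finite_induct)
  case (insert i I)
  then show ?case by (simp add: poly_approx_add)
qed (auto simp: poly_approx_const)

lemma poly_approx_cmult: "poly_approx S f \<Longrightarrow> poly_approx S (\<lambda>z. c * f z)"
proof (rule poly_approx_limit)
  fix e :: real assume f: "poly_approx S f" and e: "e > 0"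
  have "e / (cmod c + 1) > 0" using e by (simp add: add_nonneg_pos)
  then obtain q where q: "\<And>z. z \<in> S \<Longrightarrow> cmod (f z - poly q z) < e / (cmod c + 1)"
    using poly_approxD[OF f] by blast
  have "cmod (c * f z - poly (smult c q) z) < e" if "z \<in> S" for z
  proof -
    have "cmod (c * f z - poly (smult c q) z) = cmod c * cmod (f z - poly q z)"
      by (simp flip: norm_mult add: algebra_simps)
    also have "\<dots> \<le> (cmod c) * (e / (cmod c + 1))"
      using q[OF that] by (intro mult_left_mono) auto
    also have "\<dots> < (cmod c + 1) * (e / (cmod c + 1))"
      using e by (intro mult_strict_right_mono divide_pos_pos) (auto simp: add_nonneg_pos)
    also have "\<dots> = e" using add_nonneg_pos[of "cmod c" 1] by (simp add: field_simps)
    finally show ?thesis .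
  qed
  then show "\<exists>g. poly_approx S g \<and> (\<forall>z\<in>S. cmod (c * f z - g z) < e)"
    using poly_approx_poly by blast
qed

text \<open>Summing a geometric series moves the pole.\<close>

lemma poly_approx_geometric:
  assumes g: "poly_approx S g" "\<And>z. z \<in> S \<Longrightarrow> cmod (g z) \<le> 1 / 2"
  shows "poly_approx S (\<lambda>z. 1 / (1 - g z))"
proof (rule poly_approx_limit)
  fix e :: real assume e: "e > 0"
  obtain n where n: "(1 / 2) ^ n < e / 2" using real_arch_pow_inv[of "e / 2" "1 / 2"] e by auto
  have bd: "bounded (g ` S)" unfolding bounded_iff using g(2) by (intro exI[of _ "1 / 2"]) auto
  have "cmod (1 / (1 - g z) - (\<Sum>i<n. g z ^ i)) < e" if z: "z \<in> S" for z
  proof -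
    have ne: "g z \<noteq> 1" using g(2)[OF z] by auto
    have "1 - cmod (g z) \<le> cmod (1 - g z)"
      using norm_triangle_ineq2[of 1 "g z"] by simp
    then have ge: "1 / 2 \<le> cmod (1 - g z)" using g(2)[OF z] by linarith
    have "1 / (1 - g z) - (\<Sum>i<n. g z ^ i) = g z ^ n / (1 - g z)"
      using ne by (simp add: sum_gp_strict diff_divide_distrib)
    then have "cmod (1 / (1 - g z) - (\<Sum>i<n. g z ^ i)) = cmod (g z) ^ n / cmod (1 - g z)"
      by (simp add: norm_divide norm_power)
    also have "\<dots> \<le> (1 / 2) ^ n / (1 / 2)"
      using ge g(2)[OF z] by (intro frac_le power_mono) auto
    also have "\<dots> < e" using n by simp
    finally show ?thesis .
  qed
  then show "\<exists>h. poly_approx S h \<and> (\<forall>z\<in>S. cmod (1 / (1 - g z) - h z) < e)"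
    by (intro exI[of _ "\<lambda>z. \<Sum>i<n. g z ^ i"] conjI poly_approx_sum poly_approx_power(1) g(1) bd) auto
qed

lemma poly_approx_inverse_shift:
  assumes "compact S" "S \<noteq> {}" "w0 \<notin> S" "dist w w0 \<le> infdist w0 S / 2"
    "poly_approx S (\<lambda>z. 1 / (z - w0))"
  shows "poly_approx S (\<lambda>z. 1 / (z - w))"
proof -
  have inf: "infdist w0 S \<le> cmod (z - w0)" if "z \<in> S" for z
    using infdist_le[OF that, of w0] by (simp add: dist_norm norm_minus_commute)
  have pos: "infdist w0 S > 0"
    using assms by (simp add: infdist_pos_not_in_closed compact_imp_closed)
  let ?g = "\<lambda>z. (w - w0) * (1 / (z - w0))"
  have g: "cmod (?g z) \<le> 1 / 2" if "z \<in> S" for z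
  proof -
    have "cmod (?g z) = dist w w0 / cmod (z - w0)"
      by (simp add: norm_divide dist_norm)
    also have "\<dots> \<le> (infdist w0 S / 2) / infdist w0 S"
      using assms(4) inf[OF that] pos by (intro frac_le) auto
    finally show ?thesis using pos by simp
  qed
  have app: "poly_approx S (\<lambda>z. 1 / (1 - ?g z))"
    by (rule poly_approx_geometric[OF poly_approx_cmult[OF assms(5)] g])
  have bd1: "bounded ((\<lambda>z. 1 / (z - w0)) ` S)"
    unfolding bounded_iff using pos inf
    by (intro exI[of _ "1 / infdist w0 S"]) (auto simp: norm_divide intro!: frac_le)
  have bd2: "bounded ((\<lambda>z. 1 / (1 - ?g z)) ` S)"
    unfolding bounded_iff
  proof (intro exI[of _ 2] ballI, elim imageE)
    fix z y assume z: "z \<in> S" and y: "y = 1 / (1 - ?g z)"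
    have "1 / 2 \<le> cmod (1 - ?g z)"
      using norm_triangle_ineq2[of 1 "?g z"] g[OF z] by simp
    then have "1 / cmod (1 - ?g z) \<le> 1 / (1 / 2)" by (intro frac_le) auto
    then show "cmod y \<le> 2" unfolding y by (simp only: norm_divide norm_one) simp
  qed
  have "poly_approx S (\<lambda>z. 1 / (z - w0) * (1 / (1 - ?g z)))"
    by (rule poly_approx_mult[OF assms(5) app bd1 bd2])
  moreover have "1 / (z - w0) * (1 / (1 - ?g z)) = 1 / (z - w)" if "z \<in> S" for z
  proof -
    have "z \<noteq> w0" using assms(3) that by auto
    then have "(z - w0) * (1 - ?g z) = z - w" by (simp add: field_simps)
    then show ?thesis by (simp flip: divide_divide_eq_left add: divide_divide_eq_left')
  qed
  ultimately show ?thesis using poly_approx_cong by (metis (no_types, lifting))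
qed

lemma poly_approx_inverse:
  assumes S: "compact S" "S \<noteq> {}" "connected (- S)" and w: "w \<notin> S"
  shows "poly_approx S (\<lambda>z. 1 / (z - w))"
proof -
  let ?W = "{w \<in> - S. poly_approx S (\<lambda>z. 1 / (z - w))}"
  have pos: "infdist w S > 0" if "w \<notin> S" for w
    using S that by (simp add: infdist_pos_not_in_closed compact_imp_closed)
  have opn: "open ?W"
    unfolding open_dist
  proof
    fix w0 assume w0: "w0 \<in> ?W"
    show "\<exists>e>0. \<forall>y. dist y w0 < e \<longrightarrow> y \<in> ?W"
    proof (intro exI conjI allI impI)
      show "infdist w0 S / 2 > 0" using pos[of w0] w0 by auto
      fix y assume y: "dist y w0 < infdist w0 S / 2"
      then have "y \<notin> S" using infdist_le[of y S w0] pos[of w0] w0 by (auto simp: dist_commute)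
      moreover have "poly_approx S (\<lambda>z. 1 / (z - y))"
        using poly_approx_inverse_shift[OF S(1,2), of w0 y] w0 y by auto
      ultimately show "y \<in> ?W" by simp
    qed
  qed
  have opn2: "open (- S - ?W)"
    unfolding open_dist
  proof
    fix w0 assume w0: "w0 \<in> - S - ?W"
    show "\<exists>e>0. \<forall>y. dist y w0 < e \<longrightarrow> y \<in> - S - ?W"
    proof (intro exI conjI allI impI)
      show "infdist w0 S / 3 > 0" using pos[of w0] w0 by auto
      fix y assume y: "dist y w0 < infdist w0 S / 3"
      have "infdist w0 S \<le> infdist y S + dist w0 y" by (rule infdist_triangle)
      then have le: "dist w0 y \<le> infdist y S / 2" using y by (simp add: dist_commute)
      have "y \<notin> S" using infdist_le[of y S w0] y pos[of w0] w0 by (auto simp: dist_commute)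
      then show "y \<in> - S - ?W"
        using poly_approx_inverse_shift[OF S(1,2) _ le] w0 by auto
    qed
  qed
  obtain R where R: "R > 0" "\<And>z. z \<in> S \<Longrightarrow> cmod z \<le> R"
    using compact_imp_bounded[OF S(1)] unfolding bounded_pos by auto
  have "complex_of_real (2 * R) \<in> ?W"
  proof -
    let ?w = "complex_of_real (2 * R)"
    have nS: "?w \<notin> S" using R by (auto simp: norm_mult dest: R(2))
    have "poly_approx S (\<lambda>z. 1 / (1 - (1 / ?w) * poly [:0, 1:] z))"
      using R by (intro poly_approx_geometric poly_approx_cmult poly_approx_poly)
        (auto simp: norm_divide norm_mult field_simps)
    then have "poly_approx S (\<lambda>z. (- 1 / ?w) * (1 / (1 - (1 / ?w) * poly [:0, 1:] z)))"
      by (rule poly_approx_cmult)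
    moreover have "(- 1 / ?w) * (1 / (1 - (1 / ?w) * poly [:0, 1:] z)) = 1 / (z - ?w)" if "z \<in> S" for z
    proof -
      have "z \<noteq> ?w" "?w \<noteq> 0" using nS that R(1) by auto
      then have "1 - z / ?w = (?w - z) / ?w" by (simp only: diff_divide_distrib) simp
      then show ?thesis using \<open>z \<noteq> ?w\<close> \<open>?w \<noteq> 0\<close> by (simp add: divide_simps)
    qed
    ultimately have "poly_approx S (\<lambda>z. 1 / (z - ?w))"
      using poly_approx_cong by (metis (no_types, lifting))
    then show ?thesis using nS by simp
  qed
  then have "- S - ?W = {}"
    using connectedD[OF S(3) opn opn2] by blast
  then show ?thesis using w by auto
qed

lemma peak_poly:
  assumes S: "compact S" "connected (- S)" "interior S
      = {}" and l: "l \<in> S" and s: "s > 0" and t: "t > 0"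
  obtains q where "\<And>z. z \<in> S \<Longrightarrow> dist z l < s / 4 \<Longrightarrow> 1 / 2 \<le> cmod (poly q z)"
    and "\<And>z. z \<in> S \<Longrightarrow> s \<le> dist z l \<Longrightarrow> cmod (poly q z) \<le> t"
proof -
  have "\<not> ball l (s / 4) \<subseteq> S"
    using S(3) s by (auto simp: interior_def)
  then obtain w where w: "dist l w < s / 4" "w \<notin> S" by (auto simp: subset_iff)
  define g where "g z = of_real (s / 2) * (1 / (z - w))" for z :: complex
  define e where "e = min t 1 / 2"
  have e: "e > 0" "e \<le> 1 / 2" "2 * e \<le> t" using t by (auto simp: e_def)
  obtain k where k: "(2 / 3 :: real) ^ k < e" using real_arch_pow_inv[of e "2 / 3"] e by auto
  have pos: "infdist w S > 0"
    using S l w by (intro infdist_pos_not_in_closed) (auto intro: compact_imp_closed)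
  have wS: "infdist w S \<le> cmod (z - w)" if "z \<in> S" for z
    using infdist_le[OF that, of w] by (simp add: dist_norm norm_minus_commute)
  have ng: "cmod (g z) = (s / 2) / cmod (z - w)" for z
    unfolding g_def norm_mult norm_divide norm_of_real norm_one using s by simp
  have bdd: "bounded (g ` S)"
    unfolding bounded_iff using pos wS s
    by (intro exI[of _ "(s / 2) / infdist w S"]) (auto simp: ng intro!: frac_le)
  have "poly_approx S (\<lambda>z. g z)"
    unfolding g_def using S l w by (intro poly_approx_cmult poly_approx_inverse) auto
  then obtain q where q: "\<And>z. z \<in> S \<Longrightarrow> cmod (g z ^ k - poly q z) < e"
    using poly_approxD[OF poly_approx_power(1)[OF _ bdd]] e(1) by blast
  show ?thesis
  proof (rule that[of q])
    fix z assume z: "z \<in> S" "dist z l < s / 4"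
    have "cmod (z - w) \<le> s / 2" using z(2) w(1) dist_triangle[of z w l] by (simp add: dist_norm)
    moreover have "cmod (z - w) > 0" using wS[OF z(1)] pos by linarith
    ultimately have "1 \<le> cmod (g z)" by (simp add: ng)
    then have "1 \<le> cmod (g z ^ k)" by (simp add: norm_power)
    then show "1 / 2 \<le> cmod (poly q z)"
      using q[OF z(1)] e(2) norm_triangle_ineq2[of "g z ^ k" "poly q z"] by linarith
  next
    fix z assume z: "z \<in> S" "s \<le> dist z l"
    have "3 / 4 * s \<le> cmod (z - w)" using z(2) w(1) dist_triangle[of z l w]
      by (simp add: dist_norm norm_minus_commute)
    then have "(s / 2) / cmod (z - w) \<le> (s / 2) / (3 / 4 * s)" using s by (intro frac_le) auto
    then have "cmod (g z) \<le> 2 / 3" using s by (simp add: ng)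
    then have "cmod (g z ^ k) \<le> (2 / 3) ^ k" by (simp add: norm_power power_mono)
    then show "cmod (poly q z) \<le> t"
      using q[OF z(1)] e(3) k norm_triangle_ineq2[of "poly q z" "g z ^ k"]
      by (simp add: norm_minus_commute)
  qed
qed

lemma Jordan_arc_props:
  assumes "Jordan_arc A"
  shows "compact A" "connected A" "infinite A" "interior A = {}"
proof -
  obtain f g where fg: "homeomorphism {0..1::real} A f g"
    using assms unfolding Jordan_arc_def homeomorphic_def by (metis homeomorphism_symD)
  show "compact A" "connected A"
    using assms unfolding Jordan_arc_def
    by (metis homeomorphic_compactness compact_Icc, metis homeomorphic_connectedness connected_Icc)
  show "infinite A"
  proof
    assume "finite A"
    then have "finite (g ` A)" by (rule finite_imageI)
    then have "finite {0..1::real}" using homeomorphism_image2[OF fg] by metis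
    with infinite_Icc[of "0::real" 1, OF zero_less_one] show False by contradiction
  qed
  show "interior A = {}"
  proof (rule ccontr)
    assume "interior A \<noteq> {}"
    then obtain x e where e: "e > 0" "ball x e \<subseteq> A"
      by (meson all_not_in_conv mem_interior)
    have ci: "continuous_on (ball x e) g"
      using fg e(2) unfolding homeomorphism_def by (auto intro: continuous_on_subset)
    have inj: "inj_on g (ball x e)"
      using fg e(2) unfolding homeomorphism_def by (metis inj_on_def subsetD)
    have pts: "x \<in> ball x e" "x + of_real (e / 2) \<in> ball x e" "x - of_real (e / 2) \<in> ball x e"
      using e(1) by (auto simp: dist_norm)
    have "g x \<noteq> g (x + of_real (e / 2))" "g x \<noteq> g (x - of_real (e / 2))"
      "g (x + of_real (e / 2)) \<noteq> g (x - of_real (e / 2))"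
      using pts e(1) by (simp_all add: inj_on_eq_iff[OF inj])
    text \<open>Removing the median of three values disconnects the image, but not the punctured ball.\<close>
    then obtain p a b where p: "p \<in> ball x e" and ab: "a \<in> ball x e" "b \<in> ball x e" "g a < g p" "g p < g b"
      using pts by (metis linorder_neqE)
    have "connected (ball x e - {p})"
      by (intro connected_open_delete) auto
    then have "connected (g ` (ball x e - {p}))"
      using ci by (intro connected_continuous_image) (auto intro: continuous_on_subset)
    moreover have "g a \<in> g ` (ball x e - {p})" "g b \<in> g ` (ball x e - {p})"
      using ab by auto
    ultimately have "g p \<in> g ` (ball x e - {p})"
      using ab(3,4) unfolding connected_iff_interval by (meson less_imp_le)
    then show False using inj_onD[OF inj] p by auto
  qed
qed

lemma uncountable_connected_Int_ball:
  fixes A :: "'a :: metric_space set"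
  assumes "connected A" "infinite A" "l \<in> A" "e > 0"
  shows "uncountable (A \<inter> ball l e)"
proof -
  obtain b where b: "b \<in> A" "b \<noteq> l"
    using assms(2) by (metis finite.emptyI finite_insert finite_subset insertCI subsetI)
  define m where "m = min e (dist l b)"
  have m: "m > 0" using b assms(4) by (simp add: m_def)
  have con: "connected (dist l ` A)"
    by (intro connected_continuous_image assms continuous_intros)
  have "{0<..<m} \<subseteq> dist l ` (A \<inter> ball l e)"
  proof
    fix r assume r: "r \<in> {0<..<m}"
    have "dist l l \<in> dist l ` A" "dist l b \<in> dist l ` A" using assms b by auto
    then have "r \<in> dist l ` A"
      using con r unfolding connected_iff_interval m_def
          by (metis dist_self greaterThanLessThan_iff less_imp_le min_less_iff_conj)
    then show "r \<in> dist l ` (A \<inter> ball l e)" using r by (auto simp: m_def)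
  qed
  moreover have "uncountable {0<..<m}" using m by (simp add: uncountable_open_interval)
  ultimately have "uncountable (dist l ` (A \<inter> ball l e))" by (metis countable_subset)
  then show ?thesis by (metis countable_image)
qed

lemma Jordan_arc_Union_props:
  assumes "finite \<A>" "\<forall>A\<in>\<A>. Jordan_arc A"
  shows "compact (\<Union>\<A>)" "interior (\<Union>\<A>) = {}"
    "\<lbrakk>l \<in> \<Union>\<A>; e > 0\<rbrakk> \<Longrightarrow> uncountable (\<Union>\<A> \<inter> ball l e)"
proof -
  show "compact (\<Union>\<A>)" using assms Jordan_arc_props(1) by (intro compact_Union) auto
  show "interior (\<Union>\<A>) = {}"
    using assms
  proof (induction \<A>)
    case (insert A \<A>)
    then have "closed A" "interior (\<Union>\<A>) = {}" "interior A = {}"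
      using Jordan_arc_props(1,4)[of A] by (auto intro: compact_imp_closed)
    then show ?case using interior_closed_Un_empty_interior[of A "\<Union>\<A>"] by simp
  qed simp
  assume l: "l \<in> \<Union>\<A>" "e > 0"
  then obtain A where A: "A \<in> \<A>" "l \<in> A" by blast
  then have "uncountable (A \<inter> ball l e)"
    using assms Jordan_arc_props l by (intro uncountable_connected_Int_ball) auto
  moreover have "A \<inter> ball l e \<subseteq> \<Union>\<A> \<inter> ball l e" using A by auto
  ultimately show "uncountable (\<Union>\<A> \<inter> ball l e)" by (metis countable_subset)
qed

context orthonormal_poly_measure
begin

lemma poly_norm_mult_inner_le:
  "cmod (poly_inner \<mu> (p * q) r) \<le> poly_norm q * poly_norm (p * r)"
proof -
  have "cmod (poly_inner \<mu> (p * q) r) \<le> (LINT z|\<mu>. cmod (poly (p * q) z * cnj (poly r z)))"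
    unfolding poly_inner_def by (rule integral_norm_bound)
  also have "\<dots> = (LINT z|\<mu>. cmod (poly q z) * cmod (poly (p * r) z))"
    by (intro Bochner_Integration.integral_cong) (auto simp: norm_mult)
  also have "\<dots> \<le> poly_norm q * poly_norm (p * r)"
  proof -
    have "(LINT z|\<mu>. cmod (poly q z) * cmod (poly (p * r) z))\<^sup>2 \<le> (poly_norm q * poly_norm (p * r))\<^sup>2"
      unfolding power_mult_distrib poly_norm_sq
      by (intro integral_Cauchy_Schwarz integrable_continuous continuous_intros)
    then show ?thesis
      by (rule power2_le_imp_le) (intro mult_nonneg_nonneg poly_norm_nonneg)
  qed
  finally show ?thesis .
qed

lemma measure_ball_small:
  assumes "measure \<mu> {l} = 0" "e > 0"
  shows "\<exists>s0>0. \<forall>s\<le>s0. measure \<mu> (ball l s) < e"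
proof -
  have dec: "decseq (\<lambda>n. ball l (1 / real (Suc n)))"
    by (intro decseq_SucI subset_ball) (simp add: frac_le)
  have "(\<Inter>n. ball l (1 / real (Suc n))) = {l}"
  proof (intro equalityI subsetI)
    fix x assume x: "x \<in> (\<Inter>n. ball l (1 / real (Suc n)))"
    have "dist l x \<le> 0"
    proof (rule field_le_epsilon)
      fix e :: real assume "e > 0"
      then obtain n where "1 / real (Suc n) < e" using nat_approx_posE by blast
      moreover have "dist l x < 1 / real (Suc n)" using x by auto
      ultimately show "dist l x \<le> 0 + e" by simp
    qed
    then show "x \<in> {l}" by simp
  qed auto
  moreover have "(\<lambda>n. measure \<mu> (ball l (1 / real (Suc n))))
      \<longlonglongrightarrow> measure \<mu> (\<Inter>n. ball l (1 / real (Suc n)))"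
    by (rule finite_Lim_measure_decseq[OF _ dec]) (auto simp: sets_eq)
  ultimately have "(\<lambda>n. measure \<mu> (ball l (1 / real (Suc n)))) \<longlonglongrightarrow> 0" using assms by simp
  then have "\<forall>\<^sub>F n in sequentially. measure \<mu> (ball l (1 / real (Suc n))) < e"
    by (rule order_tendstoD(2)) (rule assms(2))
  then obtain n where n: "measure \<mu> (ball l (1 / real (Suc n))) < e"
    using eventually_happens' sequentially_bot by blast
  have "measure \<mu> (ball l s) < e" if "s \<le> 1 / real (Suc n)" for s
    using finite_measure_mono[of "ball l s" "ball l (1 / real (Suc n))"] that n
    by (simp add: sets_eq subset_ball)
  then show ?thesis by (intro exI[of _ "1 / real (Suc n)"]) auto
qed

lemma singular_poly:
  assumes conn: "connected (- \<Gamma>)" and int: "interior \<Gamma> = {}" and l: "l \<in> \<Gamma>"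
    and atom: "measure \<mu> {l} = 0" and h: "h > 0"
  obtains q where "poly_norm q > 0" "poly_norm ([:- l, 1:] * q) \<le> h * poly_norm q"
    "\<And>j. j < N \<Longrightarrow> cmod (poly_inner \<mu> q (P j)) \<le> h * poly_norm q"
proof -
  have bd: "\<exists>B>0. \<forall>z\<in>\<Gamma>. cmod (poly p z) \<le> B" for p
  proof -
    have "compact (poly p ` \<Gamma>)"
      by (intro compact_continuous_image continuous_intros compact_support)
    then have "bounded (poly p ` \<Gamma>)" by (rule compact_imp_bounded)
    then show ?thesis unfolding bounded_pos by auto
  qed
  obtain R where R: "R > 0" "\<And>z. z \<in> \<Gamma> \<Longrightarrow> cmod (z - l) \<le> R"
    using bd[of "[:- l, 1:]"] by (auto simp: algebra_simps)
  obtain B0 :: "nat \<Rightarrow> real" where B0: "\<And>j. B0 j > 0" "\<And>j z. z \<in> \<Gamma> \<Longrightarrow> cmod (poly (P j) z) \<le> B0 j"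
    using choice[of "\<lambda>j B. B > 0 \<and> (\<forall>z\<in>\<Gamma>. cmod (poly (P j) z) \<le> B)"] bd by blast
  define B where "B = 1 + (\<Sum>j<N. B0 j)"
  have B: "B > 0" unfolding B_def using B0(1)
      by (intro add_pos_nonneg sum_nonneg) (auto intro: less_imp_le)
  have PB: "cmod (poly (P j) z) \<le> B" if "j < N" "z \<in> \<Gamma>" for j z
  proof -
    have "B0 j \<le> (\<Sum>j<N. B0 j)" using that B0(1) by (intro member_le_sum) (auto intro: less_imp_le)
    then show ?thesis using B0(2)[OF that(2), of j] by (simp add: B_def)
  qed
  obtain s0 where s0: "s0 > 0" "\<And>s. s \<le> s0 \<Longrightarrow> measure \<mu> (ball l s) < (h / (2 * B))\<^sup>2"
    using measure_ball_small[OF atom, of "(h / (2 * B))\<^sup>2"] h B by auto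
  define s where "s = min s0 (h / 2)"
  have s: "s > 0" "s \<le> h / 2" using s0 h by (auto simp: s_def)
  have ms: "sqrt (measure \<mu> (ball l s)) \<le> h / (2 * B)"
    using s0(2)[of s] h B by (intro real_le_lsqrt) (auto simp: s_def)
  define m0 where "m0 = measure \<mu> (ball l (s / 4))"
  have m0: "m0 > 0"
  proof -
    have "emeasure \<mu> (ball l (s / 4)) > 0"
      using l s unfolding measure_support_def by auto
    then show ?thesis by (simp add: m0_def emeasure_eq_measure)
  qed
  define c where "c = sqrt m0 / 2"
  have c: "c > 0" using m0 by (simp add: c_def)
  define t where "t = h * c / (2 * (R + B))"
  have t: "t > 0" using h c R(1) B by (simp add: t_def)
  have "t * (R + B) = h / 2 * c"
    using R(1) B by (simp add: t_def nonzero_eq_divide_eq) (simp add: field_simps)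
  then have tRB: "R * t \<le> h / 2 * c" "B * t \<le> h / 2 * c"
    using t R(1) B by (auto simp: algebra_simps) (smt (verit) mult_pos_pos)+
  obtain q where q1: "\<And>z. z \<in> \<Gamma> \<Longrightarrow> dist z l < s / 4 \<Longrightarrow> 1 / 2 \<le> cmod (poly q z)"
    and q2: "\<And>z. z \<in> \<Gamma> \<Longrightarrow> s \<le> dist z l \<Longrightarrow> cmod (poly q z) \<le> t"
    using peak_poly[OF compact_support conn int l s(1) t] by blast
  let ?n = "poly_norm q"
  have meas_ball [measurable]: "ball l r \<in> sets \<mu>" for r by (simp add: sets_eq)
  have nc: "c \<le> ?n"
  proof -
    have "m0 / 4 = (LINT z|\<mu>. indicator (ball l (s / 4)) z * (1 / 4))"
      by (simp add: m0_def)
    also have "\<dots> \<le> (LINT z|\<mu>. (cmod (poly q z))\<^sup>2)"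
    proof (rule integral_mono_on_support)
      fix z assume z: "z \<in> \<Gamma>"
      show "indicator (ball l (s / 4)) z * (1 / 4) \<le> (cmod (poly q z))\<^sup>2"
      proof (cases "z \<in> ball l (s / 4)")
        case True
        then have "(1 / 2)\<^sup>2 \<le> (cmod (poly q z))\<^sup>2"
          using q1[OF z] by (intro power_mono) (auto simp: dist_commute)
        then show ?thesis using True by (simp add: power2_eq_square)
      qed simp
    next
      show "integrable \<mu> (\<lambda>z. indicator (ball l (s / 4)) z * (1 / 4 :: real))"
        by (intro integrable_mult_left integrable_real_indicator) (auto simp: emeasure_eq_measure)
    qed (intro integrable_continuous continuous_intros)
    finally have "m0 / 4 \<le> ?n\<^sup>2" by (simp add: poly_norm_sq)
    then have "c\<^sup>2 \<le> ?n\<^sup>2" using m0 by (simp add: c_def power_divide)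
    then show ?thesis by (rule power2_le_imp_le) (rule poly_norm_nonneg)
  qed
  show ?thesis
  proof (rule that[of q])
    show "poly_norm q > 0" using nc c by linarith
    have "(poly_norm ([:- l, 1:] * q))\<^sup>2 \<le> (LINT z|\<mu>. s\<^sup>2 * (cmod (poly q z))\<^sup>2 + (R * t)\<^sup>2)"
      unfolding poly_norm_sq
    proof (rule integral_mono_on_support)
      fix z assume z: "z \<in> \<Gamma>"
      have eq: "(cmod (poly ([:- l, 1:] * q) z))\<^sup>2 = (cmod (z - l) * cmod (poly q z))\<^sup>2"
        by (simp flip: norm_mult add: algebra_simps)
      show "(cmod (poly ([:- l, 1:] * q) z))\<^sup>2 \<le> s\<^sup>2 * (cmod (poly q z))\<^sup>2 + (R * t)\<^sup>2"
      proof (cases "s \<le> dist z l")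
        case True
        then have "cmod (z - l) * cmod (poly q z) \<le> R * t"
          using R q2 z by (intro mult_mono) auto
        then have "(cmod (z - l) * cmod (poly q z))\<^sup>2 \<le> (R * t)\<^sup>2" by (intro power_mono) auto
        then show ?thesis unfolding eq by (simp add: add_increasing)
      next
        case False
        then have "cmod (z - l) * cmod (poly q z) \<le> s * cmod (poly q z)"
          by (intro mult_right_mono) (auto simp: dist_norm)
        then have "(cmod (z - l) * cmod (poly q z))\<^sup>2 \<le> (s * cmod (poly q z))\<^sup>2"
            by (intro power_mono) auto
        then show ?thesis unfolding eq by (simp add: power_mult_distrib add_increasing2)
      qed
    qed (intro integrable_continuous continuous_intros)+
    also have "\<dots> = s\<^sup>2 * ?n\<^sup>2 + (R * t)\<^sup>2"
      by (subst Bochner_Integration.integral_add)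
        (auto intro!: integrable_continuous continuous_intros simp: poly_norm_sq prob_space)
    also have "\<dots> \<le> (h / 2)\<^sup>2 * ?n\<^sup>2 + (h / 2 * ?n)\<^sup>2"
    proof (intro add_mono mult_right_mono power_mono)
      show "R * t \<le> h / 2 * ?n" using tRB(1) nc h mult_left_mono[of c ?n "h / 2"] by linarith
    qed (use s R t in auto)
    also have "\<dots> \<le> (h * ?n)\<^sup>2" by (simp add: power_mult_distrib power_divide)
    finally show "poly_norm ([:- l, 1:] * q) \<le> h * ?n"
      by (rule power2_le_imp_le) (use h poly_norm_nonneg in auto)
  next
    fix j assume j: "j < N"
    let ?I = "\<lambda>z. indicator (ball l s) z :: real"
    have I_sq: "(?I z)\<^sup>2 = ?I z" for z by (simp add: indicator_def)
    have intI: "integrable \<mu> (\<lambda>z. cmod (poly q z) * ?I z)"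
      by (intro integrable_real_mult_indicator integrable_continuous continuous_intros) simp
    have "cmod (poly_inner \<mu> q (P j)) \<le> (LINT z|\<mu>. cmod (poly q z * cnj (poly (P j) z)))"
      unfolding poly_inner_def by (rule integral_norm_bound)
    also have "\<dots> \<le> (LINT z|\<mu>. B * (cmod (poly q z) * ?I z) + B * t)"
    proof (rule integral_mono_on_support)
      fix z assume z: "z \<in> \<Gamma>"
      have 1: "cmod (poly q z * cnj (poly (P j) z)) \<le> B * cmod (poly q z)"
        using mult_right_mono[OF PB[OF j z], of "cmod (poly q z)"] by (simp add: norm_mult mult.commute)
      show "cmod (poly q z * cnj (poly (P j) z)) \<le> B * (cmod (poly q z) * ?I z) + B * t"
      proof (cases "z \<in> ball l s")
        case True
        then show ?thesis using 1 B t by (simp add: add_increasing2)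
      next
        case False
        then have "B * cmod (poly q z) \<le> B * t"
          using q2[OF z] B by (intro mult_left_mono) (auto simp: dist_commute)
        then show ?thesis using 1 False by simp
      qed
    qed (intro integrable_continuous continuous_intros Bochner_Integration.integrable_add
        integrable_mult_right integrable_const intI)+
    also have "\<dots> = B * (LINT z|\<mu>. cmod (poly q z) * ?I z) + B * t"
      using intI by (simp add: prob_space)
    also have "(LINT z|\<mu>. cmod (poly q z) * ?I z) \<le> ?n * sqrt (measure \<mu> (ball l s))"
    proof -
      have "(LINT z|\<mu>. cmod (poly q z) * ?I z)\<^sup>2
          \<le> (LINT z|\<mu>. (cmod (poly q z))\<^sup>2) * (LINT z|\<mu>. (?I z)\<^sup>2)"
        by (rule integral_Cauchy_Schwarz[OF _ _ intI])
          (intro integrable_continuous continuous_intros, simp add: I_sq emeasure_eq_measure)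
      also have "(LINT z|\<mu>. (?I z)\<^sup>2) = measure \<mu> (ball l s)"
        by (simp add: I_sq)
      finally have "(LINT z|\<mu>. cmod (poly q z) * ?I z)\<^sup>2 \<le> (?n * sqrt (measure \<mu> (ball l s)))\<^sup>2"
        by (simp add: poly_norm_sq power_mult_distrib)
      then show ?thesis by (rule power2_le_imp_le) (simp add: poly_norm_nonneg)
    qed
    also have "\<dots> \<le> ?n * (h / (2 * B))"
      by (intro mult_left_mono ms poly_norm_nonneg)
    finally have "cmod (poly_inner \<mu> q (P j)) \<le> B * (?n * (h / (2 * B))) + B * t"
      using B by (simp add: mult_left_mono)
    also have "\<dots> = h / 2 * ?n + B * t" using B by simp
    also have "\<dots> \<le> h * ?n" using tRB(2) nc h mult_left_mono[of c ?n "h / 2"] by linarith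
    finally show "cmod (poly_inner \<mu> q (P j)) \<le> h * poly_norm q" .
  qed
qed

end

section \<open>Parseval on circles\<close>

abbreviation circ :: "real measure" where "circ \<equiv> lebesgue_on {0..2 * pi}"

lemma measure_circ [simp]: "measure circ {0..2 * pi} = 2 * pi"
  by (simp add: measure_restrict_space)

lemma LINT_circ_cis: "(LINT t|circ. cis (of_int k * t)) = (if k = 0 then of_real (2 * pi) else 0)"
proof (cases "k = 0")
  case False
  have "((\<lambda>t. cis (of_int k * t)) has_integral
      (cis (of_int k * (2 * pi)) / (\<i> * of_int k) - cis (of_int k * 0) / (\<i> * of_int k))) {0..2 * pi}"
  proof (rule fundamental_theorem_of_calculus)
    fix t assume "t \<in> {0..2 * pi}"
    have ii: "- (\<i> * (e * \<i>)) = e" for e by (simp add: complex_eq_iff)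
    have "((\<lambda>t. cis (of_int k * t) / (\<i> * of_int k)) has_vector_derivative
        (of_int k *\<^sub>R (\<i> * cis (of_int k * t))) / (\<i> * of_int k)) (at t within {0..2 * pi})"
      unfolding cis_conv_exp
      by (rule has_vector_derivative_real_field | rule derivative_eq_intros refl | simp add: scaleR_conv_of_real ii)+
    then show "((\<lambda>t. cis (of_int k * t) / (\<i> * of_int k)) has_vector_derivative cis (of_int k * t))
        (at t within {0..2 * pi})"
      using False by (simp add: scaleR_conv_of_real)
  qed simp
  moreover have "cis (of_int k * (2 * pi)) = 1"
    using cis_multiple_2pi[of "of_int k"] by (simp add: mult.commute mult.left_commute)
  ultimately have "((\<lambda>t. cis (of_int k * t)) has_integral 0) {0..2 * pi}" by simp
  moreover have "integrable circ (\<lambda>t. cis (of_int k * t))"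
    by (intro continuous_imp_integrable_real continuous_intros)
  ultimately show ?thesis
    using False lebesgue_integral_eq_integral[of "{0..2 * pi}" "\<lambda>t. cis (of_int k * t)"]
    by (simp add: integral_unique)
qed (simp add: scaleR_conv_of_real)

lemma finite_measure_circ: "finite_measure circ"
  by (rule finite_measure_lebesgue_on) simp

lemma integrable_circ_cont: "continuous_on {0..2 * pi} f \<Longrightarrow> integrable circ f"
  for f :: "real \<Rightarrow> 'b :: euclidean_space"
  by (rule continuous_imp_integrable_real)

lemma LINT_circ_suminf:
  fixes f :: "nat \<Rightarrow> real \<Rightarrow> complex"
  assumes cont: "\<And>n. continuous_on {0..2 * pi} (f n)"
    and bd: "\<And>n t. t \<in> {0..2 * pi} \<Longrightarrow> cmod (f n t) \<le> b n" and b: "summable b"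
  shows "(\<lambda>n. LINT t|circ. f n t) sums (LINT t|circ. (\<Sum>n. f n t))"
proof -
  interpret finite_measure circ by (rule finite_measure_circ)
  have sm: "summable (\<lambda>n. cmod (f n t))" if "t \<in> {0..2 * pi}" for t
    using bd[OF that] by (intro summable_comparison_test'[OF b, of 0]) auto
  show ?thesis
  proof (rule sums_integral)
    show "integrable circ (f n)" for n by (intro integrable_circ_cont cont)
    show "AE t in circ. summable (\<lambda>n. norm (f n t))"
      by (intro AE_I2) (use sm in auto)
    have "(LINT t|circ. norm (f n t)) \<le> 2 * pi * b n" for n
    proof -
      have "(LINT t|circ. norm (f n t)) \<le> (LINT t|circ. b n)"
        by (intro integral_mono integrable_norm integrable_circ_cont cont) (auto intro: bd)
      then show ?thesis by simp
    qed
    then show "summable (\<lambda>n. LINT t|circ. norm (f n t))"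
      by (intro summable_comparison_test'[OF summable_mult[OF b, of "2 * pi"], of 0]) auto
  qed
qed

lemma Parseval_circle:
  fixes a :: "nat \<Rightarrow> complex"
  assumes conv: "summable (\<lambda>n. cmod (a n) * r ^ n)" and r: "0 \<le> r"
  defines "g \<equiv> \<lambda>t. \<Sum>n. a n * (of_real r * cis t) ^ n"
  shows "(\<lambda>n. (cmod (a n))\<^sup>2 * r ^ (2 * n)) sums ((LINT t|circ. (cmod (g t))\<^sup>2) / (2 * pi))"
    and "continuous_on UNIV g"
proof -
  let ?f = "\<lambda>n t. a n * (of_real r * cis t) ^ n"
  have nf: "cmod (?f n t) = cmod (a n) * r ^ n" for n t
    using r by (simp add: norm_mult norm_power)
  show contg: "continuous_on UNIV g"
  proof (rule uniform_limit_theorem)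
    show "uniform_limit UNIV (\<lambda>n t. \<Sum>i<n. ?f i t) g sequentially"
      unfolding g_def by (rule Weierstrass_m_test[OF _ conv]) (simp add: nf)
  qed (auto intro!: continuous_intros always_eventually)
  obtain B where B: "\<And>t. t \<in> {0..2 * pi} \<Longrightarrow> cmod (g t) \<le> B"
    using compact_imp_bounded[OF compact_continuous_image[OF continuous_on_subset[OF contg subset_UNIV] compact_Icc]]
    unfolding bounded_iff by (metis imageI)
  have coeff: "(LINT t|circ. g t * cis (- (real n * t))) = 2 * pi * (a n * of_real r ^ n)" for n
  proof -
    have "(\<lambda>k. LINT t|circ. ?f k t * cis (- (real n * t)))
        sums (LINT t|circ. (\<Sum>k. ?f k t * cis (- (real n * t))))"
      by (rule LINT_circ_suminf[OF _ _ conv]) (auto intro!: continuous_intros simp: norm_mult norm_power r)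
    also have "(\<lambda>t. \<Sum>k. ?f k t * cis (- (real n * t))) = (\<lambda>t. g t * cis (- (real n * t)))"
    proof
      fix t
      have "summable (\<lambda>k. ?f k t)"
        by (rule summable_norm_cancel) (simp add: nf conv del: norm_mult)
      then show "(\<Sum>k. ?f k t * cis (- (real n * t))) = g t * cis (- (real n * t))"
        unfolding g_def by (rule suminf_mult2[symmetric])
    qed
    also have "(\<lambda>k. LINT t|circ. ?f k t * cis (- (real n * t)))
        = (\<lambda>k. if k = n then 2 * pi * (a n * of_real r ^ n) else 0)"
    proof
      fix k
      have "?f k t * cis (- (real n * t)) = a k * of_real r ^ k * cis (of_int (int k - int n) * t)"
          for t
      proof -
        have "cis t ^ k * cis (- (real n * t)) = cis (real k * t + - (real n * t))"
          by (simp only: Complex.DeMoivre cis_mult)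
        also have "real k * t + - (real n * t) = of_int (int k - int n) * t"
          by (simp add: algebra_simps)
        finally show ?thesis by (simp only: power_mult_distrib mult.assoc)
      qed
      then have "(LINT t|circ. ?f k t * cis (- (real n * t)))
          = a k * of_real r ^ k * (LINT t|circ. cis (of_int (int k - int n) * t))"
        by (simp only:) simp
      then show "(LINT t|circ. ?f k t * cis (- (real n * t)))
          = (if k = n then 2 * pi * (a n * of_real r ^ n) else 0)"
        unfolding LINT_circ_cis by auto
    qed
    finally show ?thesis
      using sums_single[of n "\<lambda>_. 2 * pi * (a n * of_real r ^ n)"] sums_unique2
          by (metis (no_types, lifting))
  qed
  have "(\<lambda>n. LINT t|circ. cnj (?f n t) * g t) sums (LINT t|circ. (\<Sum>n. cnj (?f n t) * g t))"
  proof (rule LINT_circ_suminf)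
    show "summable (\<lambda>n. cmod (a n) * r ^ n * B)" using conv by (rule summable_mult2)
    show "cmod (cnj (?f n t) * g t) \<le> cmod (a n) * r ^ n * B" if "t \<in> {0..2 * pi}" for n t
      unfolding norm_mult[of "cnj _"] complex_mod_cnj nf
      using B[OF that] r by (intro mult_left_mono) auto
    show "continuous_on {0..2 * pi} (\<lambda>t. cnj (?f n t) * g t)" for n
      by (intro continuous_intros continuous_on_subset[OF contg]) auto
  qed
  also have "(\<lambda>t. \<Sum>n. cnj (?f n t) * g t) = (\<lambda>t. complex_of_real ((cmod (g t))\<^sup>2))"
  proof
    fix t
    have "summable (\<lambda>k. ?f k t)"
      by (rule summable_norm_cancel) (simp add: nf conv del: norm_mult)
    then have "(\<lambda>k. ?f k t) sums g t" unfolding g_def by (rule summable_sums)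
    then have "(\<lambda>k. cnj (?f k t) * g t) sums (cnj (g t) * g t)"
      by (intro sums_mult2) (simp only: sums_cnj)
    then show "(\<Sum>n. cnj (?f n t) * g t) = complex_of_real ((cmod (g t))\<^sup>2)"
      by (metis sums_unique complex_norm_square mult.commute of_real_power)
  qed
  also have "(\<lambda>n. LINT t|circ. cnj (?f n t) * g t)
      = (\<lambda>n. complex_of_real (2 * pi * ((cmod (a n))\<^sup>2 * r ^ (2 * n))))"
  proof
    fix n
    have "cnj (?f n t) * g t = cnj (a n * of_real r ^ n) * (g t * cis (- (real n * t)))" for t
      by (simp add: power_mult_distrib Complex.DeMoivre cis_cnj)
    then have "(LINT t|circ. cnj (?f n t) * g t)
        = cnj (a n * of_real r ^ n) * (2 * pi * (a n * of_real r ^ n))"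
      by (simp only: coeff[symmetric]) simp
    also have "\<dots> = 2 * pi * ((a n * cnj (a n)) * (of_real r ^ n * of_real r ^ n))"
      by (simp add: mult_ac)
    also have "\<dots> = complex_of_real (2 * pi * ((cmod (a n))\<^sup>2 * r ^ (2 * n)))"
      by (simp only: complex_norm_square[symmetric] power_add[symmetric] mult_2) simp
    finally show "(LINT t|circ. cnj (?f n t) * g t)
        = complex_of_real (2 * pi * ((cmod (a n))\<^sup>2 * r ^ (2 * n)))" .
  qed
  finally have "(\<lambda>n. 2 * pi * ((cmod (a n))\<^sup>2 * r ^ (2 * n))) sums (LINT t|circ. (cmod (g t))\<^sup>2)"
    unfolding integral_complex_of_real sums_of_real_iff .
  from sums_divide[OF this, of "2 * pi"]
  show "(\<lambda>n. (cmod (a n))\<^sup>2 * r ^ (2 * n)) sums ((LINT t|circ. (cmod (g t))\<^sup>2) / (2 * pi))"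
    by simp
qed

text \<open>Parseval on the circles of radius \<open>r\<close> turns a lower bound of a factor near the unit circle
  into a lower bound for the coefficients of a product.\<close>

lemma coeff_norm_mult_ge:
  fixes u y :: "nat \<Rightarrow> complex" and k :: "complex \<Rightarrow> complex"
  assumes y: "\<And>z. cmod z < 1 \<Longrightarrow> (\<lambda>n. y n * z ^ n) sums (k z * (\<Sum>i<N. u i * z ^ i))"
    and k: "\<And>z. d < cmod z \<Longrightarrow> cmod z < 1 \<Longrightarrow> m * cmod z \<le> cmod (k z)" and d: "d < 1" and m: "0 \<le> m"
    and B: "\<And>n. (\<Sum>i<n. (cmod (y i))\<^sup>2) \<le> B"
  shows "m\<^sup>2 * (\<Sum>i<N. (cmod (u i))\<^sup>2) \<le> B"
proof -
  have main: "(m * r)\<^sup>2 * (\<Sum>i<N. (cmod (u i))\<^sup>2 * r ^ (2 * i)) \<le> B" if r: "max d 0 < r" "r < 1" for r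
  proof -
    define u' where "u' i = (if i < N then u i else 0)" for i
    let ?z = "\<lambda>t. complex_of_real r * cis t"
    have nz: "cmod (?z t) = r" for t using r by (simp add: norm_mult)
    define s where "s = (r + 1) / 2"
    have s: "r < s" "s < 1" using r by (auto simp: s_def)
    have "summable (\<lambda>n. y n * of_real s ^ n)"
      using sums_summable[OF y[of "of_real s"]] s r by simp
    then have "summable (\<lambda>n. cmod (y n * of_real r ^ n))"
      by (rule powser_insidea) (use r s in auto)
    then have sy: "summable (\<lambda>n. cmod (y n) * r ^ n)"
      using r by (simp add: norm_mult norm_power)
    have su: "summable (\<lambda>n. cmod (u' n) * r ^ n)"
      by (rule summable_finite[of "{..<N}"]) (auto simp: u'_def)
    have gu: "(\<Sum>n. u' n * ?z t ^ n) = (\<Sum>i<N. u i * ?z t ^ i)" for t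
      by (subst suminf_finite[of "{..<N}"]) (auto simp: u'_def)
    have gy: "(\<Sum>n. y n * ?z t ^ n) = k (?z t) * (\<Sum>n. u' n * ?z t ^ n)" for t
      unfolding gu using sums_unique[OF y[of "?z t"]] nz r by simp
    note Py = Parseval_circle[OF sy] and Pu = Parseval_circle[OF su]
    have r0: "0 \<le> r" using r by simp
    have le: "(m * r)\<^sup>2 * (cmod (\<Sum>n. u' n * ?z t ^ n))\<^sup>2 \<le> (cmod (\<Sum>n. y n * ?z t ^ n))\<^sup>2" for t
      unfolding gy norm_mult power_mult_distrib[of "cmod (k _)"]
      using k[of "?z t"] nz[of t] r m by (intro mult_right_mono power_mono) auto
    have "(\<lambda>n. (m * r)\<^sup>2 * ((cmod (u' n))\<^sup>2 * r ^ (2 * n))) sums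
        ((m * r)\<^sup>2 * ((LINT t|circ. (cmod (\<Sum>n. u' n * ?z t ^ n))\<^sup>2) / (2 * pi)))"
      by (intro sums_mult Pu(1) r0)
    moreover have "(\<lambda>n. (m * r)\<^sup>2 * ((cmod (u' n))\<^sup>2 * r ^ (2 * n))) sums
        (\<Sum>n<N. (m * r)\<^sup>2 * ((cmod (u' n))\<^sup>2 * r ^ (2 * n)))"
      by (rule sums_finite) (auto simp: u'_def)
    ultimately have "(\<Sum>n<N. (m * r)\<^sup>2 * ((cmod (u' n))\<^sup>2 * r ^ (2 * n)))
        = (m * r)\<^sup>2 * ((LINT t|circ. (cmod (\<Sum>n. u' n * ?z t ^ n))\<^sup>2) / (2 * pi))"
      by (rule sums_unique2[symmetric])
    also have "\<dots> = (LINT t|circ. (m * r)\<^sup>2 * (cmod (\<Sum>n. u' n * ?z t ^ n))\<^sup>2) / (2 * pi)"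
      by simp
    also have "\<dots> \<le> (LINT t|circ. (cmod (\<Sum>n. y n * ?z t ^ n))\<^sup>2) / (2 * pi)"
      by (intro divide_right_mono integral_mono integrable_circ_cont le continuous_intros
          continuous_on_subset[OF Py(2)[OF r0]] continuous_on_subset[OF Pu(2)[OF r0]]) auto
    also have "\<dots> \<le> B"
    proof (rule LIMSEQ_le_const2[OF Py(1)[OF r0, unfolded sums_def]], intro exI allI impI)
      fix n
      have "(\<Sum>i<n. (cmod (y i))\<^sup>2 * r ^ (2 * i)) \<le> (\<Sum>i<n. (cmod (y i))\<^sup>2)"
        using r by (intro sum_mono mult_right_le_one_le power_le_one) auto
      then show "(\<Sum>i<n. (cmod (y i))\<^sup>2 * r ^ (2 * i)) \<le> B" using B[of n] by linarith
    qed
    finally show ?thesis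
      by (simp add: sum_distrib_left u'_def)
  qed
  have "((\<lambda>r. (m * r)\<^sup>2 * (\<Sum>i<N. (cmod (u i))\<^sup>2 * r ^ (2 * i))) \<longlongrightarrow>
      (m * 1)\<^sup>2 * (\<Sum>i<N. (cmod (u i))\<^sup>2 * 1 ^ (2 * i))) (at_left 1)"
    by (intro tendsto_intros)
  moreover have "\<forall>\<^sub>F r in at_left (1::real). r \<in> {max d 0<..<1}"
    by (rule eventually_at_left_real) (use d in auto)
  then have "\<forall>\<^sub>F r in at_left 1. (m * r)\<^sup>2 * (\<Sum>i<N. (cmod (u i))\<^sup>2 * r ^ (2 * i)) \<le> B"
    by (rule eventually_mono) (auto intro!: main)
  ultimately have "(m * 1)\<^sup>2 * (\<Sum>i<N. (cmod (u i))\<^sup>2 * 1 ^ (2 * i)) \<le> B"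
    by (rule tendsto_upperbound) simp
  then show ?thesis by simp
qed

section \<open>The cluster set of the symbol is the support\<close>

locale Toeplitz_setting = Hessenberg_setting +
  fixes T :: "ell2 \<Rightarrow> ell2"
  assumes Toeplitz_limit: "unif_asymp_Toeplitz_limit D T"
begin

lemma clinear_T: "bounded_clinear T"
  using Toeplitz_limit by (simp add: unif_asymp_Toeplitz_limit_def)

lemma compression_D_tendsto: "(\<lambda>n. onorm (\<lambda>x. ell2_compression n D x - T x)) \<longlonglongrightarrow> 0"
  using Toeplitz_limit
  by (simp add: unif_asymp_Toeplitz_limit_def ell2_compression_def adjoint_ell2_shift)

lemma entry_D_tendsto: "(\<lambda>n. ell2_entry D (i + n) (j + n)) \<longlonglongrightarrow> ell2_entry T i j"
proof -
  have "cmod (ell2_entry D (i + n) (j + n) - ell2_entry T i j)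
      \<le> onorm (\<lambda>x. ell2_compression n D x - T x)" for n
    using bounded_clinear_entry_le[OF bounded_clinear_minus[OF bounded_clinear_compression[OF clinear_D] clinear_T], of n i j]
    by (simp add: ell2_entry_minus ell2_entry_compression)
  then have "(\<lambda>n. ell2_entry D (i + n) (j + n) - ell2_entry T i j) \<longlonglongrightarrow> 0"
    by (intro Lim_null_comparison[OF _ compression_D_tendsto]) auto
  then show ?thesis by (rule LIM_zero_cancel)
qed

definition tcoeff :: "nat \<Rightarrow> complex" where
  "tcoeff n = (if n = 0 then ell2_entry T 1 0 else ell2_entry T 0 (n - 1))"

lemma entry_T_Suc: "ell2_entry T (Suc i) (Suc j) = ell2_entry T i j"
proof -
  have "(\<lambda>n. ell2_entry D (i + Suc n) (j + Suc n)) \<longlonglongrightarrow> ell2_entry T i j"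
    using entry_D_tendsto[of i j] by (rule LIMSEQ_Suc)
  moreover have "(\<lambda>n. ell2_entry D (i + Suc n) (j + Suc n)) \<longlonglongrightarrow> ell2_entry T (Suc i) (Suc j)"
    using entry_D_tendsto[of "Suc i" "Suc j"] by simp
  ultimately show ?thesis using LIMSEQ_unique by blast
qed

lemma entry_T: "ell2_entry T i j = (if i \<le> j + 1 then tcoeff (j + 1 - i) else 0)"
proof -
  have shift: "ell2_entry T (i + n) (j + n) = ell2_entry T i j" for i j n
    by (induction n) (simp_all add: entry_T_Suc)
  consider "i \<le> j" | "i = j + 1" | "i > j + 1" by linarith
  then show ?thesis
  proof cases
    case 1
    then show ?thesis using shift[of 0 i "j - i"] by (simp add: tcoeff_def)
  next
    case 2
    then show ?thesis using shift[of 1 j 0] by (simp add: tcoeff_def)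
  next
    case 3
    have "(\<lambda>n. ell2_entry D (i + n) (j + n)) = (\<lambda>n. 0)"
      using 3 entry_D_eq_0 by auto
    then have "ell2_entry T i j = 0" using entry_D_tendsto[of i j] LIMSEQ_unique tendsto_const by metis
    then show ?thesis using 3 by simp
  qed
qed

lemma compression_T: "ell2_compression n T = T"
  by (rule bounded_clinear_eqI) (auto simp: clinear_T bounded_clinear_compression ell2_entry_compression entry_T)

lemma tail_null: "tail_null_operator (\<lambda>x. D x - T x)"
proof
  show "bounded_clinear (\<lambda>x. D x - T x)"
    by (rule bounded_clinear_minus[OF clinear_D clinear_T])
  have "ell2_compression n (\<lambda>x. D x - T x) = (\<lambda>x. ell2_compression n D x - T x)" for n
    using compression_T[of n] bounded_clinear_linear(3)[OF bounded_clinear_backward_shift_pow]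
    unfolding ell2_compression_def[abs_def] by metis
  then show "(\<lambda>n. onorm (ell2_compression n (\<lambda>x. D x - T x))) \<longlonglongrightarrow> 0"
    using compression_D_tendsto by simp
qed

lemma tcoeff_bound: "cmod (tcoeff n) \<le> onorm T"
  using bounded_clinear_entry_le[OF clinear_T] by (simp add: tcoeff_def)

lemma tcoeff_0: "tcoeff 0 \<in> \<real>" "0 \<le> Re (tcoeff 0)"
proof -
  have lim: "(\<lambda>n. ell2_entry D (Suc n) n) \<longlonglongrightarrow> tcoeff 0"
    using entry_D_tendsto[of 1 0] by (simp add: tcoeff_def)
  have D: "ell2_entry D (Suc n) n \<in> \<real> \<and> 0 \<le> Re (ell2_entry D (Suc n) n)" for n
    using entry_D_subdiag[of n] by auto
  show "tcoeff 0 \<in> \<real>"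
    by (rule closed_sequentially[OF closed_complex_Reals _ lim]) (use D in auto)
  show "0 \<le> Re (tcoeff 0)"
    by (rule LIMSEQ_le_const[OF tendsto_Re[OF lim]]) (use D in auto)
qed

lemma tcoeff_summable:
  assumes "cmod z < 1"
  shows "summable (\<lambda>n. cmod (tcoeff n * z ^ n))" "summable (\<lambda>n. tcoeff n * z ^ n)"
proof -
  show "summable (\<lambda>n. cmod (tcoeff n * z ^ n))"
  proof (rule summable_comparison_test')
    show "summable (\<lambda>n. onorm T * cmod z ^ n)"
      using assms by (intro summable_mult summable_geometric) simp
    show "norm (cmod (tcoeff n * z ^ n)) \<le> onorm T * cmod z ^ n" for n
      using mult_right_mono[OF tcoeff_bound, of "cmod z ^ n"] by (simp add: norm_mult norm_power)
  qed
  then show "summable (\<lambda>n. tcoeff n * z ^ n)" by (rule summable_norm_cancel)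
qed

text \<open>\<open>tser z / z\<close> is the symbol, read as a function of the inverse variable.\<close>

definition tser :: "complex \<Rightarrow> complex" where
  "tser z = (\<Sum>n. tcoeff n * z ^ n)"

lemma tser_sums: "cmod z < 1 \<Longrightarrow> (\<lambda>n. tcoeff n * z ^ n) sums tser z"
  unfolding tser_def by (intro summable_sums tcoeff_summable)

lemma tser_holomorphic: "tser holomorphic_on ball 0 1"
  by (rule power_series_holomorphic[where a = tcoeff]) (use tser_sums in auto)

lemma tser_0: "tser 0 = tcoeff 0"
  unfolding tser_def by (rule powser_zero)

lemma symbol_near_support:
  assumes e: "e > 0"
  obtains \<rho> where "\<rho> < 1" "\<And>s. \<rho> < cmod s \<Longrightarrow> cmod s < 1 \<Longrightarrow> infdist (tser s / s) \<Gamma> \<le> e"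
proof -
  interpret K: tail_null_operator "\<lambda>x. D x - T x" by (rule tail_null)
  obtain M C where C: "C \<ge> 0" "\<And>x. norm (D x - T x) \<le> e / 2 * norm x + C * norm (ell2_proj M x)"
    by (rule K.apply_le_proj[OF half_gt_zero[OF e]]) (rule that)
  define b where "b = C * sqrt (real M) + 2 * cmod (tcoeff 0)"
  have "((\<lambda>r. b * sqrt (1 - r\<^sup>2)) \<longlongrightarrow> b * sqrt (1 - 1\<^sup>2)) (at_left 1)"
    by (intro tendsto_intros)
  then have "\<forall>\<^sub>F r in at_left 1. b * sqrt (1 - r\<^sup>2) < e / 2"
    by (rule order_tendstoD) (use e in auto)
  then obtain d0 where d0: "d0 < 1" "\<And>r. d0 < r \<Longrightarrow> r < 1 \<Longrightarrow> b * sqrt (1 - r\<^sup>2) < e / 2"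
    by (auto simp: eventually_at_left_field)
  show ?thesis
  proof (rule that[of "max d0 (1 / 2)"])
    show "max d0 (1 / 2) < 1" using d0 by simp
    fix s :: complex assume s: "max d0 (1 / 2) < cmod s" "cmod s < 1"
    then have s0: "s \<noteq> 0" by auto
    let ?E = "tser s / s"
    have geo: "(\<lambda>n. (cmod (s ^ n))\<^sup>2) sums (1 / (1 - (cmod s)\<^sup>2))"
    proof -
      have "(\<lambda>n. ((cmod s)\<^sup>2) ^ n) sums (1 / (1 - (cmod s)\<^sup>2))"
        using s by (intro geometric_sums) (simp add: power_less_one_iff abs_square_less_1)
      then show ?thesis by (simp add: norm_power power_mult[symmetric] mult.commute)
    qed
    define v where "v = Abs_ell2 (\<lambda>n. s ^ n)"
    have v: "ell2_nth v n = s ^ n" for n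
      using sums_summable[OF geo] by (simp add: v_def Abs_ell2_inverse)
    have nv: "(norm v)\<^sup>2 = 1 / (1 - (cmod s)\<^sup>2)"
      using ell2_norm_sq_sums[of v] geo by (simp add: v sums_iff)
    have s1: "0 < 1 - (cmod s)\<^sup>2" using s by (simp add: power_less_one_iff abs_square_less_1)
    have nv': "norm v = 1 / sqrt (1 - (cmod s)\<^sup>2)"
      using nv s1 by (metis norm_ge_zero real_sqrt_divide real_sqrt_one real_sqrt_unique)
    have nvpos: "norm v > 0" using s1 by (simp add: nv')
    have Tv: "ell2_nth (T v) i = ?E * s ^ i - (if i = 0 then tcoeff 0 / s else 0)" for i
    proof -
      have ser: "(\<lambda>n. tcoeff n * s ^ n) sums tser s" by (rule tser_sums) (use s in auto)
      have "(\<lambda>j. ell2_entry T i j * s ^ j) sums (?E * s ^ i - (if i = 0 then tcoeff 0 / s else 0))"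
      proof (cases i)
        case 0
        have "(\<lambda>n. tcoeff (Suc n) * s ^ Suc n) sums (tser s - tcoeff 0 * s ^ 0)"
          using sums_split_initial_segment[OF ser, of 1] by simp
        then have "(\<lambda>n. tcoeff (Suc n) * s ^ Suc n / s) sums ((tser s - tcoeff 0 * s ^ 0) / s)"
          by (rule sums_divide)
        then show ?thesis using 0 s0 by (simp add: entry_T diff_divide_distrib)
      next
        case (Suc k)
        have "(\<lambda>n. tcoeff n * s ^ n * s ^ k) sums (tser s * s ^ k)"
          by (rule sums_mult2[OF ser])
        then have "(\<lambda>j. ell2_entry T i (j + k) * s ^ (j + k)) sums (tser s * s ^ k)"
          by (simp add: entry_T Suc power_add mult_ac)
        then have "(\<lambda>j. ell2_entry T i j * s ^ j) sums (tser s * s ^ k)"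
          by (subst (asm) sums_iff_shift) (simp add: entry_T Suc)
        then show ?thesis using Suc s0 by simp
      qed
      then show ?thesis
        using bounded_clinear_nth_sums[OF clinear_T, of i v] sums_unique2 unfolding v by blast
    qed
    have "T v - ell2_scaleC ?E v = ell2_fin 1 (\<lambda>_. - (tcoeff 0 / s))"
      by (rule ell2_eqI) (simp add: ell2_nth_minus ell2_nth_scaleC Tv v ell2_nth_fin)
    then have "(norm (T v - ell2_scaleC ?E v))\<^sup>2 = (cmod (tcoeff 0) / cmod s)\<^sup>2"
      by (simp add: ell2_norm_fin norm_divide)
    then have "norm (T v - ell2_scaleC ?E v) = cmod (tcoeff 0) / cmod s"
      by (rule power2_eq_imp_eq) auto
    also have "\<dots> \<le> cmod (tcoeff 0) / (1 / 2)" using s by (intro divide_left_mono) auto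
    finally have Tle: "norm (T v - ell2_scaleC ?E v) \<le> 2 * cmod (tcoeff 0)" by simp
    have "(norm (ell2_proj M v))\<^sup>2 \<le> (\<Sum>n<M. 1)"
      unfolding ell2_norm_fin v using s by (intro sum_mono) (simp add: norm_power power_le_one)
    then have Mle: "norm (ell2_proj M v) \<le> sqrt (real M)" by (intro real_le_rsqrt) simp
    have "infdist ?E \<Gamma> * norm v \<le> norm (D v - ell2_scaleC ?E v)" by (rule norm_shifted_ge)
    also have "D v - ell2_scaleC ?E v = (D v - T v) + (T v - ell2_scaleC ?E v)" by simp
    also have "norm \<dots> \<le> norm (D v - T v) + norm (T v - ell2_scaleC ?E v)" by (rule norm_triangle_ineq)
    also have "\<dots> \<le> (e / 2 * norm v + C * sqrt (real M)) + 2 * cmod (tcoeff 0)"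
      using C(2)[of v] mult_left_mono[OF Mle C(1)] Tle by linarith
    also have "\<dots> = e / 2 * norm v + b" by (simp add: b_def)
    finally have "infdist ?E \<Gamma> \<le> (e / 2 * norm v + b) / norm v"
      using nvpos by (simp add: pos_le_divide_eq)
    also have "\<dots> = e / 2 + b * sqrt (1 - (cmod s)\<^sup>2)"
    proof -
      have "(e / 2 * norm v + b) / norm v = e / 2 + b / norm v"
        using nvpos by (simp add: add_divide_distrib)
      also have "b / norm v = b * sqrt (1 - (cmod s)\<^sup>2)" by (simp add: nv')
      finally show ?thesis .
    qed
    also have "\<dots> \<le> e" using d0(2)[of "cmod s"] s by simp
    finally show "infdist ?E \<Gamma> \<le> e" .
  qed
qed

lemma ex_near_symbol:
  assumes conn: "connected (- \<Gamma>)" and int: "interior \<Gamma> = {}"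
    and unc: "\<And>l e. l \<in> \<Gamma> \<Longrightarrow> e > 0 \<Longrightarrow> uncountable (\<Gamma> \<inter> ball l e)"
    and l: "l \<in> \<Gamma>" and e: "e > 0" and \<rho>: "\<rho> < 1"
  shows "\<exists>s. \<rho> < cmod s \<and> cmod s < 1 \<and> cmod (tser s / s - l) < e"
proof (rule ccontr)
  assume "\<not> ?thesis"
  then have far: "e \<le> cmod (tser s / s - l)" if "\<rho> < cmod s" "cmod s < 1" for s
    using that by force
  interpret K: tail_null_operator "\<lambda>x. D x - T x" by (rule tail_null)
  have "\<not> \<Gamma> \<inter> ball l (e / 2) \<subseteq> {x. measure \<mu> {x} \<noteq> 0}"
    using unc[OF l, of "e / 2"] e countable_subset[OF _ countable_support] by auto
  then obtain l' where l': "l' \<in> \<Gamma>" "dist l l' < e / 2" "measure \<mu> {l'} = 0" by auto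
  define m where "m = e / 2"
  have m: "m > 0" using e by (simp add: m_def)
  have far': "m * cmod s \<le> cmod (tser s - l' * s)" if s: "max \<rho> 0 < cmod s" "cmod s < 1" for s
  proof -
    have "s \<noteq> 0" using s by auto
    have "cmod (tser s / s - l) \<le> cmod (tser s / s - l') + cmod (l' - l)"
      using norm_triangle_ineq[of "tser s / s - l'" "l' - l"] by simp
    then have "m \<le> cmod (tser s / s - l')"
      using far[of s] s l'(2) by (simp add: m_def dist_norm norm_minus_commute)
    then have "m * cmod s \<le> cmod (tser s / s - l') * cmod s" by (intro mult_right_mono) auto
    also have "\<dots> = cmod (tser s - l' * s)"
      using \<open>s \<noteq> 0\<close> by (simp flip: norm_mult add: algebra_simps)
    finally show ?thesis .
  qed
  have m8: "m / 8 > 0" using m by simp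
  obtain M C where C: "C \<ge> 0" "\<And>u v n. (\<Sum>i<n. cmod (ell2_nth u i * ell2_nth (D v - T v) i))
     \<le> (m / 8 * norm u + C * norm (ell2_proj M u)) * norm v"
    by (rule K.pairing_le_proj[OF m8]) (rule that)
  define X where "X = 1 + C * real M + cmod (tcoeff 0)"
  define h where "h = (m / 8) / X"
  have X: "X > 0" unfolding X_def using C(1) by (intro add_pos_nonneg) auto
  have h: "h > 0" using m X by (simp add: h_def)
  have "h * X = m / 8" using X by (simp add: h_def)
  then have hsum: "h + h * (C * real M) + h * cmod (tcoeff 0) = m / 8"
    by (simp add: X_def algebra_simps)
  have hle: "h \<le> m / 8" "h * (C * real M) \<le> m / 8" "h * cmod (tcoeff 0) \<le> m / 8"
    using hsum h C(1) mult_nonneg_nonneg[of h "C * real M"] mult_nonneg_nonneg[of h "cmod (tcoeff 0)"]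
      mult_nonneg_nonneg[OF C(1), of "real M"] by auto
  obtain q where q: "poly_norm q > 0" "poly_norm ([:- l', 1:] * q) \<le> h * poly_norm q"
    "\<And>j. j < Suc M \<Longrightarrow> cmod (poly_inner \<mu> q (P j)) \<le> h * poly_norm q"
    using singular_poly[OF conn int l'(1,3) h, of "Suc M"] by blast
  obtain N where N: "degree q < N" "M < N"
    by (rule that[of "Suc (degree q + M)"]) auto
  obtain x where x: "q = comb N x" using ex_comb[OF N(1)] by blast
  define u where "u i = cnj (x i)" for i
  let ?n = "poly_norm q"
  have n_sq: "(\<Sum>i<N. (cmod (u i))\<^sup>2) = ?n\<^sup>2" by (simp add: u_def x poly_norm_comb)
  have u_small: "cmod (u j) \<le> h * ?n" if "j < Suc M" for j
    using q(3)[OF that] that inner_comb_P[of j N x] N(2) by (simp add: u_def flip: x)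
  define c' where "c' n = (if n = 1 then tcoeff 1 - l' else tcoeff n)" for n :: nat
  define y where "y n = (\<Sum>i<N. if i \<le> n then c' (n - i) * u i else 0)" for n
  have y_sums: "(\<lambda>n. y n * z ^ n) sums ((tser z - l' * z) * (\<Sum>i<N. u i * z ^ i))" if z: "cmod z < 1"
      for z
  proof -
    have "(\<lambda>n. tcoeff n * z ^ n - (if n = 1 then l' * z ^ n else 0)) sums (tser z - l' * z ^ 1)"
      by (intro sums_diff tser_sums z sums_single)
    also have "(\<lambda>n. tcoeff n * z ^ n - (if n = 1 then l' * z ^ n else 0)) = (\<lambda>n. c' n * z ^ n)"
      by (auto simp: c'_def algebra_simps)
    finally have c': "(\<lambda>n. c' n * z ^ n) sums (tser z - l' * z)" by simp
    have "(\<lambda>n. if i \<le> n then c' (n - i) * u i * z ^ n else 0) sums ((tser z - l' * z) * (u i * z ^ i))"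
        for i
    proof -
      have "(\<lambda>n. c' n * z ^ n * (u i * z ^ i)) sums ((tser z - l' * z) * (u i * z ^ i))"
        by (rule sums_mult2[OF c'])
      then have "(\<lambda>n. (\<lambda>n. if i \<le> n then c' (n - i) * u i * z ^ n else 0) (n + i))
          sums ((tser z - l' * z) * (u i * z ^ i))"
        by (simp add: power_add mult_ac)
      then show ?thesis by (subst (asm) sums_iff_shift) simp
    qed
    then have "(\<lambda>n. \<Sum>i<N. if i \<le> n then c' (n - i) * u i * z ^ n else 0) sums
        (\<Sum>i<N. (tser z - l' * z) * (u i * z ^ i))"
      by (rule sums_sum)
    then show ?thesis
      by (simp add: y_def sum_distrib_left sum_distrib_right if_distrib[of "\<lambda>u. u * _"] cong: if_cong)
  qed
  define t where "t j = (\<Sum>i<N. (ell2_entry T i j - (if i = j then l' else 0)) * u i)" for j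
  have y_Suc: "y (Suc j) = t j" for j
    unfolding y_def t_def by (intro sum.cong) (auto simp: entry_T c'_def)
  have y_0: "y 0 = tcoeff 0 * u 0"
  proof -
    have "y 0 = (\<Sum>i<N. if i = 0 then tcoeff 0 * u 0 else 0)"
      unfolding y_def by (intro sum.cong) (auto simp: c'_def)
    then show ?thesis using N(2) by simp
  qed
  have t_bound: "(\<Sum>j<k. (cmod (t j))\<^sup>2) \<le> (m / 2 * ?n)\<^sup>2" for k
  proof -
    define v where "v = ell2_fin k (\<lambda>j. cnj (t j))"
    have nv: "(norm v)\<^sup>2 = (\<Sum>j<k. (cmod (t j))\<^sup>2)" by (simp add: v_def ell2_norm_fin)
    have Tv: "ell2_nth (T v - ell2_scaleC l' v) i = (\<Sum>j<k. (ell2_entry T i j - (if i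
        = j then l' else 0)) * cnj (t j))" for i
    proof -
      have "(\<Sum>j<k. (if i = j then l' else 0) * cnj (t j)) = (if i < k then l' * cnj (t i) else 0)"
        by (simp add: if_distrib[of "\<lambda>u. u * _"] cong: if_cong)
      then show ?thesis
        by (simp add: ell2_nth_minus ell2_nth_scaleC v_def ell2_nth_fin bounded_clinear_nth_fin[OF clinear_T]
            left_diff_distrib sum_subtractf)
    qed
    have "complex_of_real ((norm v)\<^sup>2) = (\<Sum>j<k. t j * cnj (t j))"
      by (simp add: nv complex_norm_square[symmetric])
    also have "\<dots> = (\<Sum>j<k. \<Sum>i<N. (ell2_entry T i j - (if i = j then l' else 0)) * u i * cnj (t j))"
      by (subst t_def) (simp add: sum_distrib_right)
    also have "\<dots> = (\<Sum>i<N. u i * ell2_nth (T v - ell2_scaleC l' v) i)"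
      unfolding Tv sum_distrib_left by (subst sum.swap) (simp add: mult_ac)
    also have "\<dots> = (\<Sum>i<N. ell2_nth (D v - ell2_scaleC l' v) i * u i) - (\<Sum>i<N. u i * ell2_nth (D v - T v) i)"
      unfolding sum_subtractf[symmetric] by (intro sum.cong) (auto simp: ell2_nth_minus algebra_simps)
    finally have eq: "complex_of_real ((norm v)\<^sup>2)
        = (\<Sum>i<N. ell2_nth (D v - ell2_scaleC l' v) i * u i) - (\<Sum>i<N. u i * ell2_nth (D v - T v) i)" .
    have X: "cmod (\<Sum>i<N. ell2_nth (D v - ell2_scaleC l' v) i * u i) \<le> norm v * (h * ?n)"
    proof -
      define M' where "M' = max N (Suc k)"
      define x0 where "x0 j = (if j < N then x j else 0)" for j
      have q': "q = comb M' x0" unfolding x x0_def by (rule comb_extend) (simp add: M'_def)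
      have "(\<Sum>i<N. ell2_nth (D v - ell2_scaleC l' v) i * u i)
          = (\<Sum>i<M'. ell2_nth (D v - ell2_scaleC l' v) i * cnj (x0 i))"
        by (intro sum.mono_neutral_cong_left) (auto simp: M'_def x0_def u_def)
      also have "\<dots> = poly_inner \<mu> ([:- l', 1:] * comb k (\<lambda>j. cnj (t j))) q"
        unfolding q' by (rule pairing_eq_inner[OF v_def]) (simp add: M'_def)
      also have "cmod \<dots> \<le> poly_norm (comb k (\<lambda>j. cnj (t j))) * poly_norm ([:- l', 1:] * q)"
        by (rule poly_norm_mult_inner_le)
      also have "poly_norm (comb k (\<lambda>j. cnj (t j))) = norm v"
        by (rule power2_eq_imp_eq) (simp_all add: nv poly_norm_comb poly_norm_nonneg)
      also have "norm v * poly_norm ([:- l', 1:] * q) \<le> norm v * (h * ?n)"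
        by (intro mult_left_mono q(2)) auto
      finally show ?thesis .
    qed
    have Y: "cmod (\<Sum>i<N. u i * ell2_nth (D v - T v) i) \<le> (m / 8 * ?n
        + C * (real M * (h * ?n))) * norm v"
    proof -
      define U where "U = ell2_fin N u"
      have nU: "norm U = ?n"
        by (rule power2_eq_imp_eq) (simp_all add: U_def ell2_norm_fin n_sq poly_norm_nonneg)
      have "norm (ell2_proj M U) \<le> (\<Sum>i<M. cmod (ell2_nth U i))" by (rule ell2_norm_proj_le_sum)
      also have "\<dots> \<le> (\<Sum>i<M. h * ?n)"
        using u_small N(2) by (intro sum_mono) (auto simp: U_def ell2_nth_fin)
      finally have pU: "norm (ell2_proj M U) \<le> real M * (h * ?n)" by simp
      have "cmod (\<Sum>i<N. u i * ell2_nth (D v - T v) i)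
          \<le> (\<Sum>i<N. cmod (ell2_nth U i * ell2_nth (D v - T v) i))"
        by (rule order_trans[OF norm_sum]) (auto intro!: sum_mono simp: U_def ell2_nth_fin)
      also have "\<dots> \<le> (m / 8 * norm U + C * norm (ell2_proj M U)) * norm v" by (rule C(2))
      also have "\<dots> \<le> (m / 8 * ?n + C * (real M * (h * ?n))) * norm v"
        unfolding nU by (intro mult_right_mono add_left_mono mult_left_mono pU C(1)) auto
      finally show ?thesis .
    qed
    have "norm v * norm v = cmod (complex_of_real ((norm v)\<^sup>2))"
      by (simp add: power2_eq_square norm_mult)
    also have "\<dots> \<le> norm v * (h * ?n) + (m / 8 * ?n + C * (real M * (h * ?n))) * norm v"
      unfolding eq by (rule order_trans[OF norm_triangle_ineq4 add_mono[OF X Y]])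
    finally have "norm v * norm v \<le> norm v * (h * ?n) + (m / 8 * ?n
        + C * (real M * (h * ?n))) * norm v" .
    then have "norm v * norm v \<le> norm v * ((h + m / 8 + h * (C * real M)) * ?n)"
      by (simp add: algebra_simps)
    then have "norm v \<le> (h + m / 8 + h * (C * real M)) * ?n \<or> norm v = 0"
      by (auto simp: mult_le_cancel_left)
    moreover have "(h + m / 8 + h * (C * real M)) * ?n \<le> m / 2 * ?n"
      using hle m q(1) by (intro mult_right_mono) auto
    moreover have "0 \<le> m / 2 * ?n" using m q(1) by simp
    ultimately have "norm v \<le> m / 2 * ?n" by linarith
    then show ?thesis unfolding nv[symmetric] by (intro power_mono) auto
  qed
  have y_bound: "(\<Sum>i<k. (cmod (y i))\<^sup>2) \<le> (m / 2 * ?n)\<^sup>2 + (m / 2 * ?n)\<^sup>2" for k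
  proof (cases k)
    case (Suc k')
    have "(\<Sum>i<k. (cmod (y i))\<^sup>2) = (cmod (y 0))\<^sup>2 + (\<Sum>j<k'. (cmod (t j))\<^sup>2)"
      unfolding Suc by (subst sum.lessThan_Suc_shift) (simp add: y_Suc)
    also have "cmod (y 0) \<le> m / 2 * ?n"
    proof -
      have "cmod (y 0) \<le> cmod (tcoeff 0) * (h * ?n)"
        unfolding y_0 norm_mult using u_small[of 0] by (intro mult_left_mono) auto
      also have "\<dots> = (h * cmod (tcoeff 0)) * ?n" by simp
      also have "\<dots> \<le> m / 2 * ?n" using hle(3) m q(1) by (intro mult_right_mono) auto
      finally show ?thesis .
    qed
    then have "(cmod (y 0))\<^sup>2 \<le> (m / 2 * ?n)\<^sup>2" by (intro power_mono) auto
    finally show ?thesis using t_bound[of k'] by linarith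
  qed simp
  have "m\<^sup>2 * (\<Sum>i<N. (cmod (u i))\<^sup>2) \<le> (m / 2 * ?n)\<^sup>2 + (m / 2 * ?n)\<^sup>2"
    by (rule coeff_norm_mult_ge[where d = "max \<rho> 0", OF y_sums far' _ _ y_bound]) (use \<rho> m in auto)
  then have "(m * ?n)\<^sup>2 \<le> (m * ?n)\<^sup>2 / 2"
    unfolding n_sq by (simp add: power_mult_distrib power_divide)
  moreover have "(m * ?n)\<^sup>2 > 0" using m q(1) by simp
  ultimately show False by linarith
qed

end

section \<open>The symbol as a conformal map\<close>

lemma zero_count_perturb:
  fixes f g :: "complex \<Rightarrow> complex"
  assumes f: "f holomorphic_on ball 0 1" and g: "g holomorphic_on ball 0 1"
    and r: "0 < r" "r < 1"
    and zf: "\<And>z. r \<le> cmod z \<Longrightarrow> cmod z < 1 \<Longrightarrow> f z \<noteq> 0"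
    and zfg: "\<And>z. r \<le> cmod z \<Longrightarrow> cmod z < 1 \<Longrightarrow> f z + g z \<noteq> 0"
    and less: "\<And>z. cmod z = r \<Longrightarrow> cmod (g z) < cmod (f z)"
  shows "(\<Sum>p\<in>{p \<in> ball 0 1. f p + g p = 0}. zorder (\<lambda>p. f p + g p) p)
    = (\<Sum>p\<in>{p \<in> ball 0 1. f p = 0}. zorder f p)"
proof -
  have fin: "finite {p \<in> ball 0 1. h p = 0}"
    if h: "h holomorphic_on ball 0 1" "\<And>z. r \<le> cmod z \<Longrightarrow> cmod z < 1 \<Longrightarrow> h z \<noteq> 0"
        for h :: "complex \<Rightarrow> complex"
  proof (cases "h constant_on ball 0 1")
    case True
    then obtain c where c: "\<And>z. z \<in> ball 0 1 \<Longrightarrow> h z = c" unfolding constant_on_def by auto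
    have "c \<noteq> 0" using h(2)[of "of_real r"] c[of "of_real r"] r by auto
    then have "{p \<in> ball 0 1. h p = 0} = {}" using c by auto
    then show ?thesis by (simp only: finite.emptyI)
  next
    case False
    have "finite {p \<in> cball 0 r. h p = 0}"
      by (rule holomorphic_compact_finite_zeros[OF h(1) _ _ _ _ False]) (use r in auto)
    moreover have "{p \<in> ball 0 1. h p = 0} \<subseteq> {p \<in> cball 0 r. h p = 0}"
      using h(2) by (force simp: not_le)
    ultimately show ?thesis by (rule finite_subset[rotated])
  qed
  let ?\<gamma> = "circlepath 0 r"
  have wind: "winding_number ?\<gamma> p = 1" if "p \<in> ball 0 1" "h p = 0" "\<And>z. r \<le> cmod z \<Longrightarrow> cmod z < 1
      \<Longrightarrow> h z \<noteq> 0" for p and h :: "complex \<Rightarrow> complex"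
  proof -
    have "cmod p < r" using that by (force simp: not_le)
    then show ?thesis by (intro winding_number_circlepath) simp
  qed
  have "(\<Sum>p\<in>{p \<in> ball 0 1. f p + g p = 0}. winding_number ?\<gamma> p * of_int (zorder (\<lambda>p. f p + g p) p))
      = (\<Sum>p\<in>{p \<in> ball 0 1. f p = 0}. winding_number ?\<gamma> p * of_int (zorder f p))"
  proof (rule Rouche_theorem)
    show "finite {p \<in> ball 0 1. f p + g p = 0}"
      using fin[of "\<lambda>z. f z + g z"] zfg by (auto intro!: holomorphic_intros f g)
    show "finite {p \<in> ball 0 1. f p = 0}" using fin[OF f] zf by auto
    show "\<forall>z\<in>path_image ?\<gamma>. cmod (g z) < cmod (f z)"
      using less r by auto
    show "path_image ?\<gamma> \<subseteq> ball 0 1" using r by auto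
    show "\<forall>z. z \<notin> ball 0 1 \<longrightarrow> winding_number ?\<gamma> z = 0"
    proof (intro allI impI)
      fix z :: complex assume "z \<notin> ball 0 1"
      then show "winding_number ?\<gamma> z = 0"
        using r by (intro winding_number_zero_outside[of _ "cball 0 r"]) auto
    qed
  qed (auto intro: f g)
  also have "(\<Sum>p\<in>{p \<in> ball 0 1. f p + g p = 0}. winding_number ?\<gamma> p * of_int (zorder (\<lambda>p. f p + g p) p))
      = (\<Sum>p\<in>{p \<in> ball 0 1. f p + g p = 0}. of_int (zorder (\<lambda>p. f p + g p) p))"
    by (intro sum.cong refl) (use wind[of _ "\<lambda>z. f z + g z"] zfg in auto)
  also have "(\<Sum>p\<in>{p \<in> ball 0 1. f p = 0}. winding_number ?\<gamma> p * of_int (zorder f p))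
      = (\<Sum>p\<in>{p \<in> ball 0 1. f p = 0}. of_int (zorder f p))"
    by (intro sum.cong refl) (use wind[of _ f] zf in auto)
  finally have "complex_of_int (\<Sum>p\<in>{p \<in> ball 0 1. f p + g p = 0}. zorder (\<lambda>p. f p + g p) p)
    = complex_of_int (\<Sum>p\<in>{p \<in> ball 0 1. f p = 0}. zorder f p)" by simp
  then show ?thesis by (simp only: of_int_eq_iff)
qed

abbreviation punctured_disc :: "complex set" where "punctured_disc \<equiv> ball 0 1 - {0}"

lemma infdist_diff_le: "infdist w S - infdist x S \<le> dist w x"
  using infdist_triangle[of w S x] by simp

locale boundary_cluster =
  fixes \<Gamma> :: "complex set" and k :: "complex \<Rightarrow> complex"
  assumes cmp: "compact \<Gamma>" and inf: "infinite \<Gamma>" and conn: "connected (- \<Gamma>)" and int: "interior \<Gamma> = {}"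
    and holo: "k holomorphic_on ball 0 1"
    and near: "\<And>e. e > 0 \<Longrightarrow> \<exists>d<1. \<forall>s. d < cmod s \<and> cmod s < 1 \<longrightarrow> infdist (k s / s) \<Gamma> \<le> e"
    and dense: "\<And>l e d. l \<in> \<Gamma> \<Longrightarrow> e > 0 \<Longrightarrow> d < 1 \<Longrightarrow>
      \<exists>s. d < cmod s \<and> cmod s < 1 \<and> cmod (k s / s - l) < e"
begin

lemma ne: "\<Gamma> \<noteq> {}" using inf by auto

lemma nearE:
  assumes "e > 0"
  obtains d where "1 / 2 \<le> d" "d < 1" "\<And>s. d \<le> cmod s \<Longrightarrow> cmod s < 1 \<Longrightarrow> infdist (k s / s) \<Gamma> \<le> e"
proof -
  obtain d where d: "d < 1" "\<forall>s. d < cmod s \<and> cmod s < 1 \<longrightarrow> infdist (k s / s) \<Gamma> \<le> e"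
    using near[OF assms] by blast
  show ?thesis
    by (rule that[of "max (1 / 2) ((d + 1) / 2)"]) (use d in auto)
qed

definition zeros :: "complex \<Rightarrow> complex set" where
  "zeros w = {p \<in> ball 0 1. k p + - w * p = 0}"

definition zcount :: "complex \<Rightarrow> int" where
  "zcount w = (\<Sum>p\<in>zeros w. zorder (\<lambda>p. k p + - w * p) p)"

lemma cmod_shift: "s \<noteq> 0 \<Longrightarrow> cmod (k s + - w * s) = cmod s * dist w (k s / s)"
proof -
  assume s: "s \<noteq> 0"
  then have "k s + - w * s = - (s * (w - k s / s))" by (simp add: algebra_simps)
  then show ?thesis by (simp only: norm_minus_cancel norm_mult dist_norm)
qed

lemma zcount_local: "w0 \<notin> \<Gamma> \<Longrightarrow> \<exists>e>0. \<forall>w\<in>ball w0 e. zcount w = zcount w0"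
proof -
  assume w0: "w0 \<notin> \<Gamma>"
  define e where "e = infdist w0 \<Gamma> / 3"
  have e: "e > 0" using infdist_pos_not_in_closed[OF compact_imp_closed[OF cmp] ne w0]
      by (simp add: e_def)
  obtain d where d: "1 / 2 \<le> d" "d < 1" "\<And>s. d \<le> cmod s \<Longrightarrow> cmod s < 1 \<Longrightarrow> infdist (k s / s) \<Gamma> \<le> e"
    using nearE[OF e] by blast
  have far0: "2 * e \<le> dist w0 (k s / s)" if "d \<le> cmod s" "cmod s < 1" for s
    using infdist_diff_le[of w0 \<Gamma> "k s / s"] d(3)[OF that] by (simp add: e_def)
  have "zcount w = zcount w0" if w: "w \<in> ball w0 e" for w
  proof -
    have far: "0 < dist w (k s / s)" if "d \<le> cmod s" "cmod s < 1" for s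
    proof -
      have "dist w0 w < e" using w by simp
      then show ?thesis using far0[OF that] e dist_triangle[of w0 "k s / s" w] by linarith
    qed
    have nz: "s \<noteq> 0" if "d \<le> cmod s" for s using that d(1) by auto
    have eq: "(\<lambda>p. (k p + - w0 * p) + (w0 - w) * p) = (\<lambda>p. k p + - w * p)" by (auto simp: algebra_simps)
    have "(\<Sum>p\<in>{p \<in> ball 0 1. (k p + - w0 * p) + (w0 - w) * p = 0}. zorder (\<lambda>p. (k p + - w0 * p)
        + (w0 - w) * p) p)
        = (\<Sum>p\<in>{p \<in> ball 0 1. k p + - w0 * p = 0}. zorder (\<lambda>p. k p + - w0 * p) p)"
    proof (rule zero_count_perturb[where r = d])
      fix z :: complex assume z: "d \<le> cmod z" "cmod z < 1"
      have "0 < cmod (k z + - w0 * z)"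
        unfolding cmod_shift[OF nz[OF z(1)]] using far0[OF z] e nz[OF z(1)] by (intro mult_pos_pos) auto
      then show "k z + - w0 * z \<noteq> 0" by auto
      have "0 < cmod (k z + - w * z)"
        unfolding cmod_shift[OF nz[OF z(1)]] using far[OF z] nz[OF z(1)] by (intro mult_pos_pos) auto
      then show "k z + - w0 * z + (w0 - w) * z \<noteq> 0" by (auto simp: algebra_simps)
    next
      fix z :: complex assume z: "cmod z = d"
      have "cmod ((w0 - w) * z) = d * dist w0 w" by (simp add: norm_mult dist_norm z)
      also have "\<dots> < d * (2 * e)" using w d(1) e by (intro mult_strict_left_mono) auto
      also have "\<dots> \<le> d * dist w0 (k z / z)" using far0[of z] z d by (intro mult_left_mono) auto
      also have "\<dots> = cmod (k z + - w0 * z)" using cmod_shift[OF nz[of z]] z by simp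
      finally show "cmod ((w0 - w) * z) < cmod (k z + - w0 * z)" .
    qed (use d in \<open>auto intro!: holomorphic_intros holo\<close>)
    then show ?thesis unfolding zcount_def zeros_def eq[THEN fun_cong] eq .
  qed
  then show ?thesis using e by blast
qed

lemma zcount_large: "\<exists>w. w \<notin> \<Gamma> \<and> zcount w = 1"
proof -
  obtain R where R: "R > 0" "\<And>z. z \<in> \<Gamma> \<Longrightarrow> cmod z \<le> R"
    using compact_imp_bounded[OF cmp] unfolding bounded_pos by auto
  define w where "w = complex_of_real (R + 4)"
  have nw: "cmod w = R + 4" using R(1) by (simp only: w_def norm_of_real)
  have wG: "w \<notin> \<Gamma>" using R(2)[of w] nw by auto
  obtain d where d: "1 / 2 \<le> d" "d < 1" "\<And>s. d \<le> cmod s \<Longrightarrow> cmod s < 1 \<Longrightarrow> infdist (k s / s) \<Gamma> \<le> 1"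
    using nearE[of 1] by auto
  have kE: "cmod (k s / s) \<le> R + 1" if "d \<le> cmod s" "cmod s < 1" for s
  proof -
    obtain x where x: "x \<in> \<Gamma>" "infdist (k s / s) \<Gamma> = dist (k s / s) x"
      using infdist_attains_inf[OF compact_imp_closed[OF cmp] ne] by blast
    have "cmod (k s / s) \<le> cmod x + dist (k s / s) x"
      using norm_triangle_ineq[of x "k s / s - x"] by (simp add: dist_norm)
    then show ?thesis using x d(3)[OF that] R(2)[OF x(1)] by simp
  qed
  have nz: "s \<noteq> 0" if "d \<le> cmod s" for s using that d(1) by auto
  have less: "cmod (k z) < cmod (- w * z)" if z: "d \<le> cmod z" "cmod z < 1" for z
  proof -
    have "cmod (k z) = cmod (k z / z) * cmod z" using nz[OF z(1)] by (simp add: norm_divide)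
    also have "\<dots> \<le> (R + 1) * cmod z" using kE[OF z] by (intro mult_right_mono) auto
    also have "\<dots> < (R + 4) * cmod z" using nz[OF z(1)] by (intro mult_strict_right_mono) auto
    finally show ?thesis by (simp add: norm_mult nw)
  qed
  have "(\<Sum>p\<in>{p \<in> ball 0 1. - w * p + k p = 0}. zorder (\<lambda>p. - w * p + k p) p)
      = (\<Sum>p\<in>{p \<in> ball 0 1. - w * p = 0}. zorder (\<lambda>p. - w * p) p)"
  proof (rule zero_count_perturb[where r = d])
    fix z :: complex assume z: "d \<le> cmod z" "cmod z < 1"
    show "- w * z \<noteq> 0" using less[OF z] by auto
    show "- w * z + k z \<noteq> 0" using less[OF z] by (metis add_eq_0_iff less_irrefl norm_minus_cancel)
  qed (use d less in \<open>auto intro!: holomorphic_intros holo\<close>)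
  also have "{p \<in> ball 0 1. - w * p = 0} = {0}"
    using nw R(1) by auto
  also have "(\<Sum>p\<in>{0}. zorder (\<lambda>p. - w * p) p) = zorder (\<lambda>p. - w * p) 0" by simp
  also have "\<dots> = 1"
    by (rule zorder_eqI[of UNIV 0 "\<lambda>_. - w"]) (use nw R(1) in auto)
  finally have "zcount w = 1"
    unfolding zcount_def zeros_def by (simp add: add.commute)
  then show ?thesis using wG by blast
qed

lemma zcount_eq_1: "w \<notin> \<Gamma> \<Longrightarrow> zcount w = 1"
proof -
  assume w: "w \<notin> \<Gamma>"
  obtain w1 where w1: "w1 \<notin> \<Gamma>" "zcount w1 = 1" using zcount_large by blast
  have "zcount w = zcount w1"
  proof (rule connected_local_const[OF conn])
    show "\<forall>a\<in>- \<Gamma>. \<forall>\<^sub>F b in at a within - \<Gamma>. zcount a = zcount b"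
      using zcount_local unfolding eventually_at by (metis Compl_iff dist_commute mem_ball)
  qed (use w w1 in auto)
  then show ?thesis using w1 by simp
qed

lemma ex1_zero:
  assumes w: "w \<notin> \<Gamma>"
  shows "\<exists>!s. s \<in> ball 0 1 \<and> k s = w * s"
proof -
  let ?f = "\<lambda>p. k p + - w * p"
  have z: "zeros w = {s \<in> ball 0 1. k s = w * s}" by (auto simp: zeros_def)
  have fin: "finite (zeros w)"
    using zcount_eq_1[OF w] unfolding zcount_def by (metis sum.infinite zero_neq_one)
  have "\<exists>s\<in>ball 0 1. ?f s \<noteq> 0"
  proof (rule ccontr)
    assume "\<not> ?thesis"
    then have "zeros w = ball 0 1" by (auto simp: zeros_def)
    then have "finite (ball 0 1 :: complex set)" using fin by simp
    then have "interior (ball 0 1 :: complex set) = {}" by (rule empty_interior_finite)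
    then show False by (simp add: interior_open)
  qed
  moreover have "?f holomorphic_on ball 0 1" by (intro holomorphic_intros holo)
  ultimately have pos: "zorder ?f p \<ge> 1" if "p \<in> zeros w" for p
    using zorder_exist_zero[of ?f "ball 0 1" p] that by (auto simp: zeros_def split: if_splits)
  have "int (card (zeros w)) \<le> zcount w"
    unfolding zcount_def using sum_mono[of "zeros w" "\<lambda>_. 1" "zorder ?f", OF pos] by simp
  then have "card (zeros w) \<le> 1" using zcount_eq_1[OF w] by simp
  moreover have "zeros w \<noteq> {}" using zcount_eq_1[OF w] by (auto simp: zcount_def)
  ultimately have "card (zeros w) = 1" using fin by (metis card_0_eq le_less less_one)
  then obtain s where "zeros w = {s}" by (auto simp: card_1_singleton_iff)
  then show ?thesis unfolding z by (intro ex1I[of _ s]) auto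
qed

lemma quot_holo: "(\<lambda>s. k s / s) holomorphic_on punctured_disc"
  by (intro holomorphic_intros holomorphic_on_subset[OF holo]) auto

lemma punctured_props: "open punctured_disc" "connected punctured_disc"
  by (auto intro!: connected_punctured_ball)

lemma open_quot_image:
  assumes "\<not> (\<lambda>s. k s / s) constant_on punctured_disc" "open U" "U \<subseteq> punctured_disc"
  shows "open ((\<lambda>s. k s / s) ` U)"
  by (rule open_mapping_thm[OF quot_holo punctured_props assms(2,3,1)])

lemma not_constant: "\<not> (\<lambda>s. k s / s) constant_on punctured_disc"
proof
  assume "(\<lambda>s. k s / s) constant_on punctured_disc"
  then obtain c where c: "\<And>s. s \<in> punctured_disc \<Longrightarrow> k s / s = c" unfolding constant_on_def by auto
  have "\<Gamma> \<subseteq> {c}"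
  proof
    fix l assume l: "l \<in> \<Gamma>"
    have "cmod (c - l) \<le> 0"
    proof (rule field_le_epsilon)
      fix e :: real assume "e > 0"
      then obtain s where s: "0 < cmod s" "cmod s < 1" "cmod (k s / s - l) < e"
        using dense[OF l, of e 0] by auto
      then show "cmod (c - l) \<le> 0 + e" using c[of s] by simp
    qed
    then show "l \<in> {c}" by simp
  qed
  then show False using inf finite_subset by auto
qed

lemma k0_ne_0: "k 0 \<noteq> 0"
proof
  assume k0: "k 0 = 0"
  have im: "k s / s \<in> \<Gamma>" if s: "s \<in> punctured_disc" for s
  proof (rule ccontr)
    assume "k s / s \<notin> \<Gamma>"
    then show False using ex1_zero[of "k s / s"] s k0
      by (metis Diff_iff centre_in_ball mult_zero_right nonzero_divide_eq_eq singletonI zero_less_one)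
  qed
  then have "(\<lambda>s. k s / s) ` punctured_disc \<subseteq> interior \<Gamma>"
    by (intro interior_maximal open_quot_image not_constant punctured_props subset_refl) (use im in blast)
  moreover have "1 / 2 \<in> punctured_disc" by auto
  ultimately show False using int by blast
qed

lemma quot_notin:
  assumes s0: "s0 \<in> punctured_disc"
  shows "k s0 / s0 \<notin> \<Gamma>"
proof
  let ?E = "\<lambda>s. k s / s"
  assume l: "?E s0 \<in> \<Gamma>"
  define r where "r = min (cmod s0) (1 - cmod s0) / 2"
  have r: "r > 0" "r < cmod s0" "cmod s0 + r < 1" using s0 by (auto simp: r_def min_def field_simps)
  have Vb: "cmod z < cmod s0 + r" "z \<noteq> 0" if "z \<in> ball s0 r" for z
  proof -
    have "cmod z \<le> cmod s0 + dist s0 z"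
      using norm_triangle_ineq[of s0 "z - s0"] by (simp add: dist_norm norm_minus_commute)
    then show "cmod z < cmod s0 + r" using that by simp
    show "z \<noteq> 0" using that r by (auto simp: dist_norm)
  qed
  have V: "ball s0 r \<subseteq> punctured_disc" using Vb r(3) by force
  have "open (?E ` ball s0 r)" by (rule open_quot_image[OF not_constant _ V]) simp
  moreover have "?E s0 \<in> ?E ` ball s0 r" using r by auto
  ultimately obtain h where h: "h > 0" "ball (?E s0) h \<subseteq> ?E ` ball s0 r"
    by (meson openE)
  obtain s1 where s1: "cmod s0 + r < cmod s1" "cmod s1 < 1" "cmod (?E s1 - ?E s0) < h"
    using dense[OF l h(1) r(3)] by blast
  define W where "W = {s \<in> punctured_disc. cmod s0 + r < cmod s \<and> ?E s \<in> ball (?E s0) h}"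
  have "W = punctured_disc \<inter> {s. cmod s0 + r < cmod s} \<inter> (punctured_disc \<inter> ?E -` ball (?E s0) h)"
    by (auto simp: W_def)
  moreover have "open (punctured_disc \<inter> ?E -` ball (?E s0) h)"
    by (rule continuous_open_preimage[OF holomorphic_on_imp_continuous_on[OF quot_holo]]) auto
  moreover have "open {s :: complex. cmod s0 + r < cmod s}"
    by (intro open_Collect_less continuous_intros)
  ultimately have W: "open W" by (simp add: open_Int punctured_props)
  have "s1 \<in> W" using s1 r by (auto simp: W_def dist_norm norm_minus_commute)
  have "open (?E ` W)"
    by (rule open_quot_image[OF not_constant W]) (auto simp: W_def)
  then have "\<not> ?E ` W \<subseteq> \<Gamma>"
    using int \<open>s1 \<in> W\<close> interior_maximal by blast
  then obtain a where a: "a \<in> W" "?E a \<notin> \<Gamma>" by auto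
  then obtain b where b: "b \<in> ball s0 r" "?E b = ?E a" using h(2) by (auto simp: W_def)
  have "a \<noteq> b" using a(1) Vb(1)[OF b(1)] by (auto simp: W_def)
  moreover have "a \<in> ball 0 1 \<and> k a = ?E a * a" using a(1) by (auto simp: W_def)
  moreover have "b \<in> ball 0 1 \<and> k b = ?E a * b"
    unfolding b(2)[symmetric] using V b(1) Vb(2)[OF b(1)] by auto
  ultimately show False using ex1_zero[OF a(2)] by blast
qed

lemma bij_quot: "bij_betw (\<lambda>s. k s / s) punctured_disc (- \<Gamma>)"
  unfolding bij_betw_def
proof (intro conjI equalityI subsetI)
  show "inj_on (\<lambda>s. k s / s) punctured_disc"
  proof (rule inj_onI)
    fix a b assume ab: "a \<in> punctured_disc" "b \<in> punctured_disc" "k a / a = k b / b"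
    have "k a = k a / a * a" using ab(1) by simp
    moreover have "k b = k a / a * b" unfolding ab(3) using ab(2) by simp
    ultimately show "a = b" using ex1_zero[OF quot_notin[OF ab(1)]] ab(1,2) by (metis Diff_iff)
  qed
  fix w assume w: "w \<in> - \<Gamma>"
  then obtain s where s: "s \<in> ball 0 1" "k s = w * s" using ex1_zero[of w] by auto
  then have "s \<noteq> 0" using k0_ne_0 by auto
  then show "w \<in> (\<lambda>s. k s / s) ` punctured_disc"
    using s by (intro image_eqI[of _ _ s]) auto
qed (use quot_notin in auto)

end

lemma pole_bij_transition:
  assumes k1: "k1 holomorphic_on ball 0 1" "k1 0 \<noteq> 0" "bij_betw (\<lambda>s. k1 s / s) punctured_disc V"
    and k2: "k2 holomorphic_on ball 0 1" "k2 0 \<noteq> 0" "bij_betw (\<lambda>s. k2 s / s) punctured_disc V"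
  obtains m where "m holomorphic_on ball 0 1" "m 0 = 0"
    "\<And>s. s \<in> punctured_disc \<Longrightarrow> m s \<in> punctured_disc \<and> k2 (m s) / m s = k1 s / s"
proof -
  let ?E1 = "\<lambda>s. k1 s / s" and ?E2 = "\<lambda>s. k2 s / s"
  have o: "open punctured_disc" by auto
  have h1: "?E1 holomorphic_on punctured_disc" and h2: "?E2 holomorphic_on punctured_disc"
    by (auto intro!: holomorphic_intros holomorphic_on_subset[OF k1(1)] holomorphic_on_subset[OF k2(1)])
  have inj2: "inj_on ?E2 punctured_disc" and im2: "?E2 ` punctured_disc
      = V" and im1: "?E1 ` punctured_disc = V"
    using k1(3) k2(3) by (auto simp: bij_betw_def)
  obtain g where g: "g holomorphic_on (?E2 ` punctured_disc)" "\<And>z. z \<in> punctured_disc \<Longrightarrow> g (?E2 z) = z"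
    using holomorphic_has_inverse[OF h2 o inj2] by metis
  define m where "m s = (if s = 0 then 0 else g (?E1 s))" for s
  have m: "m s \<in> punctured_disc \<and> ?E2 (m s) = ?E1 s" if s: "s \<in> punctured_disc" for s
  proof -
    have "?E1 s \<in> ?E2 ` punctured_disc" using im1 im2 s by blast
    then obtain z where z: "z \<in> punctured_disc" "?E1 s = ?E2 z" by blast
    have "m s = z" using s g(2)[OF z(1)] z(2) by (simp add: m_def)
    then show ?thesis using z by simp
  qed
  have hm: "m holomorphic_on punctured_disc"
  proof -
    have "(g \<circ> ?E1) holomorphic_on punctured_disc"
      by (rule holomorphic_on_compose[OF h1]) (use g(1) im1 im2 in simp)
    then show ?thesis by (rule holomorphic_transform) (auto simp: m_def)
  qed
  have lim: "(m \<longlongrightarrow> 0) (at 0)"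
    unfolding Lim_at
  proof (intro allI impI)
    fix e :: real assume e: "e > 0"
    have c2: "isCont k2 0"
      using holomorphic_on_imp_continuous_on[OF k2(1)] by (simp add: continuous_on_eq_continuous_at)
    obtain d2 where d2: "d2 > 0" "\<And>s. dist 0 s < d2 \<Longrightarrow> k2 s \<noteq> 0"
      using continuous_at_avoid[OF c2 k2(2)] by blast
    define r where "r = Min {e, d2, 1}"
    have r: "r > 0" "r \<le> e" "r \<le> d2" "r \<le> 1" using e d2(1) by (auto simp: r_def)
    define G where "G s = s / k2 s" for s
    have hG: "G holomorphic_on ball 0 r"
      unfolding G_def using d2(2) r by (intro holomorphic_intros holomorphic_on_subset[OF k2(1)]) auto
    have nc: "\<not> G constant_on ball 0 r"
    proof
      assume "G constant_on ball 0 r"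
      then obtain c where c: "\<And>s. s \<in> ball 0 r \<Longrightarrow> G s = c" unfolding constant_on_def by auto
      have "G 0 = G (of_real (r / 2))" using c[of 0] c[of "of_real (r / 2)"] r by simp
      then show False using d2(2)[of "of_real (r / 2)"] r by (simp add: G_def)
    qed
    have "open (G ` ball 0 r)" by (rule open_mapping_thm[OF hG _ _ _ _ nc]) auto
    moreover have "0 \<in> G ` ball 0 r" using r by (intro image_eqI[of _ _ 0]) (auto simp: G_def)
    ultimately obtain h where h: "h > 0" "ball 0 h \<subseteq> G ` ball 0 r" by (meson openE)
    have c1: "isCont k1 0"
      using holomorphic_on_imp_continuous_on[OF k1(1)] by (simp add: continuous_on_eq_continuous_at)
    obtain d1 where d1: "d1 > 0" "\<And>s. dist 0 s < d1 \<Longrightarrow> k1 s \<noteq> 0"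
      using continuous_at_avoid[OF c1 k1(2)] by blast
    have "isCont (\<lambda>s. s / k1 s) 0" using k1(2) c1 by (intro continuous_intros)
    then have "((\<lambda>s. s / k1 s) \<longlongrightarrow> 0) (at 0)" by (simp add: isCont_def)
    then obtain d where d: "d > 0" "\<And>s. s \<noteq> 0 \<Longrightarrow> dist s 0 < d \<Longrightarrow> dist (s / k1 s) 0 < h"
      unfolding Lim_at using h(1) by (metis zero_less_dist_iff)
    show "\<exists>d>0. \<forall>x. 0 < dist x 0 \<and> dist x 0 < d \<longrightarrow> dist (m x) 0 < e"
    proof (intro exI conjI allI impI)
      show "0 < min (min d d1) 1" using d(1) d1(1) by simp
      fix s :: complex assume s: "0 < dist s 0 \<and> dist s 0 < min (min d d1) 1"
      then have sP: "s \<in> punctured_disc" by auto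
      have "s / k1 s \<in> G ` ball 0 r" using d(2)[of s] s h(2) by auto
      then obtain z where z: "z \<in> ball 0 r" "s / k1 s = z / k2 z" by (auto simp: G_def)
      have E: "?E2 (m s) = ?E1 s" "m s \<in> punctured_disc" using m[OF sP] by auto
      show "dist (m s) 0 < e"
      proof (cases "z = 0")
        case True
        then show ?thesis using z(2) d1(2)[of s] s by simp
      next
        case False
        then have zP: "z \<in> punctured_disc" using z(1) r by auto
        have "?E1 s = ?E2 z" using z(2) by (metis inverse_divide)
        then have "m s = z" using inj_onD[OF inj2] E zP by metis
        then show ?thesis using z(1) r by simp
      qed
    qed
  qed
  show ?thesis
  proof (rule that[of m])
    show "m holomorphic_on ball 0 1"
    proof (rule no_isolated_singularity'[of "{0}"])
      fix z :: complex assume "z \<in> {0}"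
      then have "z = 0" "m z = 0" by (simp_all add: m_def)
      then show "(m \<longlongrightarrow> m z) (at z within ball 0 1)"
        using tendsto_within_subset[OF lim subset_UNIV] by metis
    qed (use hm in auto)
  next
    show "m 0 = 0" by (simp add: m_def)
  next
    fix s assume "s \<in> punctured_disc"
    then show "m s \<in> punctured_disc \<and> k2 (m s) / m s = k1 s / s" by (rule m)
  qed
qed

lemma pole_bij_unique:
  assumes k1: "k1 holomorphic_on ball 0 1" "bij_betw (\<lambda>s. k1 s / s) punctured_disc V"
    and k2: "k2 holomorphic_on ball 0 1" "bij_betw (\<lambda>s. k2 s / s) punctured_disc V"
    and c: "k1 0 = of_real c1" "c1 > 0" "k2 0 = of_real c2" "c2 > 0"
    and s: "s \<in> punctured_disc"
  shows "k1 s = k2 s"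
proof -
  have ne: "k1 0 \<noteq> 0" "k2 0 \<noteq> 0" using c by auto
  obtain m where m: "m holomorphic_on ball 0 1" "m 0 = 0"
    "\<And>s. s \<in> punctured_disc \<Longrightarrow> m s \<in> punctured_disc \<and> k2 (m s) / m s = k1 s / s"
    using pole_bij_transition[OF k1(1) ne(1) k1(2) k2(1) ne(2) k2(2)] by blast
  obtain n where n: "n holomorphic_on ball 0 1" "n 0 = 0"
    "\<And>s. s \<in> punctured_disc \<Longrightarrow> n s \<in> punctured_disc \<and> k1 (n s) / n s = k2 s / s"
    using pole_bij_transition[OF k2(1) ne(2) k2(2) k1(1) ne(1) k1(2)] by blast
  have b: "cmod (m z) < 1" "cmod (n z) < 1" if "cmod z < 1" for z
    using m(2) m(3)[of z] n(2) n(3)[of z] that by (cases "z = 0"; simp)+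
  have nm: "n (m s) = s"
    using m(3)[OF s] n(3)[of "m s"] s inj_onD[OF bij_betw_imp_inj_on[OF k1(2)], of "n (m s)" s] by auto
  have s1: "cmod s < 1" "s \<noteq> 0" using s by auto
  have "cmod (m s) \<le> cmod s" by (rule Schwarz_Lemma(1)[OF m(1,2) b(1) s1(1)])
  moreover have "cmod (n (m s)) \<le> cmod (m s)"
    by (rule Schwarz_Lemma(1)[OF n(1,2) b(2)]) (use b(1) s1 in auto)
  ultimately have "cmod (m s) = cmod s" using nm by simp
  then obtain a where a: "\<And>z. cmod z < 1 \<Longrightarrow> m z = a * z" "cmod a = 1"
    using Schwarz_Lemma(3)[OF m(1,2) b(1) s1(1)] s1 by blast
  have a0: "a \<noteq> 0" using a(2) by auto
  have k12: "k2 (a * z) = a * k1 z" if "z \<in> punctured_disc" for z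
    using m(3)[OF that] a(1)[of z] that a0 by (auto simp: field_simps)
  have c1: "isCont k1 0" and c2: "isCont k2 0"
    using holomorphic_on_imp_continuous_on[OF k1(1)] holomorphic_on_imp_continuous_on[OF k2(1)]
    by (simp_all add: continuous_on_eq_continuous_at)
  have "((\<lambda>z. a * k1 z) \<longlongrightarrow> a * k1 0) (at 0)"
    using c1 by (intro tendsto_intros) (simp add: isCont_def)
  moreover have "((\<lambda>z. a * z) \<longlongrightarrow> 0) (at 0)"
    by (auto intro!: tendsto_eq_intros)
  then have "((\<lambda>z. k2 (a * z)) \<longlongrightarrow> k2 0) (at 0)"
    by (rule isCont_tendsto_compose[OF c2])
  moreover have "\<forall>\<^sub>F z in at 0. k2 (a * z) = a * k1 z"
    unfolding eventually_at using k12 by (intro exI[of _ 1]) auto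
  ultimately have "a * k1 0 = k2 0"
    using tendsto_cong[of "\<lambda>z. k2 (a * z)" "\<lambda>z. a * k1 z" "at 0"] tendsto_unique[of "at (0::complex)"]
        by auto
  then have "a * of_real c1 = of_real c2" using c by simp
  then have av: "a = of_real (c2 / c1)" using c(2) by (simp add: field_simps)
  then have "c2 / c1 = 1" using a(2) c(2,4) by (simp only: norm_of_real) simp
  then have "a = 1" using av by simp
  then show ?thesis using k12[OF s] by simp
qed

lemma Riemann_mapping_inverted:
  assumes "Riemann_mapping \<Gamma> \<phi>"
  obtains k c where "k holomorphic_on ball 0 1" "k 0 = of_real c" "c > 0"
    "\<And>s. s \<in> punctured_disc \<Longrightarrow> \<phi> (1 / s) = k s / s"
    "bij_betw (\<lambda>s. k s / s) punctured_disc (- \<Gamma>)"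
proof -
  obtain c1 :: real and c :: "nat \<Rightarrow> complex" where c1: "c1 > 0"
    and c: "\<And>z. 1 < cmod z \<Longrightarrow> (\<lambda>k. c k / z ^ k) sums (\<phi> z - of_real c1 * z)"
    and bij: "bij_betw \<phi> {z. 1 < cmod z} (- \<Gamma>)"
    using assms unfolding Riemann_mapping_def by blast
  have sums: "(\<lambda>n. c n * s ^ n) sums (\<phi> (1 / s) - of_real c1 / s)" if "s \<in> punctured_disc" for s
    using c[of "1 / s"] that by (simp add: norm_divide power_divide)
  define S where "S s = (\<Sum>n. c n * s ^ n)" for s
  have S: "(\<lambda>n. c n * s ^ n) sums S s" if "cmod s < 1" for s
  proof -
    have "summable (\<lambda>n. c n * s ^ n)"
    proof (cases "s = 0")
      case True
      then show ?thesis using powser_sums_zero[of c] by (simp add: sums_summable)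
    next
      case False
      then show ?thesis using sums[of s] that by (auto intro: sums_summable)
    qed
    then show ?thesis unfolding S_def by (rule summable_sums)
  qed
  have hS: "S holomorphic_on ball 0 1"
    by (rule power_series_holomorphic[where a = c]) (use S in auto)
  define k where "k s = of_real c1 + s * S s" for s
  have eq: "\<phi> (1 / s) = k s / s" if s: "s \<in> punctured_disc" for s
  proof -
    have "S s = \<phi> (1 / s) - of_real c1 / s" using sums[OF s] S[of s] s sums_unique2 by auto
    then show ?thesis using s by (simp add: k_def field_simps)
  qed
  show ?thesis
  proof (rule that[of k c1])
    have "bij_betw (\<lambda>s. 1 / s) punctured_disc {z :: complex. 1 < cmod z}"
      by (rule bij_betw_byWitness[where f' = "\<lambda>z. 1 / z"]) (auto simp: norm_divide divide_less_eq_1)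
    then have "bij_betw (\<phi> \<circ> (\<lambda>s. 1 / s)) punctured_disc (- \<Gamma>)"
      using bij by (rule bij_betw_trans)
    then show "bij_betw (\<lambda>s. k s / s) punctured_disc (- \<Gamma>)"
      by (rule bij_betw_cong[THEN iffD1, rotated]) (simp add: eq)
    show "k holomorphic_on ball 0 1" unfolding k_def by (intro holomorphic_intros hS)
  qed (use c1 eq in \<open>auto simp: k_def\<close>)
qed

lemma connected_compl_Riemann_mapping:
  assumes "Riemann_mapping \<Gamma> \<phi>"
  shows "connected (- \<Gamma>)"
proof -
  have im: "\<phi> ` {z. 1 < cmod z} = - \<Gamma>" and h: "\<phi> holomorphic_on {z. 1 < cmod z}"
    using assms by (auto simp: Riemann_mapping_def bij_betw_def)
  have "{z. 1 < cmod z} = - cball 0 1" by auto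
  moreover have "connected (- cball (0::complex) 1)"
    by (rule connected_complement_bounded_convex) auto
  ultimately have "connected (\<phi> ` {z. 1 < cmod z})"
    using holomorphic_on_imp_continuous_on[OF h] by (intro connected_continuous_image) auto
  then show ?thesis by (simp add: im)
qed

section \<open>Boundary values and convergence\<close>

definition poisson :: "complex \<Rightarrow> real \<Rightarrow> real" where
  "poisson s t = (1 - (cmod s)\<^sup>2) / (cmod (1 - s * cis t))\<^sup>2"

lemma poisson_eq:
  assumes "cmod s < 1"
  shows "complex_of_real (poisson s t)
    = 1 / (1 - s * cis t) + cnj (s * cis t) / (1 - cnj (s * cis t))"
proof -
  let ?u = "s * cis t"
  have nu: "cmod ?u = cmod s" by (simp add: norm_mult)
  have ne: "1 - ?u \<noteq> 0" "1 - cnj ?u \<noteq> 0"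
  proof -
    show 1: "1 - ?u \<noteq> 0" using nu assms by (metis eq_iff_diff_eq_0 less_irrefl norm_one)
    have "1 - cnj ?u = cnj (1 - ?u)" by simp
    then show "1 - cnj ?u \<noteq> 0" using 1 by (metis complex_cnj_zero_iff)
  qed
  have "1 / (1 - ?u) + cnj ?u / (1 - cnj ?u) = (1 - ?u * cnj ?u) / ((1 - ?u) * (1 - cnj ?u))"
  proof -
    have "1 / A + c / B = (B + c * A) / (A * B)" if "A \<noteq> 0" "B \<noteq> 0" for A B c :: complex
      using that by (simp add: field_simps)
    from this[OF ne, of "cnj ?u"] show ?thesis by (simp add: algebra_simps)
  qed
  also have "(1 - ?u) * (1 - cnj ?u) = complex_of_real ((cmod (1 - ?u))\<^sup>2)"
    unfolding complex_norm_square by simp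
  also have "1 - ?u * cnj ?u = complex_of_real (1 - (cmod s)\<^sup>2)"
    unfolding complex_norm_square[symmetric] nu by simp
  finally show ?thesis by (simp add: poisson_def)
qed

lemma poisson_nonneg: "cmod s < 1 \<Longrightarrow> 0 \<le> poisson s t"
  by (simp add: poisson_def abs_square_le_1 less_imp_le)

lemma continuous_poisson:
  assumes "cmod s < 1"
  shows "continuous_on UNIV (poisson s)"
proof -
  have "1 - s * cis t \<noteq> 0" for t
  proof -
    have "cmod (s * cis t) = cmod s" by (simp add: norm_mult)
    then show ?thesis using assms by (metis eq_iff_diff_eq_0 less_irrefl norm_one)
  qed
  then show ?thesis unfolding poisson_def by (intro continuous_intros) auto
qed

lemma LINT_poisson_sums:
  fixes g :: "real \<Rightarrow> complex"
  assumes g: "continuous_on {0..2 * pi} g" and s: "cmod s < 1"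
  defines "G \<equiv> \<lambda>n :: int. LINT t|circ. g t * cis (- (of_int n * t))"
  shows "(\<lambda>n. s ^ n * G (- int n) + cnj s ^ Suc n * G (int n + 1))
      sums (LINT t|circ. g t * poisson s t)"
proof -
  obtain B where B: "\<And>t. t \<in> {0..2 * pi} \<Longrightarrow> cmod (g t) \<le> B"
    using compact_imp_bounded[OF compact_continuous_image[OF g compact_Icc]]
    unfolding bounded_iff by (metis imageI)
  let ?u = "\<lambda>t. s * cis t"
  let ?f = "\<lambda>n t. g t * ?u t ^ n + g t * cnj (?u t) ^ Suc n"
  have nu: "cmod (?u t) = cmod s" for t by (simp add: norm_mult)
  have gs: "integrable circ (\<lambda>t. g t * h t)" if "continuous_on UNIV h" for h
    by (intro integrable_circ_cont continuous_intros g continuous_on_subset[OF that]) auto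
  have "(\<lambda>n. LINT t|circ. ?f n t) sums (LINT t|circ. (\<Sum>n. ?f n t))"
  proof (rule LINT_circ_suminf)
    show "continuous_on {0..2 * pi} (?f n)" for n by (intro continuous_intros g)
    show "summable (\<lambda>n. 2 * B * cmod s ^ n)" using s by (intro summable_mult summable_geometric) simp
    fix n t assume t: "t \<in> {0..2 * pi}"
    have B0: "0 \<le> B" using B[OF t] norm_ge_zero order_trans by blast
    have "cmod (?f n t) \<le> cmod (g t) * cmod s ^ n + cmod (g t) * cmod s ^ Suc n"
      by (rule order_trans[OF norm_triangle_ineq]) (simp only: norm_mult norm_power complex_mod_cnj nu norm_cis, simp add: power_mult_distrib)
    also have "\<dots> \<le> B * cmod s ^ n + B * cmod s ^ n"
      using s B0 by (intro add_mono mult_mono B t) (auto simp: mult_le_one mult_left_le_one_le)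
    finally show "cmod (?f n t) \<le> 2 * B * cmod s ^ n" by simp
  qed
  also have "(LINT t|circ. (\<Sum>n. ?f n t)) = (LINT t|circ. g t * poisson s t)"
  proof (rule Bochner_Integration.integral_cong[OF refl])
    fix t
    have "(\<lambda>n. g t * ?u t ^ n) sums (g t * (1 / (1 - ?u t)))"
      by (intro sums_mult geometric_sums) (use s nu in simp)
    moreover have "(\<lambda>n. g t * (cnj (?u t) * cnj (?u t) ^ n))
        sums (g t * (cnj (?u t) * (1 / (1 - cnj (?u t)))))"
      by (intro sums_mult geometric_sums) (use s nu complex_mod_cnj in metis)
    ultimately have "(\<lambda>n. ?f n t) sums (g t * (1 / (1 - ?u t))
        + g t * (cnj (?u t) * (1 / (1 - cnj (?u t)))))"
      unfolding power_Suc by (rule sums_add)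
    also have "g t * (1 / (1 - ?u t)) + g t * (cnj (?u t) * (1 / (1 - cnj (?u t)))) = g t * poisson s t"
      unfolding poisson_eq[OF s] by (simp add: algebra_simps)
    finally show "(\<Sum>n. ?f n t) = g t * poisson s t" by (rule sums_unique[symmetric])
  qed
  also have "(\<lambda>n. LINT t|circ. ?f n t) = (\<lambda>n. s ^ n * G (- int n) + cnj s ^ Suc n * G (int n + 1))"
  proof
    fix n
    have e1: "g t * ?u t ^ n = s ^ n * (g t * cis (- (of_int (- int n) * t)))" for t
      by (simp add: power_mult_distrib Complex.DeMoivre)
    have e2: "g t * cnj (?u t) ^ Suc n = cnj s ^ Suc n * (g t * cis (- (of_int (int n + 1) * t)))" for t
    proof -
      have "cnj (?u t) ^ Suc n = cnj s ^ Suc n * cis (- t) ^ Suc n"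
        by (simp only: complex_cnj_mult cis_cnj power_mult_distrib)
      also have "cis (- t) ^ Suc n = cis (- (of_int (int n + 1) * t))"
        unfolding Complex.DeMoivre by (simp add: algebra_simps)
      finally show ?thesis by (simp only: mult_ac)
    qed
    show "(LINT t|circ. ?f n t) = s ^ n * G (- int n) + cnj s ^ Suc n * G (int n + 1)"
      unfolding e1 e2 G_def
      by (subst Bochner_Integration.integral_add) (auto intro!: integrable_mult_right gs continuous_intros)
  qed
  finally show ?thesis .
qed

lemma LINT_poisson: assumes s: "cmod s < 1" shows "(LINT t|circ. poisson s t) = 2 * pi"
proof -
  have "(\<lambda>n. s ^ n * (LINT t|circ. 1 * cis (- (of_int (- int n) * t)))
      + cnj s ^ Suc n * (LINT t|circ. 1 * cis (- (of_int (int n + 1) * t))))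
          sums (LINT t|circ. 1 * complex_of_real (poisson s t))"
    by (rule LINT_poisson_sums) (use s in auto)
  also have "(\<lambda>n. s ^ n * (LINT t|circ. 1 * cis (- (of_int (- int n) * t)))
      + cnj s ^ Suc n * (LINT t|circ. 1 * cis (- (of_int (int n + 1) * t)))) = (\<lambda>n. if n
          = 0 then 2 * pi else 0)"
  proof
    fix n
    have 1: "(LINT t|circ. 1 * cis (- (of_int (- int n) * t))) = (if n = 0 then 2 * pi else 0)"
      using LINT_circ_cis[of "int n"] by simp
    have 2: "(LINT t|circ. 1 * cis (- (of_int (int n + 1) * t))) = 0"
    proof -
      have "(LINT t|circ. cis (of_int (- (int n + 1)) * t)) = 0"
        unfolding LINT_circ_cis by simp
      then show ?thesis by (simp only: of_int_minus mult_minus_left mult_1_left)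
    qed
    show "s ^ n * (LINT t|circ. 1 * cis (- (of_int (- int n) * t)))
      + cnj s ^ Suc n * (LINT t|circ. 1 * cis (- (of_int (int n + 1) * t))) = (if n
          = 0 then 2 * pi else 0)"
      unfolding 1 2 by simp
  qed
  finally have "(\<lambda>n. if n = 0 then complex_of_real (2 * pi) else 0)
      sums complex_of_real (LINT t|circ. poisson s t)"
    by (simp add: if_distrib[of complex_of_real] cong: if_cong)
  from sums_unique2[OF this sums_single[of 0 "\<lambda>_. complex_of_real (2 * pi)"]]
  show ?thesis by (simp only: of_real_eq_iff)
qed

lemma poisson_approximation:
  fixes f :: "complex \<Rightarrow> complex"
  assumes f: "continuous_on (sphere 0 1) f" and e: "e > 0"
  obtains h C where "h > 0" "C \<ge> 0" "\<And>s. s \<noteq> 0 \<Longrightarrow> 1 - h \<le> cmod s \<Longrightarrow> cmod s < 1 \<Longrightarrow>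
    cmod ((LINT t|circ. f (cis t) * poisson s t) / (2 * pi) - f (cnj (sgn s))) \<le> e
        + C * (1 - (cmod s)\<^sup>2)"
proof -
  have "compact (f ` sphere 0 1)" by (intro compact_continuous_image f) simp
  then obtain M where M: "M > 0" "\<And>z. z \<in> sphere 0 1 \<Longrightarrow> cmod (f z) \<le> M"
    using compact_imp_bounded[of "f ` sphere 0 1"] unfolding bounded_pos by auto
  have "uniformly_continuous_on (sphere 0 1) f"
    by (intro compact_uniformly_continuous f) simp
  then obtain h where h: "h > 0" "\<And>x y. x \<in> sphere 0 1 \<Longrightarrow> y \<in> sphere 0 1 \<Longrightarrow> dist y x < h
      \<Longrightarrow> dist (f y) (f x) < e"
    unfolding uniformly_continuous_on_def using e by metis
  define C where "C = 2 * M * (4 / h\<^sup>2)"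
  show ?thesis
  proof (rule that[of "h / 2" C])
    show "h / 2 > 0" "C \<ge> 0" using h(1) M(1) by (auto simp: C_def)
    fix s :: complex assume s: "s \<noteq> 0" "1 - h / 2 \<le> cmod s" "cmod s < 1"
    define w where "w = cnj (sgn s)"
    have w: "w \<in> sphere 0 1" using s(1) by (simp add: w_def norm_sgn)
    have sw: "s = of_real (cmod s) * cnj w" using s(1) by (simp add: w_def sgn_eq)
    have cw: "w * cnj w = 1" using w complex_norm_square[of w] by simp
    have fc: "continuous_on {0..2 * pi} (\<lambda>t. f (cis t))"
      by (rule continuous_on_compose2[OF f]) (auto intro!: continuous_intros)
    have pc: "continuous_on {0..2 * pi} (poisson s)"
      by (rule continuous_on_subset[OF continuous_poisson[OF s(3)]]) simp
    have pt: "cmod ((f (cis t) - f w) * poisson s t) \<le> e * poisson s t + C * (1 - (cmod s)\<^sup>2)" for t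
    proof (cases "dist (cis t) w < h")
      case True
      then have "cmod (f (cis t) - f w) \<le> e" using h(2)[OF w, of "cis t"]
          by (simp add: dist_norm less_imp_le)
      then have "cmod ((f (cis t) - f w) * poisson s t) \<le> e * poisson s t"
        using poisson_nonneg[OF s(3)] by (simp add: norm_mult mult_right_mono)
      moreover have "0 \<le> C * (1 - (cmod s)\<^sup>2)"
        using \<open>C \<ge> 0\<close> s(3) by (simp add: abs_square_le_1 less_imp_le)
      ultimately show ?thesis by linarith
    next
      case False
      have "h \<le> cmod (w - cis t)" using False by (simp add: dist_norm norm_minus_commute)
      also have "\<dots> \<le> cmod (w - of_real (cmod s) * cis t) + cmod (of_real (cmod s) * cis t - cis t)"
        using norm_triangle_ineq[of "w - of_real (cmod s) * cis t" "of_real (cmod s) * cis t - cis t"]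
            by simp
      also have "cmod (of_real (cmod s) * cis t - cis t) = 1 - cmod s"
      proof -
        have "of_real (cmod s) * cis t - cis t = of_real (cmod s - 1) * cis t"
            by (simp add: algebra_simps)
        then have "cmod (of_real (cmod s) * cis t - cis t) = \<bar>cmod s - 1\<bar>"
            by (simp only: norm_mult norm_of_real norm_cis mult_1_right)
        then show ?thesis using s(3) by simp
      qed
      also have "w - of_real (cmod s) * cis t = w * (1 - s * cis t)"
        using cw by (subst (2) sw) (simp add: algebra_simps)
      also have "cmod (w * (1 - s * cis t)) = cmod (1 - s * cis t)" using w by (simp add: norm_mult)
      finally have "h / 2 \<le> cmod (1 - s * cis t)" using s(2) by linarith
      then have "(h / 2)\<^sup>2 \<le> (cmod (1 - s * cis t))\<^sup>2" using h(1) by (intro power_mono) auto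
      then have "poisson s t \<le> (1 - (cmod s)\<^sup>2) / (h / 2)\<^sup>2"
        unfolding poisson_def using h(1) s(3)
            by (intro divide_left_mono) (auto simp: abs_square_le_1 less_imp_le intro!: mult_pos_pos zero_less_power)
      then have "poisson s t \<le> 4 / h\<^sup>2 * (1 - (cmod s)\<^sup>2)"
        by (simp add: power_divide mult.commute)
      moreover have "cmod (f (cis t) - f w) \<le> 2 * M"
        using norm_triangle_ineq4[of "f (cis t)" "f w"] M(2)[OF w] M(2)[of "cis t"] by simp
      ultimately have "cmod (f (cis t) - f w) * poisson s t \<le> 2 * M * (4 / h\<^sup>2 * (1 - (cmod s)\<^sup>2))"
        using M(1) poisson_nonneg[OF s(3)] by (intro mult_mono) auto
      then have "cmod ((f (cis t) - f w) * poisson s t) \<le> C * (1 - (cmod s)\<^sup>2)"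
        by (simp only: C_def norm_mult norm_of_real abs_of_nonneg[OF poisson_nonneg[OF s(3)]] mult.assoc)
      moreover have "0 \<le> e * poisson s t" using e poisson_nonneg[OF s(3)] by simp
      ultimately show ?thesis by linarith
    qed
    have "(LINT t|circ. f (cis t) * poisson s t) - 2 * pi * f w
        = (LINT t|circ. f (cis t) * poisson s t) - (LINT t|circ. f w * complex_of_real (poisson s t))"
      using LINT_poisson[OF s(3)] by simp
    also have "\<dots> = (LINT t|circ. f (cis t) * poisson s t - f w * complex_of_real (poisson s t))"
      by (rule Bochner_Integration.integral_diff[symmetric])
        (auto intro!: integrable_circ_cont continuous_intros fc pc)
    also have "\<dots> = (LINT t|circ. (f (cis t) - f w) * poisson s t)" by (simp add: left_diff_distrib)
    also have "cmod \<dots> \<le> (LINT t|circ. e * poisson s t + C * (1 - (cmod s)\<^sup>2))"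
      by (rule order_trans[OF integral_norm_bound integral_mono])
        (auto intro!: integrable_norm integrable_circ_cont continuous_intros fc pc pt)
    also have "\<dots> = (LINT t|circ. e * poisson s t) + (LINT t|circ. C * (1 - (cmod s)\<^sup>2))"
      by (rule Bochner_Integration.integral_add) (intro integrable_circ_cont continuous_intros pc)+
    also have "\<dots> = (e + C * (1 - (cmod s)\<^sup>2)) * (2 * pi)"
      by (simp add: LINT_poisson[OF s(3)] distrib_right)
    finally have le: "cmod ((LINT t|circ. f (cis t) * poisson s t) - 2 * pi * f w) \<le> (e
        + C * (1 - (cmod s)\<^sup>2)) * (2 * pi)" .
    have "(LINT t|circ. f (cis t) * poisson s t) / (2 * pi) - f w
        = ((LINT t|circ. f (cis t) * poisson s t) - 2 * pi * f w) / complex_of_real (2 * pi)"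
      by (simp add: field_simps)
    then have "cmod ((LINT t|circ. f (cis t) * poisson s t) / (2 * pi) - f w)
        = cmod ((LINT t|circ. f (cis t) * poisson s t) - 2 * pi * f w) / (2 * pi)"
      by (simp only: norm_divide norm_of_real) simp
    also have "\<dots> \<le> e + C * (1 - (cmod s)\<^sup>2)" using le by (simp add: pos_divide_le_eq)
    finally show "cmod ((LINT t|circ. f (cis t) * poisson s t) / (2 * pi) - f (cnj (sgn s))) \<le> e
        + C * (1 - (cmod s)\<^sup>2)"
      unfolding w_def .
  qed
qed

context Toeplitz_setting
begin

lemma tser_eq_poisson:
  assumes sym: "Toeplitz_symbol T f" and f: "continuous_on (sphere 0 1) f"
    and s: "s \<noteq> 0" "cmod s < 1"
  shows "tser s / s = (LINT t|circ. f (cis t) * poisson s t) / (2 * pi)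
    + tcoeff 0 * of_real (1 - (cmod s)\<^sup>2) / s"
proof -
  define G where "G n = (LINT t|circ. f (cis t) * cis (- (of_int n * t)))" for n
  have G: "G (int i - int j) = 2 * pi * ell2_entry T i j" for i j
    using sym by (simp add: Toeplitz_symbol_def fourier_coeff_def G_def)
  have Gneg: "G (- int n) = 2 * pi * tcoeff (Suc n)" for n
    using G[of 0 n] by (simp add: entry_T)
  have Gpos: "G (int n + 1) = (if n = 0 then 2 * pi * tcoeff 0 else 0)" for n
    using G[of "Suc n" 0] by (simp add: entry_T add.commute)
  have fc: "continuous_on {0..2 * pi} (\<lambda>t. f (cis t))"
    by (rule continuous_on_compose2[OF f]) (auto intro!: continuous_intros)
  have 1: "(\<lambda>n. s ^ n * G (- int n) + cnj s ^ Suc n * G (int n + 1)) sums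
      (LINT t|circ. f (cis t) * poisson s t)"
    unfolding G_def by (rule LINT_poisson_sums[OF fc s(2)])
  have "(\<lambda>n. tcoeff (Suc n) * s ^ Suc n) sums (tser s - tcoeff 0 * s ^ 0)"
    using sums_split_initial_segment[OF tser_sums[OF s(2)], of 1] by simp
  then have "(\<lambda>n. 2 * pi * (tcoeff (Suc n) * s ^ Suc n / s))
      sums (2 * pi * ((tser s - tcoeff 0 * s ^ 0) / s))"
    by (intro sums_mult sums_divide)
  then have "(\<lambda>n. 2 * pi * (tcoeff (Suc n) * s ^ Suc n / s) + (if n
      = 0 then cnj s * (2 * pi * tcoeff 0) else 0))
      sums (2 * pi * ((tser s - tcoeff 0 * s ^ 0) / s) + cnj s * (2 * pi * tcoeff 0))"
    by (intro sums_add sums_single)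
  moreover have "(\<lambda>n. 2 * pi * (tcoeff (Suc n) * s ^ Suc n / s) + (if n
      = 0 then cnj s * (2 * pi * tcoeff 0) else 0))
      = (\<lambda>n. s ^ n * G (- int n) + cnj s ^ Suc n * G (int n + 1))"
    using s(1) by (auto simp: Gneg Gpos)
  ultimately have "(LINT t|circ. f (cis t) * poisson s t) = 2 * pi * ((tser s - tcoeff 0 * s ^ 0) / s)
      + cnj s * (2 * pi * tcoeff 0)"
    using sums_unique2[OF 1] by simp
  also have "\<dots> = 2 * pi * ((tser s - tcoeff 0) / s + cnj s * tcoeff 0)"
    by (simp add: algebra_simps)
  finally have "(LINT t|circ. f (cis t) * poisson s t) / (2 * pi) = (tser s - tcoeff 0) / s
      + cnj s * tcoeff 0"
    by simp
  moreover have "tcoeff 0 * of_real (1 - (cmod s)\<^sup>2) / s = tcoeff 0 / s - cnj s * tcoeff 0"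
    using s(1) by (simp only: of_real_diff of_real_1 complex_norm_square) (simp add: field_simps)
  ultimately show ?thesis by (simp add: diff_divide_distrib)
qed

lemma tser_boundary_limit:
  assumes sym: "Toeplitz_symbol T f" and f: "continuous_on (sphere 0 1) f" and e: "e > 0"
  obtains \<delta> where "\<delta> > 0" "\<And>z. 1 < cmod z \<Longrightarrow> cmod z < 1 + \<delta> \<Longrightarrow> cmod (z * tser (1 / z) - f (sgn z)) \<le> e"
proof -
  obtain h C where h: "h > 0" "C \<ge> 0" and app: "\<And>s. s \<noteq> 0 \<Longrightarrow> 1 - h \<le> cmod s \<Longrightarrow> cmod s < 1 \<Longrightarrow>
    cmod ((LINT t|circ. f (cis t) * poisson s t) / (2 * pi) - f (cnj (sgn s))) \<le> e / 2
        + C * (1 - (cmod s)\<^sup>2)"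
    by (rule poisson_approximation[OF f half_gt_zero[OF e]]) (rule that)
  define L where "L = 2 * C + 4 * cmod (tcoeff 0) + 1"
  have L: "L > 0" using h(2) by (simp add: L_def add_nonneg_pos)
  define \<delta> where "\<delta> = Min {h, 1, e / (2 * L)}"
  have \<delta>: "\<delta> > 0" "\<delta> \<le> h" "\<delta> \<le> 1" "\<delta> \<le> e / (2 * L)" using h e L by (auto simp: \<delta>_def)
  show ?thesis
  proof (rule that[OF \<delta>(1)])
    fix z :: complex assume z: "1 < cmod z" "cmod z < 1 + \<delta>"
    define s where "s = 1 / z"
    have z0: "z \<noteq> 0"
    proof
      assume "z = 0"
      then show False using z(1) by simp
    qed
    have s: "s \<noteq> 0" "cmod s < 1" "cmod s = 1 / cmod z"
      using z0 z(1) by (simp_all add: s_def norm_divide)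
    have "1 - cmod s = (cmod z - 1) / cmod z" using z0 by (simp add: s(3) diff_divide_distrib)
    also have "\<dots> \<le> (cmod z - 1) / 1" using z by (intro divide_left_mono) auto
    finally have d: "1 - cmod s \<le> \<delta>" using z by simp
    have half: "1 / 2 \<le> cmod s" unfolding s(3) using z \<delta>(3) z0 by (intro divide_left_mono) auto
    have sq: "1 - (cmod s)\<^sup>2 \<le> 2 * \<delta>" "0 \<le> 1 - (cmod s)\<^sup>2"
    proof -
      have "1 - (cmod s)\<^sup>2 = (1 + cmod s) * (1 - cmod s)" by (simp add: power2_eq_square algebra_simps)
      moreover have "(1 + cmod s) * (1 - cmod s) \<le> 2 * \<delta>" using s(2) d by (intro mult_mono) auto
      ultimately show "1 - (cmod s)\<^sup>2 \<le> 2 * \<delta>" by simp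
      show "0 \<le> 1 - (cmod s)\<^sup>2" using s(2) by (simp add: abs_square_le_1 less_imp_le)
    qed
    have sg: "cnj (sgn s) = sgn z"
    proof -
      have "cnj (sgn s) = cnj s / of_real (cmod s)" by (simp add: sgn_eq)
      also have "cnj s = 1 / cnj z" by (simp add: s_def)
      also have "1 / cnj z = z / (z * cnj z)" using z0 by simp
      also have "\<dots> = z / of_real ((cmod z)\<^sup>2)" by (simp only: complex_norm_square)
      finally show ?thesis using z0 by (simp add: sgn_eq s(3) power2_eq_square)
    qed
    have "z * tser (1 / z) - f (sgn z) = ((LINT t|circ. f (cis t) * poisson s t) / (2 * pi) - f (cnj (sgn s)))
        + tcoeff 0 * of_real (1 - (cmod s)\<^sup>2) / s"
      using tser_eq_poisson[OF sym f s(1,2)] unfolding sg by (simp add: s_def mult.commute)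
    also have "cmod \<dots> \<le> (e / 2 + C * (1 - (cmod s)\<^sup>2)) + cmod (tcoeff 0 * of_real (1 - (cmod s)\<^sup>2) / s)"
      by (rule order_trans[OF norm_triangle_ineq add_right_mono[OF app]]) (use s d \<delta> in auto)
    also have "cmod (tcoeff 0 * of_real (1 - (cmod s)\<^sup>2) / s)
        = cmod (tcoeff 0) * (1 - (cmod s)\<^sup>2) / cmod s"
      using sq(2) by (simp only: norm_mult norm_divide norm_of_real abs_of_nonneg)
    also have "\<dots> \<le> cmod (tcoeff 0) * (1 - (cmod s)\<^sup>2) / (1 / 2)"
      using half sq(2) by (intro divide_left_mono) auto
    also have "(e / 2 + C * (1 - (cmod s)\<^sup>2)) + cmod (tcoeff 0) * (1 - (cmod s)\<^sup>2) / (1 / 2)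
        = e / 2 + (C + 2 * cmod (tcoeff 0)) * (1 - (cmod s)\<^sup>2)" by (simp add: algebra_simps)
    also have "\<dots> \<le> e / 2 + (C + 2 * cmod (tcoeff 0)) * (2 * \<delta>)"
      using h(2) sq by (intro add_left_mono mult_left_mono) auto
    also have "\<dots> \<le> e / 2 + L * \<delta>" using \<delta>(1) by (simp add: L_def algebra_simps)
    also have "\<dots> \<le> e" using \<delta>(4) L by (simp add: pos_le_divide_eq algebra_simps)
    finally show "cmod (z * tser (1 / z) - f (sgn z)) \<le> e" by simp
  qed
qed

lemma hess_laurent_tendsto:
  assumes r: "1 < r" and e: "e > 0"
  obtains N where "N \<ge> 1" "\<And>n z. n \<ge> N \<Longrightarrow> cmod z = r \<Longrightarrow> cmod (hess_laurent d n z - z * tser (1 / z)) \<le> e"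
proof -
  define b where "b m n = (if m \<le> n then ell2_entry D (n - m) (n - 1) else 0)" for m n
  have b_lim: "(\<lambda>n. b m n) \<longlonglongrightarrow> tcoeff m" for m
  proof (cases m)
    case 0
    have "(\<lambda>n. ell2_entry D (1 + n) (0 + n)) \<longlonglongrightarrow> tcoeff 0"
      using entry_D_tendsto[of 1 0] by (simp add: tcoeff_def)
    then have "(\<lambda>n. b m (n + 1)) \<longlonglongrightarrow> tcoeff m" by (simp add: b_def 0)
    then show ?thesis by (rule LIMSEQ_offset)
  next
    case (Suc k)
    have "(\<lambda>n. ell2_entry D (0 + n) (k + n)) \<longlonglongrightarrow> tcoeff m"
      using entry_D_tendsto[of 0 k] by (simp add: tcoeff_def Suc)
    then have "(\<lambda>n. b m (n + m)) \<longlonglongrightarrow> tcoeff m" by (simp add: b_def Suc add.commute)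
    then show ?thesis by (rule LIMSEQ_offset)
  qed
  have b_bound: "cmod (b m n) \<le> onorm D" for m n
    using bounded_clinear_entry_le[OF clinear_D] order_trans[OF norm_ge_zero bounded_clinear_entry_le[OF clinear_D]]
    by (auto simp: b_def)
  define a where "a m n = r * (cmod (b m n - tcoeff m) * (1 / r) ^ m)" for m n
  have "eventually (\<lambda>n. summable (\<lambda>k. norm (a k n))) sequentially \<and>
      summable (\<lambda>m. norm (r * (cmod (tcoeff m - tcoeff m) * (1 / r) ^ m))) \<and>
      ((\<lambda>n. suminf (\<lambda>k. a k n)) \<longlongrightarrow> suminf (\<lambda>m. r * (cmod (tcoeff m - tcoeff m) * (1 / r) ^ m))) sequentially"
  proof (rule tannerys_theorem)
    show "((\<lambda>n. a k n) \<longlongrightarrow> r * (cmod (tcoeff k - tcoeff k) * (1 / r) ^ k)) sequentially" for k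
      unfolding a_def by (intro tendsto_intros b_lim)
    show "summable (\<lambda>m. r * ((onorm D + onorm T) * (1 / r) ^ m))"
      using r by (intro summable_mult summable_geometric) simp
    have "norm (a m n) \<le> r * ((onorm D + onorm T) * (1 / r) ^ m)" for m n
    proof -
      have "cmod (b m n - tcoeff m) \<le> onorm D + onorm T"
        by (rule order_trans[OF norm_triangle_ineq4 add_mono[OF b_bound tcoeff_bound]])
      then have "r * (cmod (b m n - tcoeff m) * (1 / r) ^ m) \<le> r * ((onorm D + onorm T) * (1 / r) ^ m)"
        using r by (intro mult_left_mono mult_right_mono) auto
      then show ?thesis using r by (simp add: a_def)
    qed
    then show "eventually (\<lambda>(m,n). norm (a m n) \<le> r * ((onorm D
        + onorm T) * (1 / r) ^ m)) (at_top \<times>\<^sub>F sequentially)"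
      by (intro always_eventually) auto
  qed simp
  then have lim: "(\<lambda>n. \<Sum>m. a m n) \<longlonglongrightarrow> 0" and sm: "\<forall>\<^sub>F n in sequentially. summable (\<lambda>m. norm (a m n))"
    by auto
  have "\<forall>\<^sub>F n in sequentially. (\<Sum>m. a m n) < e \<and> summable (\<lambda>m. norm (a m n)) \<and> 1 \<le> n"
    by (intro eventually_conj order_tendstoD(2)[OF lim e] sm eventually_ge_at_top)
  then obtain N where N: "\<And>n. n \<ge> N \<Longrightarrow> (\<Sum>m. a m n) < e \<and> summable (\<lambda>m. norm (a m n)) \<and> 1 \<le> n"
    by (auto simp: eventually_sequentially)
  show ?thesis
  proof (rule that[of "max N 1"])
    fix n and z :: complex assume n: "n \<ge> max N 1" and z: "cmod z = r"
    have z0: "z \<noteq> 0" using z r by auto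
    have n1: "n \<ge> 1" and nN: "n \<ge> N" using n by auto
    have s1: "cmod (1 / z) < 1" using z r by (simp add: norm_divide)
    have "(\<lambda>m. b m n * (1 / z) ^ m) sums (\<Sum>m<Suc n. b m n * (1 / z) ^ m)"
      by (rule sums_finite) (auto simp: b_def)
    then have "(\<lambda>m. z * (b m n * (1 / z) ^ m - tcoeff m * (1 / z) ^ m)) sums
        (z * ((\<Sum>m<Suc n. b m n * (1 / z) ^ m) - tser (1 / z)))"
      by (intro sums_mult sums_diff tser_sums s1)
    also have "z * ((\<Sum>m<Suc n. b m n * (1 / z) ^ m) - tser (1 / z))
        = hess_laurent d n z - z * tser (1 / z)"
    proof -
      have "(\<Sum>m<Suc n. b m n * (1 / z) ^ m) = b 0 n + (\<Sum>m<n. b (Suc m) n * (1 / z) ^ Suc m)"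
        by (subst sum.lessThan_Suc_shift) simp
      then have "z * (\<Sum>m<Suc n. b m n * (1 / z) ^ m) = b 0 n * z
          + (\<Sum>m<n. z * (b (Suc m) n * (1 / z) ^ Suc m))"
        by (simp add: distrib_left sum_distrib_left mult.commute)
      also have "(\<Sum>m<n. z * (b (Suc m) n * (1 / z) ^ Suc m)) = (\<Sum>m<n. d (n - m) n / z ^ m)"
      proof (rule sum.cong[OF refl])
        fix m assume m: "m \<in> {..<n}"
        then have "b (Suc m) n = d (n - m) n"
          using n1 by (simp add: b_def entry_D Suc_diff_Suc)
        then show "z * (b (Suc m) n * (1 / z) ^ Suc m) = d (n - m) n / z ^ m"
          using z0 by (simp add: field_simps)
      qed
      also have "b 0 n = d (n + 1) n" using n1 by (simp add: b_def entry_D)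
      finally show ?thesis by (simp add: hess_laurent_def right_diff_distrib)
    qed
    finally have sums: "(\<lambda>m. z * (b m n * (1 / z) ^ m - tcoeff m * (1 / z) ^ m))
        sums (hess_laurent d n z - z * tser (1 / z))" .
    have na: "cmod (z * (b m n * (1 / z) ^ m - tcoeff m * (1 / z) ^ m)) = a m n" for m
    proof -
      have "z * (b m n * (1 / z) ^ m - tcoeff m * (1 / z) ^ m) = z * ((b m n - tcoeff m) * (1 / z) ^ m)"
        by (simp only: left_diff_distrib)
      then show ?thesis by (simp only: norm_mult norm_power norm_divide z norm_one a_def)
    qed
    have sa: "summable (\<lambda>m. a m n)" using N[OF nN] r by (simp add: a_def)
    have "cmod (hess_laurent d n z - z * tser (1 / z)) \<le> (\<Sum>m. a m n)"
      unfolding sums_unique[OF sums]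
      using summable_norm[of "\<lambda>m. z * (b m n * (1 / z) ^ m - tcoeff m * (1 / z) ^ m)"] sa unfolding na
          by simp
    then show "cmod (hess_laurent d n z - z * tser (1 / z)) \<le> e" using N[OF nN] by linarith
  qed simp
qed

end

context Toeplitz_setting
begin

lemma Riemann_mapping_eq_symbol:
  assumes arcs: "\<exists>\<A>. finite \<A> \<and> (\<forall>A\<in>\<A>. Jordan_arc A) \<and> \<Gamma> = \<Union>\<A>"
    and inf: "infinite \<Gamma>" and \<phi>: "Riemann_mapping \<Gamma> \<phi>" and z: "1 < cmod z"
  shows "\<phi> z = z * tser (1 / z)"
proof -
  obtain \<A> where A: "finite \<A>" "\<forall>A\<in>\<A>. Jordan_arc A" "\<Gamma> = \<Union>\<A>" using arcs by blast
  note arc = Jordan_arc_Union_props[OF A(1,2), folded A(3)]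
  have conn: "connected (- \<Gamma>)" by (rule connected_compl_Riemann_mapping[OF \<phi>])
  interpret B: boundary_cluster \<Gamma> tser
  proof
    show "\<exists>d<1. \<forall>s. d < cmod s \<and> cmod s < 1 \<longrightarrow> infdist (tser s / s) \<Gamma> \<le> e" if "e > 0" for e
      using symbol_near_support[OF that] by metis
    show "\<exists>s. \<rho> < cmod s \<and> cmod s < 1 \<and> cmod (tser s / s - l) < e"
      if "l \<in> \<Gamma>" "e > 0" "\<rho> < 1" for l e \<rho>
      by (rule ex_near_symbol[OF conn arc(2) arc(3) that])
  qed (use arc(1,2) inf conn tser_holomorphic in auto)
  obtain k c where k: "k holomorphic_on ball 0 1" "k 0 = of_real c" "c > 0"
    "\<And>s. s \<in> punctured_disc \<Longrightarrow> \<phi> (1 / s) = k s / s"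
    "bij_betw (\<lambda>s. k s / s) punctured_disc (- \<Gamma>)"
    by (rule Riemann_mapping_inverted[OF \<phi>]) (rule that)
  have t0: "tser 0 = of_real (Re (tcoeff 0))"
    using tcoeff_0(1) by (simp add: tser_0 of_real_Re)
  have "Re (tcoeff 0) > 0"
    using tcoeff_0(2) B.k0_ne_0 t0 by (metis of_real_0 order_le_less)
  have s: "1 / z \<in> punctured_disc" using z by (auto simp: norm_divide divide_less_eq_1)
  have "tser (1 / z) = k (1 / z)"
    by (rule pole_bij_unique[OF tser_holomorphic B.bij_quot k(1,5) t0 \<open>Re (tcoeff 0) > 0\<close> k(2,3) s])
  then show ?thesis using k(4)[OF s] by (simp add: mult.commute)
qed

lemma boundary_extension_eq_symbol:
  assumes sym: "Toeplitz_symbol T f" and f: "continuous_on (sphere 0 1) f"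
    and \<phi>: "\<And>z. 1 < cmod z \<Longrightarrow> \<phi> z = z * tser (1 / z)"
    and hol: "\<phi> holomorphic_on {z. 1 < cmod z}" and z: "cmod z = 1"
  shows "boundary_extension \<phi> z = f z"
proof -
  define g where "g z = (if 1 < cmod z then \<phi> z else f z)" for z
  have op: "open {z :: complex. 1 < cmod z}" by (intro open_Collect_less continuous_intros)
  have "continuous_on {z. 1 \<le> cmod z} g"
    unfolding continuous_on_def
  proof
    fix x :: complex assume x: "x \<in> {z. 1 \<le> cmod z}"
    show "(g \<longlongrightarrow> g x) (at x within {z. 1 \<le> cmod z})"
    proof (cases "1 < cmod x")
      case True
      have "isCont \<phi> x"
        using holomorphic_on_imp_continuous_on[OF hol] op True
            by (simp add: continuous_on_eq_continuous_at)
      moreover have "\<forall>\<^sub>F y in at x. \<phi> y = g y"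
        using op True unfolding eventually_at_topological g_def
            by (intro exI[of _ "{z. 1 < cmod z}"]) auto
      ultimately have "(g \<longlongrightarrow> g x) (at x)"
        using True tendsto_cong by (fastforce simp: isCont_def g_def)
      then show ?thesis by (rule tendsto_within_subset) simp
    next
      case False
      then have x1: "cmod x = 1" and gx: "g x = f x" using x by (auto simp: g_def)
      show ?thesis
        unfolding gx Lim_within
      proof (intro allI impI)
        fix e :: real assume e: "e > 0"
        obtain \<delta> where \<delta>: "\<delta> > 0" "\<And>z. 1 < cmod z \<Longrightarrow> cmod z < 1 + \<delta> \<Longrightarrow> cmod (z * tser (1 / z) - f (sgn z))
            \<le> e / 2"
          by (rule tser_boundary_limit[OF sym f half_gt_zero[OF e]]) (rule that)
        obtain h where h: "h > 0" "\<And>y. cmod y = 1 \<Longrightarrow> dist y x < h \<Longrightarrow> dist (f y) (f x) < e / 2"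
          using f x1 e unfolding continuous_on_iff by (metis half_gt_zero mem_sphere_0)
        show "\<exists>d>0. \<forall>y\<in>{z. 1 \<le> cmod z}. 0 < dist y x \<and> dist y x < d \<longrightarrow> dist (g y) (f x) < e"
        proof (intro exI conjI ballI impI)
          show "min \<delta> (h / 2) > 0" using \<delta> h by simp
          fix y :: complex assume y: "y \<in> {z. 1 \<le> cmod z}" "0 < dist y x \<and> dist y x < min \<delta> (h / 2)"
          have ny: "cmod y \<le> 1 + dist y x"
            using norm_triangle_ineq[of x "y - x"] x1 by (simp add: dist_norm)
          have y0: "y \<noteq> 0" using y(1) by auto
          have "dist (sgn y) y = cmod y - 1"
          proof -
            have "sgn y - y = of_real (1 / cmod y - 1) * y" using y0 by (simp add: sgn_eq field_simps)
            then have "dist (sgn y) y = \<bar>1 / cmod y - 1\<bar> * cmod y"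
              by (simp only: dist_norm norm_mult norm_of_real)
            also have "\<bar>1 / cmod y - 1\<bar> = 1 - 1 / cmod y" using y(1) y0 by (simp add: divide_le_eq_1)
            finally show ?thesis using y0 by (simp add: left_diff_distrib)
          qed
          then have "dist (sgn y) x < h" using dist_triangle[of "sgn y" x y] ny y(2) by simp
          then have fs: "dist (f (sgn y)) (f x) < e / 2" using h(2)[of "sgn y"] y0
              by (simp add: norm_sgn)
          show "dist (g y) (f x) < e"
          proof (cases "1 < cmod y")
            case True
            then have "dist (g y) (f (sgn y)) \<le> e / 2"
              using \<delta>(2)[of y] ny y(2) \<phi>[of y] by (simp add: g_def dist_norm)
            then show ?thesis using fs dist_triangle[of "g y" "f x" "f (sgn y)"] by linarith
          next
            case False
            then have "cmod y = 1" using y(1) by simp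
            then have "sgn y = y" by (simp add: sgn_eq)
            then show ?thesis using fs False e by (simp add: g_def)
          qed
        qed
      qed
    qed
  qed
  then have "boundary_extension \<phi> z = g z"
    by (rule boundary_extension_eq) (use z in \<open>auto simp: g_def\<close>)
  then show ?thesis using z by (simp add: g_def)
qed

end

theorem theorem3:
  fixes \<mu> :: "complex measure"
    and P :: "nat \<Rightarrow> complex poly"
    and d :: "nat \<Rightarrow> nat \<Rightarrow> complex"
    and D T :: "ell2 \<Rightarrow> ell2"
    and \<phi> :: "complex \<Rightarrow> complex"
  assumes "prob_space \<mu>" and "sets \<mu> = sets borel"
    and "compact (measure_support \<mu>)" and "infinite (measure_support \<mu>)"
    and "orthonormal_polys \<mu> P" and "Hessenberg_matrix P d" and "Hessenberg_operator d D"
    and "regular_measure \<mu> P"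
    and "\<exists>\<A>. finite \<A> \<and> (\<forall>A\<in>\<A>. Jordan_arc A) \<and> measure_support \<mu> = \<Union>\<A>"
    and "simply_connected_space (sphere_complement (measure_support \<mu>))"
    and "unif_asymp_Toeplitz_limit D T" and "has_continuous_symbol T"
    and "Riemann_mapping (measure_support \<mu>) \<phi>"
  shows "\<forall>\<epsilon>>0. \<exists>\<delta>>0. \<forall>r. 1 < r \<and> r < 1 + \<delta> \<longrightarrow>
           (\<exists>N\<ge>1. \<forall>n\<ge>N. \<forall>\<theta>\<in>{0..2 * pi}.
              cmod (hess_laurent d n (of_real r * cis \<theta>) - boundary_extension \<phi> (cis \<theta>)) \<le> \<epsilon>)"
proof -
  interpret prob_space \<mu> by (rule assms(1))
  interpret Toeplitz_setting \<mu> P d D T by unfold_locales (rule assms)+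
  obtain f where f: "Toeplitz_symbol T f" "continuous_on (sphere 0 1) f"
    using assms(12) by (auto simp: has_continuous_symbol_def)
  have \<phi>: "\<phi> z = z * tser (1 / z)" if "1 < cmod z" for z
    by (rule Riemann_mapping_eq_symbol[OF assms(9,4,13) that])
  have hol: "\<phi> holomorphic_on {z. 1 < cmod z}"
    using assms(13) by (simp add: Riemann_mapping_def)
  show ?thesis
  proof (intro allI impI)
    fix e :: real assume e: "e > 0"
    obtain \<delta> where \<delta>: "\<delta> > 0" "\<And>z. 1 < cmod z \<Longrightarrow> cmod z < 1 + \<delta> \<Longrightarrow> cmod (z * tser (1 / z) - f (sgn z))
        \<le> e / 2"
      by (rule tser_boundary_limit[OF f half_gt_zero[OF e]]) (rule that)
    show "\<exists>\<delta>>0. \<forall>r. 1 < r \<and> r < 1 + \<delta> \<longrightarrow> (\<exists>N\<ge>1. \<forall>n\<ge>N. \<forall>\<theta>\<in>{0..2 * pi}.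
        cmod (hess_laurent d n (of_real r * cis \<theta>) - boundary_extension \<phi> (cis \<theta>)) \<le> e)"
    proof (intro exI[of _ \<delta>] conjI allI impI \<delta>(1))
      fix r assume r: "1 < r \<and> r < 1 + \<delta>"
      obtain N where N: "N \<ge> 1" "\<And>n z. n \<ge> N \<Longrightarrow> cmod z = r \<Longrightarrow> cmod (hess_laurent d n z - z * tser (1 / z))
          \<le> e / 2"
        by (rule hess_laurent_tendsto[OF conjunct1[OF r] half_gt_zero[OF e]]) (rule that)
      show "\<exists>N\<ge>1. \<forall>n\<ge>N. \<forall>\<theta>\<in>{0..2 * pi}.
        cmod (hess_laurent d n (of_real r * cis \<theta>) - boundary_extension \<phi> (cis \<theta>)) \<le> e"
      proof (intro exI[of _ N] conjI N(1) allI impI ballI)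
        fix n \<theta> assume n: "n \<ge> N"
        let ?z = "complex_of_real r * cis \<theta>"
        have nz: "cmod ?z = r" using r by (simp add: norm_mult)
        have sg: "sgn ?z = cis \<theta>" unfolding sgn_eq nz using r by simp
        have b: "boundary_extension \<phi> (cis \<theta>) = f (cis \<theta>)"
          by (rule boundary_extension_eq_symbol[OF f \<phi> hol]) simp_all
        have "cmod (hess_laurent d n ?z - f (cis \<theta>))
            \<le> cmod (hess_laurent d n ?z - ?z * tser (1 / ?z)) + cmod (?z * tser (1 / ?z) - f (cis \<theta>))"
          using norm_triangle_ineq[of "hess_laurent d n ?z - ?z * tser (1 / ?z)" "?z * tser (1 / ?z) - f (cis \<theta>)"] by simp
        also have "\<dots> \<le> e / 2 + e / 2"
          using N(2)[OF n nz] \<delta>(2)[of ?z] r unfolding nz sg by (intro add_mono) auto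
        finally show "cmod (hess_laurent d n ?z - boundary_extension \<phi> (cis \<theta>)) \<le> e"
          unfolding b by simp
      qed
    qed
  qed
qed

end
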